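(* Let $q$ be a fixed power of an odd prime and let $\gamma$ be a fixed generator of $\mathbb{F}_q^\times$. \begin{enumerate} \item For $s\in\mathbb{C}$ with $\mathrm{Re}(s)\ge\frac12$, as $g\to\infty$, $$\sum_{P\in\mathcal{P}_{2g+1}} L(s,\chi_P)=I_g(s)\frac{|P|}{\log_q|P|}+\begin{cases}O(|P|^{1-\frac s2}) & \text{if } \mathrm{Re}(s)<1,\\ O(|P|^{\frac12}\log_q|P|) & \text{if } \mathrm{Re}(s)\ge 1,\end{cases}$$ where $I_g(s)=g+1$ if $s=\frac12$; $I_g(s)=\zeta_{A}(2s)(1-q^{(1+g)(1-2s)})$ if $\frac12\le\mathrm{Re}(s)<1$, $s\ne\frac12$; and $I_g(s)=\zeta_A(2s)$ if $\mathrm{Re}(s)\ge1$. Here $|P|=q^{2g+1}$. \item For any $\epsilon>0$ and $s\in\mathbb{C}$ with $\mathrm{Re}(s)\ge\frac12$ and $|s-1|>\epsilon$, as $g\to\infty$, $$\sum_{P\in\mathcal{P}_{2g+2}} L(s,\chi_P)=J_g(s)\frac{|P|}{\log_q|P|}+\begin{cases}O(|P|^{1-\frac s2}) & \text{if } \mathrm{Re}(s)<1,\\ O(|P|^{\frac12}\log_q|P|) & \text{if } \mathrm{Re}(s)\ge 1,\ s\neq 1,\end{cases}$$ where $J_g(s)=g+1+\zeta_A(\frac12)$ if $s=\frac12$; $J_g(s)=\zeta_A(2s)J'_g(s)-\zeta_A(2)J^*_g(s)$ if $\frac12\le\mathrm{Re}(s)<1$, $s\ne\frac12$; $J_g(s)=\zeta_A(2s)J''_g(s)-\zeta_A(2)J^*_g(s)$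 if $1\le \mathrm{Re}(s)<\frac32$, $s\neq1$; $J_g(s)=\zeta_A(2s)$ if $\mathrm{Re}(s)\ge\frac32$; with $$J'_g(s)=1-q^{([\frac g2+1])(1-2s)}+\frac{\zeta_A(2-s)}{\zeta_A(1+s)}\left(q^{(g-[\frac{g-1}{2}])(1-2s)}-q^{(g+1)(1-2s)}\right),$$ $$J''_g(s)=1-q^{([\frac g2+1])(1-2s)}+\frac{\zeta_A(2-s)}{\zeta_A(1+s)}q^{(g-[\frac{g-1}{2}])(1-2s)},\qquad J^*_g(s)=q^{[\frac g2]-(g+1)s}+\frac{\zeta_A(2-s)}{\zeta_A(1+s)}q^{[\frac{g-1}2]-gs};$$ and for $s=1$, $$\sum_{P\in\mathcal{P}_{2g+2}}L(1,\chi_P)=\zeta_A(2)\frac{|P|}{\log_q|P|}+O(|P|^{\frac12}\log_q|P|).$$ Here $|P|=q^{2g+2}$. \item For $s\in\mathbb{C}$ with $\mathrm{Re}(s)\ge\frac12$, as $g\to\infty$, $$\sum_{P\in\mathcal{P}_{2g+2}} L(s,\chi_{\gamma P})=K_g(s)\frac{|P|}{\log_q|P|}+\begin{cases}O(|P|^{1-\frac s2}) & \text{if } \mathrm{Re}(s)<1,\\ O(|P|^{\frac12}\log_q|P|) & \text{if } \mathrm{Re}(s)\ge 1,\end{cases}$$ where $K_g(s)=g+1+\zeta_A(0)\zeta_A(\frac12)^{-1}$ if $s=\frac12$; $K_g(s)=\zeta_A(2s)K'_g(s)+\zeta_A(2)K^*_g(s)$ if $\frac12\le\mathrm{Re}(s)<1$,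 $s\neq\frac12$; $K_g(s)=\zeta_A(2s)K''_g(s)+\zeta_A(2)K^*_g(s)$ if $1\le\mathrm{Re}(s)<\frac32$; $K_g(s)=\zeta_A(2s)$ if $\mathrm{Re}(s)\ge\frac32$; with $$K'_g(s)=1-q^{([\frac g2+1])(1-2s)}+\frac{1+q^{-s}}{1+q^{s-1}}\left(q^{(g-[\frac{g-1}2])(1-2s)}-q^{(g+1)(1-2s)}\right),$$ $$K''_g(s)=1-q^{([\frac g2+1])(1-2s)}+\frac{1+q^{-s}}{1+q^{s-1}}q^{(g-[\frac{g-1}2])(1-2s)},$$ $$K^*_g(s)=(-1)^gq^{[\frac g2]-(g+1)s}+(-1)^{g+1}\frac{1+q^{-s}}{1+q^{s-1}}q^{[\frac{g-1}2]-gs}.$$ Here $|P|=q^{2g+2}$. \end{enumerate}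
   Context: $A=\mathbb{F}_q[T]$ with $q$ odd. For nonzero $f\in A$, $|f|=q^{\deg f}$. $\mathcal{P}_n$ is the set of monic irreducible polynomials of degree $n$ in $A$; in a sum over $P\in\mathcal{P}_n$, $|P|$ denotes the common value $q^n$. For a nonzero square-free $D\in A$, $\chi_D(f)=\left(\frac{D}{f}\right)$ is the Kronecker (Jacobi) symbol for $f\in A$ monic (multiplicative in $f$, and for $f$ monic irreducible equal to $0$ if $f\mid D$, $1$ if $D$ is a nonzero square mod $f$, $-1$ otherwise). $L(s,\chi_D)=\sum_{f\text{ monic}}\chi_D(f)|f|^{-s}$, which is a polynomial in $q^{-s}$ and hence defined for all $s\in\mathbb{C}$. $\zeta_A(s)=\frac{1}{1-q^{1-s}}$. $[x]$ denotes the integer part of $x$. Implied constants may depend on $q$.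
   Formalization: At the s ≠ 1/2 with q^(1−2s)=1, at q^s=q with s≠1 in J_g, and at q^s=−q in K_g, the displayed formulas are undefined and are read as their limits; s is fixed as g→∞, so implied constants may depend on s. *)

theory Defs
  imports
    "HOL-Complex_Analysis.Complex_Analysis"
    "HOL-Number_Theory.Cong"
    "HOL-Library.Landau_Symbols"
begin

(* The field F_q is a finite field type 'a with q = CARD('a), so A = F_q[T] is the type 'a poly. *)

definition monics :: "nat \<Rightarrow> 'a::{field,finite} poly set" where
  "monics n = {f. lead_coeff f = 1 \<and> degree f = n}"

definition monic_irreds :: "nat \<Rightarrow> 'a::{field,finite} poly set" where
  "monic_irreds n = {P. lead_coeff P = 1 \<and> irreducible P \<and> degree P = n}"

definition pnorm :: "'a::{field,finite} poly \<Rightarrow> nat" where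
  "pnorm f = CARD('a) ^ degree f"

definition poly_legendre :: "'a::{field,finite} poly \<Rightarrow> 'a poly \<Rightarrow> int" where
  "poly_legendre D P =
     (if P dvd D then 0 else if \<exists>h. [h ^ 2 = D] (mod P) then 1 else -1)"

(* The Jacobi symbol (D/f) for f monic: the multiplicative extension of the Legendre symbol
   along the factorization of f into monic irreducibles (in particular (D/1) = 1).
   The exponent is written as Max {n. P ^ n dvd f} because the constant multiplicity requires
   factorial_semiring, of which 'a poly is not an instance for a plain field 'a. *)
definition chi :: "'a::{field,finite} poly \<Rightarrow> 'a poly \<Rightarrow> int" where
  "chi D f = (\<Prod>P\<in>{P. lead_coeff P = 1 \<and> irreducible P \<and> P dvd f}.
                poly_legendre D P ^ Max {n. P ^ n dvd f})"

(* The Dirichlet series over monic polynomials, grouped by degree. If D is not a square times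
   a constant, the inner sums vanish for n \<ge> degree D, so that this is a polynomial in q^(-s)
   and gives the value of L(s, chi_D) for every complex s. *)
definition Lfun :: "complex \<Rightarrow> 'a::{field,finite} poly \<Rightarrow> complex" where
  "Lfun s D = (\<Sum>n. \<Sum>f\<in>monics n. of_int (chi D f) * of_nat (pnorm f) powr (- s))"

definition zetaA :: "nat \<Rightarrow> complex \<Rightarrow> complex" where
  "zetaA q s = 1 / (1 - of_nat q powr (1 - s))"

(* The closed forms below are quotients of polynomials in q^s and q^(-s). At finitely many points
   per period 2 pi i / ln q of s they read "0 times infinity" or "infinity minus infinity":
   at q^(1-2s) = 1 (a pole of zetaA q (2 * s)), and on the line Re s = 1 at q^s = q (a pole of
   zetaA q (2-s)), resp. at q^s = -q (a zero of 1 + q^(s-1)). All these singularities of the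
   complete expressions are removable, and the expressions are read as their continuous
   extensions there; since x / 0 = 0 in HOL, this has to be said explicitly, by remove_sings.
   Wherever all denominators are nonzero the expression is continuous
   and remove_sings does not change its value. *)

definition Imain :: "nat \<Rightarrow> nat \<Rightarrow> complex \<Rightarrow> complex" where
  "Imain q g s =
     (if s = 1/2 then of_nat g + 1
      else if Re s < 1 then
        remove_sings (\<lambda>z. zetaA q (2 * z) * (1 - of_nat q powr ((1 + of_nat g) * (1 - 2 * z)))) s
      else zetaA q (2 * s))"

definition J1 :: "nat \<Rightarrow> nat \<Rightarrow> complex \<Rightarrow> complex" where
  "J1 q g s =
     1 - of_nat q powr (of_int \<lfloor>real g / 2 + 1\<rfloor> * (1 - 2 * s))
     + zetaA q (2 - s) / zetaA q (1 + s) *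
       (of_nat q powr ((of_nat g - of_int \<lfloor>(real g - 1) / 2\<rfloor>) * (1 - 2 * s))
        - of_nat q powr ((of_nat g + 1) * (1 - 2 * s)))"

definition J2 :: "nat \<Rightarrow> nat \<Rightarrow> complex \<Rightarrow> complex" where
  "J2 q g s =
     1 - of_nat q powr (of_int \<lfloor>real g / 2 + 1\<rfloor> * (1 - 2 * s))
     + zetaA q (2 - s) / zetaA q (1 + s) *
       of_nat q powr ((of_nat g - of_int \<lfloor>(real g - 1) / 2\<rfloor>) * (1 - 2 * s))"

definition Jstar :: "nat \<Rightarrow> nat \<Rightarrow> complex \<Rightarrow> complex" where
  "Jstar q g s =
     of_nat q powr (of_int \<lfloor>real g / 2\<rfloor> - (of_nat g + 1) * s)
     + zetaA q (2 - s) / zetaA q (1 + s) *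
       of_nat q powr (of_int \<lfloor>(real g - 1) / 2\<rfloor> - of_nat g * s)"

(* The point s = 1 is treated separately in the theorem; Jmain is not used there. *)
definition Jmain :: "nat \<Rightarrow> nat \<Rightarrow> complex \<Rightarrow> complex" where
  "Jmain q g s =
     (if s = 1/2 then of_nat g + 1 + zetaA q (1/2)
      else if Re s < 1 then
        remove_sings (\<lambda>z. zetaA q (2 * z) * J1 q g z - zetaA q 2 * Jstar q g z) s
      else if Re s < 3/2 then
        remove_sings (\<lambda>z. zetaA q (2 * z) * J2 q g z - zetaA q 2 * Jstar q g z) s
      else zetaA q (2 * s))"

definition K1 :: "nat \<Rightarrow> nat \<Rightarrow> complex \<Rightarrow> complex" where
  "K1 q g s =
     1 - of_nat q powr (of_int \<lfloor>real g / 2 + 1\<rfloor> * (1 - 2 * s))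
     + (1 + of_nat q powr (- s)) / (1 + of_nat q powr (s - 1)) *
       (of_nat q powr ((of_nat g - of_int \<lfloor>(real g - 1) / 2\<rfloor>) * (1 - 2 * s))
        - of_nat q powr ((of_nat g + 1) * (1 - 2 * s)))"

definition K2 :: "nat \<Rightarrow> nat \<Rightarrow> complex \<Rightarrow> complex" where
  "K2 q g s =
     1 - of_nat q powr (of_int \<lfloor>real g / 2 + 1\<rfloor> * (1 - 2 * s))
     + (1 + of_nat q powr (- s)) / (1 + of_nat q powr (s - 1)) *
       of_nat q powr ((of_nat g - of_int \<lfloor>(real g - 1) / 2\<rfloor>) * (1 - 2 * s))"

definition Kstar :: "nat \<Rightarrow> nat \<Rightarrow> complex \<Rightarrow> complex" where
  "Kstar q g s =
     (- 1) ^ g * of_nat q powr (of_int \<lfloor>real g / 2\<rfloor> - (of_nat g + 1) * s)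
     + (- 1) ^ (g + 1) * ((1 + of_nat q powr (- s)) / (1 + of_nat q powr (s - 1))) *
       of_nat q powr (of_int \<lfloor>(real g - 1) / 2\<rfloor> - of_nat g * s)"

definition Kmain :: "nat \<Rightarrow> nat \<Rightarrow> complex \<Rightarrow> complex" where
  "Kmain q g s =
     (if s = 1/2 then of_nat g + 1 + zetaA q 0 * inverse (zetaA q (1/2))
      else if Re s < 1 then
        remove_sings (\<lambda>z. zetaA q (2 * z) * K1 q g z + zetaA q 2 * Kstar q g z) s
      else if Re s < 3/2 then
        remove_sings (\<lambda>z. zetaA q (2 * z) * K2 q g z + zetaA q 2 * Kstar q g z) s
      else zetaA q (2 * s))"

(* The error term as a function of N = |P|. For Re s < 1 it is a complex power of N; Landau's O
   only sees its modulus N powr (1 - Re s / 2). *)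
definition err :: "nat \<Rightarrow> complex \<Rightarrow> nat \<Rightarrow> complex" where
  "err q s N =
     (if Re s < 1 then of_nat N powr (1 - s / 2)
      else of_real (real N powr (1/2) * log (real q) (real N)))"

definition N_over_log :: "nat \<Rightarrow> nat \<Rightarrow> complex" where
  "N_over_log q N = of_real (real N / log (real q) (real N))"

end

theory Submission
  imports "HOL-Algebra.Algebraic_Closure_Type" Defs
begin

text \<open>The sum over $f$ of degree $n$ of $\chi_P(f)$ is evaluated, after summing over all $P$ of degree $m$, in two parts.
  If $f$ is a square, $\chi_P(f) = 1$, and these $f$ give the main term. If $f$ is not a square, quadratic
  reciprocity turns $\chi_P(f)$ into the quadratic character of $\mathbb{F}_{q^m}$ at $f(\alpha)$ for a root $\alpha$ of $P$,
  and Weil's bound, which Stepanov's method gives in an elementary way, shows that the sum over $P$ is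
  $O(q^g)$, uniformly in $f$. The functional equation of $L(s, \chi_P)$ expresses it by the coefficients of degree at most $g$.
  The functional equation itself is Fourier duality on $\mathbb{F}_q[T]/(P)$: with respect to the trace form
  $x \mapsto \mathrm{Tr}(x / P'(\alpha))$, the orthogonal complement of the polynomials of degree less than
  $k$ consists of the polynomials of degree less than $m - k$.\<close>

section \<open>Finite fields inside the algebraic closure\<close>

text \<open>Averaging over \<open>P\<close> is the same as averaging over roots: each prime of
  degree \<open>m\<close> is met \<open>m\<close> times, and this factor \<open>m\<close> cancels
  the degree of \<open>f\<close> (at most \<open>g < m\<close>) that Weil's bound carries. This is
  where uniformity in \<open>f\<close> comes from. With q^n polynomials of degree n the averaged
  n-th coefficient has error of order q^(g+n). Used up to n = 2g this would be too large: at s = 1/2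
  it sums to q^(2g), while the admissible error is q^(3g/2). Hence the functional equation is
  applied first, and only n \<le> g is estimated. Its sign comes without classical Gauss sums. In
  odd degree the middle coefficient is odd, hence nonzero, and cancelling it fixes the constant; in
  even degree the subfield with q^(m/2) elements, all of them squares, serves as a test space. In
  even degree L has the trivial zero q^(-s) = 1, so the partial sums of the coefficients, not the
  coefficients themselves, satisfy the symmetric relation. The exact main terms are finite sums,
  regular everywhere; the stated closed forms are compared with them, and it is through these sums
  that the removable singularities are resolved.\<close>

definition ac_poly :: "'a::field poly \<Rightarrow> 'a alg_closure poly" where
  "ac_poly f = map_poly to_ac f"

definition ev :: "'a::field poly \<Rightarrow> 'a alg_closure \<Rightarrow> 'a alg_closure" where
  "ev f x = poly (ac_poly f) x"

text \<open>All extensions live in one algebraic closure, as fixed sets of Frobenius powers, so that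
  inclusions of subfields are inclusions of sets. For \<open>m = 0\<close> this is the whole
  closure, which is why finiteness asks for \<open>m > 0\<close>.\<close>

definition GF :: "nat \<Rightarrow> 'a::{field,finite} alg_closure set" where
  "GF m = {x. x ^ (CARD('a) ^ m) = x}"

lemma coeff_ac_poly [simp]: "coeff (ac_poly f) n = to_ac (coeff f n)"
  by (simp add: ac_poly_def coeff_map_poly)

lemma degree_ac_poly [simp]: "degree (ac_poly f) = degree f"
  by (simp add: ac_poly_def degree_map_poly)

lemma ac_poly_0 [simp]: "ac_poly 0 = 0"
  and ac_poly_1 [simp]: "ac_poly 1 = 1"
  and ac_poly_pCons: "ac_poly (pCons a p) = pCons (to_ac a) (ac_poly p)"
  and ac_poly_monom: "ac_poly (monom a n) = monom (to_ac a) n"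
  by (simp_all add: ac_poly_def map_poly_pCons map_poly_monom)

lemma ac_poly_eq_iff [simp]: "ac_poly f = ac_poly g \<longleftrightarrow> f = g"
  by (auto simp: poly_eq_iff)

lemma ac_poly_eq_0_iff [simp]: "ac_poly f = 0 \<longleftrightarrow> f = 0"
  using ac_poly_eq_iff[of f 0] by (simp del: ac_poly_eq_iff)

lemma ac_poly_add [simp]: "ac_poly (f + g) = ac_poly f + ac_poly g"
  and ac_poly_diff [simp]: "ac_poly (f - g) = ac_poly f - ac_poly g"
  and ac_poly_minus [simp]: "ac_poly (- f) = - ac_poly f"
  and ac_poly_smult [simp]: "ac_poly (smult c f) = smult (to_ac c) (ac_poly f)"
  by (auto simp: poly_eq_iff)

lemma ac_poly_mult [simp]: "ac_poly (f * g) = ac_poly f * ac_poly g"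
  by (auto simp: poly_eq_iff coeff_mult to_ac_sum)

lemma ac_poly_power [simp]: "ac_poly (f ^ n) = ac_poly f ^ n"
  by (induction n) auto

lemma ac_poly_sum: "ac_poly (sum h A) = (\<Sum>x\<in>A. ac_poly (h x))"
  by (induction A rule: infinite_finite_induct) auto

lemma ev_simps [simp]:
  "ev 0 x = 0" "ev 1 x = 1" "ev (f + g) x = ev f x + ev g x" "ev (f - g) x = ev f x - ev g x"
  "ev (- f) x = - ev f x" "ev (f * g) x = ev f x * ev g x" "ev (f ^ n) x = ev f x ^ n"
  "ev (smult c f) x = to_ac c * ev f x" "ev (monom c n) x = to_ac c * x ^ n"
  "ev [:c:] x = to_ac c" "ev (pCons c f) x = to_ac c + x * ev f x"
  by (simp_all add: ev_def ac_poly_pCons ac_poly_monom poly_monom)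

lemma ev_sum: "ev (sum h A) x = (\<Sum>i\<in>A. ev (h i) x)"
  by (simp add: ev_def ac_poly_sum poly_sum)

section \<open>Frobenius on F_q, on its closure and on polynomials\<close>

lemma card_gt_1: "CARD('a::{field,finite}) > 1"
proof -
  have "card {0::'a, 1} \<le> CARD('a)" by (rule card_mono) auto
  thus ?thesis by simp
qed

lemma power_card_minus_1:
  fixes x :: "'a::{field,finite}"
  assumes "x \<noteq> 0"
  shows "x ^ (CARD('a) - 1) = 1"
proof -
  let ?U = "UNIV - {0::'a}"
  have bij: "bij_betw (\<lambda>y. x * y) ?U ?U"
    by (rule bij_betw_byWitness[of _ "\<lambda>y. y / x"]) (use assms in auto)
  have "(\<Prod>y\<in>?U. y) = (\<Prod>y\<in>?U. x * y)"
    using prod.reindex_bij_betw[OF bij, of "\<lambda>y. y"] by simp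
  also have "\<dots> = x ^ card ?U * (\<Prod>y\<in>?U. y)"
    by (simp add: prod.distrib)
  finally have "x ^ card ?U = 1" by simp
  thus ?thesis by (simp add: card_Diff_subset)
qed

lemma power_card [simp]:
  fixes x :: "'a::{field,finite}"
  shows "x ^ CARD('a) = x"
proof (cases "x = 0")
  case False
  have "x ^ CARD('a) = x ^ (Suc (CARD('a) - 1))" using card_gt_1[where 'a='a] by simp
  then show ?thesis using power_card_minus_1[OF False] by (simp only: power_Suc) simp
qed (use card_gt_1[where 'a='a] in auto)

lemma power_card_power [simp]:
  fixes x :: "'a::{field,finite}"
  shows "x ^ (CARD('a) ^ m) = x"
  by (induction m) (simp_all add: power_mult)

text \<open>The binomial coefficients vanish because $(X + 1)^q - X^q - 1$ has degree less than $q$ and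
  vanishes on all of $\mathbb{F}_q$.\<close>

lemma of_nat_choose_card_eq_0:
  assumes "0 < k" "k < CARD('a::{field,finite})"
  shows "of_nat (CARD('a) choose k) = (0::'a)"
proof -
  let ?q = "CARD('a)"
  define p :: "'a poly" where "p = (\<Sum>k\<in>{0<..<?q}. monom (of_nat (?q choose k)) k)"
  have "poly p x = 0" for x
  proof -
    have "x + 1 = (x + 1) ^ ?q" by simp
    also have "\<dots> = (\<Sum>k\<le>?q. of_nat (?q choose k) * x ^ k)"
      by (subst binomial_ring) simp
    also have "{..?q} = insert 0 (insert ?q {0<..<?q})" by auto
    finally show ?thesis using card_gt_1[where 'a='a]
      by (simp add: p_def poly_sum poly_monom)
  qed
  moreover have "degree p \<le> ?q - 1"
    unfolding p_def by (intro degree_sum_le) (auto intro: order.trans[OF degree_monom_le])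
  ultimately have "p = 0"
    using card_gt_1[where 'a='a] by (intro poly_eqI_degree[of UNIV]) auto
  moreover have "coeff p k = of_nat (?q choose k)"
    using assms by (simp add: p_def coeff_sum)
  ultimately show ?thesis by simp
qed

text \<open>The hypothesis on binomial coefficients replaces a prime exponent: q is a prime power
  whose prime is never named. The lemma serves the closure and the polynomial ring alike.\<close>

lemma add_power_card:
  fixes x y :: "'b::comm_semiring_1"
  assumes "\<And>k. 0 < k \<Longrightarrow> k < n \<Longrightarrow> of_nat (n choose k) = (0::'b)" "n > 0"
  shows "(x + y) ^ n = x ^ n + y ^ n"
proof -
  have "(x + y) ^ n = (\<Sum>k\<le>n. of_nat (n choose k) * x ^ k * y ^ (n - k))"
    by (rule binomial_ring)
  also have "\<dots> = (\<Sum>k\<in>{0,n}. of_nat (n choose k) * x ^ k * y ^ (n - k))"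
    by (rule sum.mono_neutral_right) (use assms in auto)
  finally show ?thesis using assms by (simp add: add.commute)
qed

lemma frob_add:
  fixes x y :: "'a::{field,finite} alg_closure"
  shows "(x + y) ^ (CARD('a) ^ m) = x ^ (CARD('a) ^ m) + y ^ (CARD('a) ^ m)"
proof (induction m)
  case (Suc m)
  have "of_nat (CARD('a) choose k) = (0::'a alg_closure)" if "0 < k" "k < CARD('a)" for k
    using of_nat_choose_card_eq_0[OF that] by (metis to_ac_0 to_ac_of_nat)
  hence "(u + v) ^ CARD('a) = u ^ CARD('a) + v ^ CARD('a)" for u v :: "'a alg_closure"
    by (intro add_power_card) auto
  with Suc show ?case
    by (simp add: power_mult mult.commute[of "CARD('a)"] del: power_Suc add: power_Suc2)
qed auto

lemma frob_poly_add:
  fixes x y :: "'a::{field,finite} poly"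
  shows "(x + y) ^ (CARD('a) ^ m) = x ^ (CARD('a) ^ m) + y ^ (CARD('a) ^ m)"
proof (induction m)
  case (Suc m)
  have "of_nat (CARD('a) choose k) = (0::'a poly)" if "0 < k" "k < CARD('a)" for k
    using of_nat_choose_card_eq_0[OF that] by (simp add: of_nat_poly)
  hence "(u + v) ^ CARD('a) = u ^ CARD('a) + v ^ CARD('a)" for u v :: "'a poly"
    by (intro add_power_card) auto
  with Suc show ?case
    by (simp add: power_mult mult.commute[of "CARD('a)"] del: power_Suc add: power_Suc2)
qed auto

lemma frob_minus:
  fixes x :: "'a::{field,finite} alg_closure"
  shows "(- x) ^ (CARD('a) ^ m) = - (x ^ (CARD('a) ^ m))"
  using frob_add[of x "-x" m] card_gt_1[where 'a='a]
  by (simp add: zero_power eq_neg_iff_add_eq_0 add.commute)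

lemma frob_diff:
  fixes x y :: "'a::{field,finite} alg_closure"
  shows "(x - y) ^ (CARD('a) ^ m) = x ^ (CARD('a) ^ m) - y ^ (CARD('a) ^ m)"
  using frob_add[of x "-y" m] by (simp add: frob_minus)

lemma frob_inj:
  fixes x y :: "'a::{field,finite} alg_closure"
  assumes "x ^ (CARD('a) ^ m) = y ^ (CARD('a) ^ m)"
  shows "x = y"
proof -
  have "(x - y) ^ (CARD('a) ^ m) = 0" using assms by (simp add: frob_diff)
  thus ?thesis by simp
qed

lemma to_ac_frob [simp]:
  fixes c :: "'a::{field,finite}"
  shows "to_ac c ^ (CARD('a) ^ m) = to_ac c"
  by (metis power_card_power to_ac_power)

lemma ev_frob:
  fixes f :: "'a::{field,finite} poly"
  shows "ev f x ^ (CARD('a) ^ m) = ev f (x ^ (CARD('a) ^ m))"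
  by (induction f) (simp_all add: zero_power frob_add power_mult_distrib)

text \<open>The coefficients are fixed by Frobenius. Stepanov's argument uses this to read f^Q as f
  evaluated at T^Q.\<close>

lemma poly_frob:
  fixes f :: "'a::{field,finite} poly"
  shows "f ^ (CARD('a) ^ m) = pcompose f (monom 1 (CARD('a) ^ m))"
proof (induction f)
  case (pCons a p)
  have "pCons a p ^ (CARD('a) ^ m) = ([:a:] + monom 1 1 * p) ^ (CARD('a) ^ m)"
    by (simp add: monom_altdef)
  also have "\<dots> = [:a:] + monom 1 (CARD('a) ^ m) * p ^ (CARD('a) ^ m)"
    by (simp only: frob_poly_add power_mult_distrib poly_const_pow power_card_power monom_power) simp
  finally show ?case using pCons by (simp add: pcompose_pCons)
qed (simp add: zero_power)

section \<open>The fields with q^m elements\<close>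

lemma GF_0 [simp]: "0 \<in> GF m" and GF_1 [simp]: "1 \<in> GF m"
  and GF_to_ac [simp]: "to_ac c \<in> GF m"
  by (simp_all add: GF_def zero_power)

lemma GF_add [intro]: "x \<in> GF m \<Longrightarrow> y \<in> GF m \<Longrightarrow> x + y \<in> GF m"
  and GF_diff [intro]: "x \<in> GF m \<Longrightarrow> y \<in> GF m \<Longrightarrow> x - y \<in> GF m"
  and GF_mult [intro]: "x \<in> GF m \<Longrightarrow> y \<in> GF m \<Longrightarrow> x * y \<in> GF m"
  and GF_minus [intro]: "x \<in> GF m \<Longrightarrow> - x \<in> GF m"
  and GF_power [intro]: "x \<in> GF m \<Longrightarrow> x ^ n \<in> GF m"
  and GF_inverse [intro]: "x \<in> GF m \<Longrightarrow> inverse x \<in> GF m"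
  and GF_divide [intro]: "x \<in> GF m \<Longrightarrow> y \<in> GF m \<Longrightarrow> x / y \<in> GF m"
  by (auto simp: GF_def frob_add frob_diff power_mult_distrib frob_minus power_inverse power_divide)
     (metis mult.commute power_mult)

lemma GF_ev [intro]: "x \<in> GF m \<Longrightarrow> ev f x \<in> GF m"
  unfolding GF_def by (simp add: ev_frob)

lemma GF_sum [intro]: "(\<And>i. i \<in> A \<Longrightarrow> h i \<in> GF m) \<Longrightarrow> sum h A \<in> GF m"
  by (induction A rule: infinite_finite_induct) auto

lemma GF_mono: "k dvd m \<Longrightarrow> GF k \<subseteq> (GF m :: 'a::{field,finite} alg_closure set)"
proof -
  assume "k dvd m"
  then obtain t where t: "m = k * t" by (elim dvdE)
  have "x ^ (CARD('a) ^ (k * t)) = x" if "x ^ (CARD('a) ^ k) = x" for x :: "'a alg_closure"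
    by (induction t) (use that in \<open>simp_all add: power_add power_mult\<close>)
  thus ?thesis by (auto simp: GF_def t)
qed

text \<open>X^Q - X has derivative -1, hence no multiple root. Since it splits over the closure, the
  multiset \<open>A\<close> of its roots is a set with Q elements.\<close>

lemma finite_GF_aux:
  assumes "m > 0"
  shows "finite (GF m :: 'a::{field,finite} alg_closure set)" "card (GF m :: 'a alg_closure set) = CARD('a) ^ m"
proof -
  define Q where "Q = CARD('a) ^ m"
  have Q: "Q > 1" unfolding Q_def by (rule one_less_power[OF card_gt_1 assms])
  define p :: "'a alg_closure poly" where "p = monom 1 Q - monom 1 1"
  have deg: "degree p = Q"
    unfolding p_def using Q by (subst diff_conv_add_uminus, subst degree_add_eq_left)
      (auto simp: degree_monom_eq)
  have [simp]: "p \<noteq> 0" using deg Q by auto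
  have roots: "GF m = {x. poly p x = 0}" by (auto simp: GF_def p_def poly_monom Q_def)
  have "of_nat Q = (0::'a alg_closure)"
  proof -
    have "of_nat (CARD('a) choose 1) = (0::'a)"
      by (rule of_nat_choose_card_eq_0) (use card_gt_1[where 'a='a] in auto)
    hence "of_nat CARD('a) = (0::'a alg_closure)" by (metis choose_one to_ac_0 to_ac_of_nat)
    thus ?thesis using assms by (simp add: Q_def zero_power)
  qed
  hence "pderiv p = -1" by (simp add: p_def pderiv_diff pderiv_monom)
  hence pd: "poly (pderiv p) x \<noteq> 0" for x by simp
  obtain A where A: "size A = degree p" "p = smult (lead_coeff p) (\<Prod>x\<in>#A. [:-x, 1:])"
    using alg_closed_imp_factorization[of p] by auto
  have set_A: "set_mset A = GF m"
  proof -
    have "poly p x = 0 \<longleftrightarrow> x \<in># A" for x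
      by (subst A(2)) (auto simp: poly_prod_mset prod_mset_zero_iff image_iff)
    thus ?thesis by (auto simp: roots)
  qed
  have "count A x \<le> 1" for x
  proof (rule ccontr)
    assume "\<not> count A x \<le> 1"
    hence "2 \<le> count A x" by simp
    hence "x \<in># A" "x \<in># A - {#x#}" by (auto simp flip: count_greater_zero_iff)
    hence B: "A = add_mset x (add_mset x (A - {#x#} - {#x#}))"
      by (metis insert_DiffM)
    define B where "B = A - {#x#} - {#x#}"
    have "p = [:-x,1:] * ([:-x,1:] * smult (lead_coeff p) (\<Prod>x\<in>#B. [:-x, 1:]))"
      by (subst A(2), subst B, fold B_def)
        (simp only: image_mset_add_mset prod_mset.add_mset mult_smult_right mult.assoc)
    then obtain h where h: "p = [:-x,1:] * ([:-x,1:] * h)" ..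
    have "poly (pderiv p) x = 0"
      by (subst h, simp only: pderiv_mult poly_add poly_mult) simp
    thus False using pd by blast
  qed
  hence "A = mset_set (set_mset A)"
    by (intro multiset_eqI) (metis count_greater_zero_iff count_mset_set(1,3) finite_set_mset
        le_neq_implies_less less_one not_gr_zero)
  hence "size A = card (set_mset A)" by (metis size_mset_set)
  thus "card (GF m :: 'a alg_closure set) = CARD('a) ^ m"
    using A(1) by (simp add: set_A deg Q_def)
  show "finite (GF m :: 'a alg_closure set)" by (metis finite_set_mset set_A)
qed

lemmas finite_GF [simp] = finite_GF_aux(1) and card_GF = finite_GF_aux(2)

lemma GF_1_eq: "GF 1 = range (to_ac :: 'a::{field,finite} \<Rightarrow> _)"
proof (rule card_seteq[symmetric])
  show "card (GF 1 :: 'a alg_closure set) \<le> card (range (to_ac :: 'a \<Rightarrow> _))"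
    by (simp add: card_GF card_image inj_to_ac)
qed auto


section \<open>The quadratic character\<close>

text \<open>The quadratic character of \<open>GF m\<close>, by Euler's criterion. Its values are
  integers, so that character sums can be compared and counted; identities are checked in the
  closure, where the character is a power, and pulled back by
  \<open>of_int_sign_inj\<close>.\<close>

definition eta :: "nat \<Rightarrow> 'a::{field,finite} alg_closure \<Rightarrow> int" where
  "eta m x = (if x = 0 then 0 else if x ^ ((CARD('a) ^ m - 1) div 2) = 1 then 1 else - 1)"

lemma two_neq_0:
  assumes "odd CARD('a::{field,finite})"
  shows "(2::'a alg_closure) \<noteq> 0"
proof
  assume "(2::'a alg_closure) = 0"
  moreover have "of_nat CARD('a) = (0::'a alg_closure)"
  proof -
    have "of_nat (CARD('a) choose 1) = (0::'a)"
      by (rule of_nat_choose_card_eq_0) (use card_gt_1[where 'a='a] in auto)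
    thus ?thesis by (metis choose_one to_ac_0 to_ac_of_nat)
  qed
  moreover obtain k where "CARD('a) = 2 * k + 1" using assms by (elim oddE)
  ultimately show False by simp
qed

lemma one_neq_minus_one:
  assumes "odd CARD('a::{field,finite})"
  shows "(1::'a alg_closure) \<noteq> - 1" "(- 1::'a alg_closure) \<noteq> 1"
  using two_neq_0[OF assms] by (metis add.left_inverse add_eq_0_iff one_add_one)+

lemma two_mul_half:
  assumes "odd CARD('a::{field,finite})"
  shows "2 * ((CARD('a) ^ m - 1) div 2) = CARD('a) ^ m - 1"
  using assms by (simp add: even_two_times_div_two)

lemma GF_power_minus_1:
  assumes "x \<in> (GF m :: 'a::{field,finite} alg_closure set)" "x \<noteq> 0"
  shows "x ^ (CARD('a) ^ m - 1) = 1"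
proof -
  have "x ^ (CARD('a) ^ m - 1) * x = 1 * x"
    using assms by (simp add: GF_def flip: power_Suc2)
  thus ?thesis using assms by simp
qed

lemma half_power_cases:
  assumes "odd CARD('a::{field,finite})" "x \<in> (GF m :: 'a alg_closure set)" "x \<noteq> 0"
  shows "x ^ ((CARD('a) ^ m - 1) div 2) = 1 \<or> x ^ ((CARD('a) ^ m - 1) div 2) = - 1"
proof -
  have "(x ^ ((CARD('a) ^ m - 1) div 2)) ^ 2 = 1"
    using GF_power_minus_1[OF assms(2,3)] two_mul_half[OF assms(1), of m]
    by (simp add: mult.commute flip: power_mult)
  thus ?thesis by (simp add: power2_eq_1_iff)
qed

lemma of_int_eta:
  assumes "odd CARD('a::{field,finite})" "x \<in> (GF m :: 'a alg_closure set)" "m > 0"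
  shows "of_int (eta m x) = x ^ ((CARD('a) ^ m - 1) div 2)"
proof -
  have "CARD('a) ^ m > 1" by (rule one_less_power[OF card_gt_1 assms(3)])
  hence "(CARD('a) ^ m - 1) div 2 > 0"
    using two_mul_half[OF assms(1), of m] by (metis less_not_refl2 mult_0_right neq0_conv zero_less_diff)
  thus ?thesis using half_power_cases[OF assms(1,2)] by (auto simp: eta_def zero_power)
qed

lemma eta_cases: "eta m x \<in> {-1, 0, 1}"
  by (simp add: eta_def)

lemma eta_0 [simp]: "eta m 0 = 0" and eta_eq_0_iff [simp]: "eta m x = 0 \<longleftrightarrow> x = 0"
  and eta_1 [simp]: "eta m 1 = 1" and abs_eta_le: "\<bar>eta m x\<bar> \<le> 1"
  by (auto simp: eta_def)

lemma of_int_sign_inj: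
  assumes "odd CARD('a::{field,finite})" "a \<in> {-1,0,1}" "b \<in> {-1,0,1}" "of_int a = (of_int b :: 'a alg_closure)"
  shows "a = b"
  using assms one_neq_minus_one[OF assms(1)] by auto

lemma eta_eqI:
  assumes "odd CARD('a::{field,finite})" "x \<in> (GF m :: 'a alg_closure set)" "m > 0" "a \<in> {-1,0,1}"
    "x ^ ((CARD('a) ^ m - 1) div 2) = of_int a"
  shows "eta m x = a"
  using of_int_sign_inj[OF assms(1) eta_cases assms(4), of m x] of_int_eta[OF assms(1-3)] assms(5) by simp

lemma eta_mult:
  assumes "odd CARD('a::{field,finite})" "x \<in> (GF m :: 'a alg_closure set)" "y \<in> GF m" "m > 0"
  shows "eta m (x * y) = eta m x * eta m y"
proof (rule eta_eqI)
  show "eta m x * eta m y \<in> {-1,0,1}" using eta_cases[of m x] eta_cases[of m y] by auto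
  show "(x * y) ^ ((CARD('a) ^ m - 1) div 2) = of_int (eta m x * eta m y)"
    using assms by (simp add: of_int_eta power_mult_distrib)
qed (use assms in auto)

lemma eta_power:
  assumes "odd CARD('a::{field,finite})" "x \<in> (GF m :: 'a alg_closure set)" "m > 0"
  shows "eta m (x ^ n) = eta m x ^ n"
  by (induction n) (use assms in \<open>auto simp: eta_mult GF_power\<close>)

lemma eta_prod:
  assumes "odd CARD('a::{field,finite})" "m > 0" "\<And>i. i \<in> A \<Longrightarrow> h i \<in> (GF m :: 'a alg_closure set)"
  shows "eta m (prod h A) = (\<Prod>i\<in>A. eta m (h i))"
  using assms(3)
proof (induction A rule: infinite_finite_induct)
  case (insert x F)
  have "prod h F \<in> GF m" using insert.prems
    by (induction F rule: infinite_finite_induct) auto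
  thus ?case using insert assms by (simp add: eta_mult)
qed auto

lemma eta_square:
  assumes "odd CARD('a::{field,finite})" "x \<in> (GF m :: 'a alg_closure set)" "m > 0" "x \<noteq> 0"
  shows "eta m (x * x) = 1"
  using assms eta_cases[of m x] by (auto simp: eta_mult)

lemma card_squares_GF:
  assumes "odd CARD('a::{field,finite})" "m > 0"
  shows "2 * card ((\<lambda>y. y ^ 2) ` (GF m - {0 :: 'a alg_closure})) = CARD('a) ^ m - 1"
proof -
  let ?G = "GF m - {0 :: 'a alg_closure}" and ?S = "(\<lambda>y. y ^ 2) ` (GF m - {0 :: 'a alg_closure})"
  have fin: "finite ?G" using assms by simp
  have "card ?G = (\<Sum>z\<in>?S. card {y \<in> ?G. y ^ 2 = z})"
    using sum.group[of ?G ?S "\<lambda>y. y ^ 2" "\<lambda>_. 1::nat"] fin by simp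
  also have "\<dots> = (\<Sum>z\<in>?S. 2)"
  proof (rule sum.cong)
    fix z assume "z \<in> ?S"
    then obtain y where y: "y \<in> ?G" "z = y ^ 2" by auto
    have "{w \<in> ?G. w ^ 2 = z} = {y, - y}"
      using y by (auto simp: power2_eq_iff)
    moreover have "y \<noteq> - y"
      using y two_neq_0[OF assms(1)] by (metis Diff_iff add_eq_0_iff2 insertI1 mult_2 mult_eq_0_iff neg_eq_iff_add_eq_0 add.right_inverse)
    ultimately show "card {w \<in> ?G. w ^ 2 = z} = 2" by simp
  qed simp
  finally show ?thesis using assms by (simp add: card_GF card_Diff_subset)
qed

text \<open>Nonzero squares are roots of X^c - 1 with c = (q^m - 1)/2. Squaring is two-to-one on
  nonzero elements, so there are c squares and they exhaust the roots.\<close>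

lemma eta_eq_1_iff:
  assumes odd: "odd CARD('a::{field,finite})" and m: "m > 0" and x: "x \<in> (GF m :: 'a alg_closure set)"
  shows "eta m x = 1 \<longleftrightarrow> x \<noteq> 0 \<and> (\<exists>y\<in>GF m. y ^ 2 = x)"
proof -
  let ?c = "(CARD('a) ^ m - 1) div 2"
  let ?S = "(\<lambda>y. y ^ 2) ` (GF m - {0 :: 'a alg_closure})"
  let ?R = "{x :: 'a alg_closure. poly (monom 1 ?c - 1) x = 0}"
  have "CARD('a) ^ m > 1" by (rule one_less_power[OF card_gt_1 m])
  hence c: "?c > 0"
    using two_mul_half[OF odd, of m] by (metis less_not_refl2 mult_0_right neq0_conv zero_less_diff)
  have deg: "degree (monom 1 ?c - 1 :: 'a alg_closure poly) = ?c"
    using c by (subst diff_conv_add_uminus, subst degree_add_eq_left) (auto simp: degree_monom_eq)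
  hence nz: "(monom 1 ?c - 1 :: 'a alg_closure poly) \<noteq> 0" using c by force
  have "?S \<subseteq> ?R"
  proof
    fix z assume "z \<in> ?S"
    then obtain y where y: "y \<in> GF m" "y \<noteq> 0" "z = y ^ 2" by auto
    hence "z ^ ?c = 1" using GF_power_minus_1[of y m] two_mul_half[OF odd, of m]
      by (simp flip: power_mult)
    thus "z \<in> ?R" by (simp add: poly_monom)
  qed
  moreover have "card ?R \<le> card ?S"
    using card_poly_roots_bound[OF nz] deg card_squares_GF[OF odd m] two_mul_half[OF odd, of m] by simp
  ultimately have "?S = ?R" using nz by (intro card_seteq poly_roots_finite)
  hence "x \<in> ?S \<longleftrightarrow> x \<in> ?R" by simp
  moreover have "x \<in> ?S \<longleftrightarrow> x \<noteq> 0 \<and> (\<exists>y\<in>GF m. y ^ 2 = x)"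
    by (auto simp: image_iff)
  moreover have "x \<in> ?R \<longleftrightarrow> eta m x = 1"
    using c by (auto simp: eta_def poly_monom zero_power)
  ultimately show ?thesis by blast
qed

lemma exists_eta_minus_1:
  assumes odd: "odd CARD('a::{field,finite})" and m: "m > 0"
  shows "\<exists>z \<in> (GF m :: 'a alg_closure set). eta m z = -1"
proof (rule ccontr)
  assume "\<not> ?thesis"
  hence "eta m z = 1" if "z \<in> (GF m :: 'a alg_closure set)" "z \<noteq> 0" for z
    using that eta_cases[of m z] by auto
  hence "GF m - {0 :: 'a alg_closure} \<subseteq> (\<lambda>y. y ^ 2) ` (GF m - {0})"
    using eta_eq_1_iff[OF odd m] by (fastforce simp: image_iff)
  hence "card (GF m - {0 :: 'a alg_closure}) \<le> card ((\<lambda>y. y ^ 2) ` (GF m - {0 :: 'a alg_closure}))"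
    using m by (intro card_mono) auto
  hence "CARD('a) ^ m - 1 \<le> card ((\<lambda>y. y ^ 2) ` (GF m - {0 :: 'a alg_closure}))"
    using m by (simp add: card_GF card_Diff_subset)
  moreover have "CARD('a) ^ m > 1" by (rule one_less_power[OF card_gt_1 m])
  ultimately show False using card_squares_GF[OF odd m] by linarith
qed

lemma bij_betw_GF_mult:
  assumes "z \<in> (GF m :: 'a::{field,finite} alg_closure set)" "z \<noteq> 0"
  shows "bij_betw (\<lambda>x. z * x) (GF m) (GF m)"
  by (rule bij_betw_byWitness[of _ "\<lambda>x. x / z"]) (use assms in auto)

lemma sum_eta_GF:
  assumes odd: "odd CARD('a::{field,finite})" and m: "m > 0"
  shows "(\<Sum>x\<in>(GF m :: 'a alg_closure set). eta m x) = 0"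
proof -
  obtain z where z: "z \<in> (GF m :: 'a alg_closure set)" "eta m z = -1"
    using exists_eta_minus_1[OF assms] by auto
  have "z \<noteq> 0" using z by auto
  have "(\<Sum>x\<in>(GF m :: 'a alg_closure set). eta m x) = (\<Sum>x\<in>GF m. eta m (z * x))"
    using sum.reindex_bij_betw[OF bij_betw_GF_mult[OF z(1) \<open>z \<noteq> 0\<close>], of "eta m"] by simp
  also have "\<dots> = (\<Sum>x\<in>(GF m :: 'a alg_closure set). - eta m x)"
    by (rule sum.cong) (use z odd m in \<open>auto simp: eta_mult\<close>)
  finally show ?thesis by (simp add: sum_negf)
qed

text \<open>Frobenius is injective and fixes 1. This will pair the conjugate differences in
  \<open>even_gauss_sum\<close>.\<close>

lemma eta_frob:
  assumes "x \<in> (GF m :: 'a::{field,finite} alg_closure set)"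
  shows "eta m (x ^ (CARD('a) ^ k)) = eta m x"
proof -
  have "(x ^ n) ^ (CARD('a) ^ k) = 1 \<longleftrightarrow> x ^ n = 1" for n
    using frob_inj[of "x ^ n" k 1] by auto
  thus ?thesis by (simp add: eta_def power_mult[symmetric] mult.commute[of "CARD('a) ^ k"])
qed

section \<open>Irreducible polynomials and their roots\<close>

text \<open>Written with coefficients so that \<open>polys 0\<close> is the zero space and dimension
  counts hold for every n; the condition \<open>degree f < n\<close> would lose the zero polynomial
  at n = 0.\<close>

definition polys :: "nat \<Rightarrow> 'a::zero poly set" where
  "polys n = {f. \<forall>k\<ge>n. coeff f k = 0}"

lemma polys_iff_degree: "n > 0 \<Longrightarrow> f \<in> polys n \<longleftrightarrow> degree f < n"
  unfolding polys_def by (auto intro: coeff_eq_0 degree_lessI)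

lemma polys_Suc: "polys (Suc n) = (\<lambda>(c, f). pCons c f) ` (UNIV \<times> polys n)"
proof (intro Set.set_eqI iffI)
  fix f :: "'a poly" assume f: "f \<in> polys (Suc n)"
  obtain c g where "f = pCons c g" by (cases f)
  with f have "g \<in> polys n" by (force simp: polys_def coeff_pCons split: nat.splits)
  with \<open>f = pCons c g\<close> show "f \<in> (\<lambda>(c, f). pCons c f) ` (UNIV \<times> polys n)" by auto
qed (auto simp: polys_def coeff_pCons split: nat.splits)

lemma finite_card_polys:
  "finite (polys n :: 'a::{field,finite} poly set) \<and> card (polys n :: 'a poly set) = CARD('a) ^ n"
proof (induction n)
  case 0
  have "polys 0 = {0::'a poly}" by (auto simp: polys_def poly_eq_iff)
  thus ?case by simp
next
  case (Suc n)
  have "inj_on (\<lambda>(c, f). pCons c f) (UNIV \<times> (polys n :: 'a poly set))"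
    by (rule inj_onI) (clarsimp simp: pCons_eq_iff)
  thus ?case using Suc by (simp add: polys_Suc card_image card_cartesian_product)
qed

lemmas finite_polys [simp] = finite_card_polys[THEN conjunct1]
  and card_polys = finite_card_polys[THEN conjunct2]

lemma monics_eq: "monics n = (\<lambda>f. monom 1 n + f) ` (polys n :: 'a::{field,finite} poly set)"
proof (intro Set.set_eqI iffI)
  fix f :: "'a poly" assume f: "f \<in> monics n"
  hence "f - monom 1 n \<in> polys n"
    unfolding polys_def monics_def by (auto simp: coeff_eq_0)
  moreover have "f = monom 1 n + (f - monom 1 n)" by simp
  ultimately show "f \<in> (\<lambda>f. monom 1 n + f) ` polys n"
    by (rule rev_image_eqI)
next
  fix f :: "'a poly" assume "f \<in> (\<lambda>f. monom 1 n + f) ` polys n"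
  then obtain g where g: "f = monom 1 n + g" "g \<in> polys n" by auto
  have n: "coeff f n = 1" using g by (simp add: polys_def)
  moreover have "coeff f k = 0" if "k > n" for k using that g by (simp add: polys_def)
  ultimately have "degree f = n"
    by (intro antisym degree_le le_degree) auto
  with n show "f \<in> monics n" by (simp add: monics_def)
qed

lemma finite_monics [simp]: "finite (monics n :: 'a::{field,finite} poly set)"
  by (simp add: monics_eq)

lemma card_monics: "card (monics n :: 'a::{field,finite} poly set) = CARD('a) ^ n"
  unfolding monics_eq by (subst card_image) (auto simp: inj_on_def card_polys)

lemma monic_irreds_subset: "monic_irreds n \<subseteq> monics n"
  by (auto simp: monic_irreds_def monics_def)

lemma finite_monic_irreds [simp]: "finite (monic_irreds n :: 'a::{field,finite} poly set)"
  using monic_irreds_subset finite_monics by (rule finite_subset)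

lemma irreducible_degree_pos:
  assumes "irreducible (P :: 'a::field poly)"
  shows "degree P > 0"
  using assms by (metis irreducible_def is_unit_iff_degree neq0_conv)

lemma least_annihilator:
  fixes x :: "'a::field alg_closure"
  obtains g where "g \<noteq> 0" "ev g x = 0" "\<And>f. ev f x = 0 \<longleftrightarrow> g dvd f"
proof -
  obtain p where "p \<noteq> 0" "poly (map_poly to_ac p) x = 0"
    by (rule alg_closure_algebraic)
  hence "p \<noteq> 0 \<and> ev p x = 0" by (simp add: ev_def ac_poly_def)
  then obtain g where g: "g \<noteq> 0" "ev g x = 0"
    and least: "\<And>f. f \<noteq> 0 \<Longrightarrow> ev f x = 0 \<Longrightarrow> degree g \<le> degree f"
    using ex_has_least_nat[of "\<lambda>f. f \<noteq> 0 \<and> ev f x = 0" p degree] by blast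
  have "g dvd f" if "ev f x = 0" for f
  proof -
    have "ev f x = ev (f div g) x * ev g x + ev (f mod g) x"
      by (metis div_mult_mod_eq ev_simps(3,6))
    hence "ev (f mod g) x = 0" using g that by simp
    hence "f mod g = 0" using least[of "f mod g"] degree_mod_less[OF g(1), of f]
      by (metis linorder_not_le)
    thus ?thesis by (simp add: dvd_eq_mod_eq_0)
  qed
  thus ?thesis using g by (intro that[of g]) (auto elim!: dvdE)
qed

lemma ev_eq_0_iff_dvd:
  fixes P :: "'a::field poly"
  assumes "irreducible P" "ev P x = 0"
  shows "ev f x = 0 \<longleftrightarrow> P dvd f"
proof -
  obtain g where g: "g \<noteq> 0" "ev g x = 0" "\<And>f. ev f x = 0 \<longleftrightarrow> g dvd f"
    using least_annihilator[of x] by auto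
  have "\<not> is_unit g"
  proof
    assume "is_unit g"
    hence "g dvd 1" by simp
    hence "ev 1 x = 0" using g(3) by blast
    thus False by simp
  qed
  moreover obtain h where "P = g * h" using g(3) assms by auto
  ultimately have "is_unit h" using assms irreducibleD by blast
  hence "P dvd g" using \<open>P = g * h\<close> by simp
  moreover have "g dvd P" using g(3) assms by auto
  ultimately show ?thesis using g(3) dvd_trans by blast
qed

lemma exists_root:
  assumes "irreducible (P :: 'a::field poly)"
  obtains x where "ev P x = 0"
  using alg_closed_imp_poly_has_root[of "ac_poly P"] irreducible_degree_pos[OF assms]
  by (auto simp: ev_def)

lemma exists_minimal_poly:
  fixes x :: "'a::{field,finite} alg_closure"
  obtains P where "lead_coeff P = 1" "irreducible P" "ev P x = 0"
proof -
  obtain g where g: "g \<noteq> 0" "ev g x = 0" "\<And>f. ev f x = 0 \<longleftrightarrow> g dvd f"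
    using least_annihilator[of x] by auto
  define P where "P = smult (inverse (lead_coeff g)) g"
  have P: "P \<noteq> 0" "ev P x = 0" "lead_coeff P = 1" using g by (auto simp: P_def)
  have dvd: "ev f x = 0 \<longleftrightarrow> P dvd f" for f
    using g by (simp add: P_def smult_dvd_iff)
  have "irreducible P"
  proof (rule irreducibleI)
    show "\<not> is_unit P" using dvd[of 1] by auto
  next
    fix a b assume ab: "P = a * b"
    hence "ev a x = 0 \<or> ev b x = 0" using P by simp
    hence "P dvd a \<or> P dvd b" using dvd by simp
    moreover have "a \<noteq> 0" "b \<noteq> 0" using ab \<open>P \<noteq> 0\<close> by auto
    ultimately show "is_unit a \<or> is_unit b"
      using dvd_times_left_cancel_iff[of a b 1] dvd_times_right_cancel_iff[of b a 1] ab by auto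
  qed fact
  thus ?thesis using P that by blast
qed

lemma monic_dvd_monic_eq:
  fixes P R :: "'a::field poly"
  assumes "lead_coeff P = 1" "lead_coeff R = 1" "irreducible P" "irreducible R" "P dvd R"
  shows "P = R"
proof -
  obtain h where h: "R = P * h" using assms by auto
  hence "is_unit h" using assms irreducibleD irreducible_not_unit by blast
  then obtain c where c: "h = [:c:]" by (auto simp: is_unit_poly_iff)
  have "lead_coeff R = lead_coeff P * lead_coeff h" by (simp only: h lead_coeff_mult)
  hence "c = 1" using assms c by simp
  thus ?thesis using h c by (simp add: one_pCons)
qed

lemma monic_irreds_root_unique:
  assumes "P \<in> monic_irreds m" "R \<in> monic_irreds n" "ev P x = 0" "ev R x = 0"
  shows "P = R"
  using assms ev_eq_0_iff_dvd[of P x R] monic_dvd_monic_eq[of P R]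
  by (auto simp: monic_irreds_def)

text \<open>Choosing a root identifies A/(P) with \<open>GF m\<close> by evaluation, and the residue
  symbol mod P with the character \<open>eta m\<close>.\<close>

locale irred_root =
  fixes P :: "'a::{field,finite} poly" and m :: nat and \<alpha> :: "'a alg_closure"
  assumes P: "P \<in> monic_irreds m" and root: "ev P \<alpha> = 0"
begin

lemma irred: "irreducible P" and monic: "lead_coeff P = 1" and deg: "degree P = m"
  using P by (auto simp: monic_irreds_def)

lemma m_pos: "m > 0"
  using irreducible_degree_pos[OF irred] deg by simp

lemma ev_0_iff: "ev f \<alpha> = 0 \<longleftrightarrow> P dvd f"
  by (rule ev_eq_0_iff_dvd[OF irred root])

lemma ev_inj: "inj_on (\<lambda>f. ev f \<alpha>) (polys m)"
proof (rule inj_onI)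
  fix f g assume fg: "f \<in> polys m" "g \<in> polys m" "ev f \<alpha> = ev g \<alpha>"
  hence "P dvd f - g" by (simp flip: ev_0_iff)
  moreover have "f - g \<in> polys m" using fg by (simp add: polys_def)
  hence "degree (f - g) < degree P" using m_pos deg by (simp add: polys_iff_degree)
  ultimately show "f = g" using dvd_imp_degree_le[of P "f - g"] by (cases "f - g = 0") auto
qed

lemma ev_mod: "ev (f mod P) \<alpha> = ev f \<alpha>"
proof -
  have "ev f \<alpha> = ev (f div P) \<alpha> * ev P \<alpha> + ev (f mod P) \<alpha>"
    by (metis div_mult_mod_eq ev_simps(3,6))
  thus ?thesis using root by simp
qed

lemma mod_polys: "f mod P \<in> polys m"
proof -
  have "P \<noteq> 0" using m_pos deg by auto
  thus ?thesis using degree_mod_less[of P f] m_pos deg by (auto simp: polys_iff_degree)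
qed

text \<open>The values form a set of q^m elements closed under multiplication. A nonzero value x
  permutes the nonzero values, and comparing their products gives x^(q^m - 1) = 1; equality with
  \<open>GF m\<close> follows by counting.\<close>

lemma ev_image: "(\<lambda>f. ev f \<alpha>) ` polys m = GF m"
proof -
  let ?K = "(\<lambda>f. ev f \<alpha>) ` polys m"
  have inK: "ev f \<alpha> \<in> ?K" for f
    using ev_mod[of f] mod_polys[of f] by (metis image_eqI)
  have fin: "finite ?K" by simp
  have card: "card ?K = CARD('a) ^ m" using ev_inj by (simp add: card_image card_polys)
  have sub: "?K \<subseteq> GF m"
  proof
    fix x assume x: "x \<in> ?K"
    show "x \<in> GF m"
    proof (cases "x = 0")
      case False
      have "(\<lambda>y. x * y) ` (?K - {0}) = ?K - {0}"
      proof (rule card_seteq)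
        obtain f where "x = ev f \<alpha>" using x by blast
        hence "x * ev g \<alpha> \<in> ?K" for g using inK[of "f * g"] by simp
        thus "(\<lambda>y. x * y) ` (?K - {0}) \<subseteq> ?K - {0}" using False by auto
        show "card (?K - {0}) \<le> card ((\<lambda>y. x * y) ` (?K - {0}))"
          using False by (subst card_image) (auto simp: inj_on_def)
      qed (use fin in auto)
      hence "bij_betw (\<lambda>y. x * y) (?K - {0}) (?K - {0})"
        using False by (simp add: bij_betw_def inj_on_def)
      hence "(\<Prod>y\<in>?K - {0}. y) = (\<Prod>y\<in>?K - {0}. x * y)"
        using prod.reindex_bij_betw[of "\<lambda>y. x * y" "?K - {0}" "?K - {0}" "\<lambda>y. y"] by simp
      also have "\<dots> = x ^ card (?K - {0}) * (\<Prod>y\<in>?K - {0}. y)"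
        by (simp add: prod.distrib)
      finally have "x ^ card (?K - {0}) = 1" using fin by (simp add: prod_zero_iff)
      moreover have "card (?K - {0}) = CARD('a) ^ m - 1"
        using fin card inK[of 0] by (simp add: card_Diff_subset)
      ultimately have "x ^ (CARD('a) ^ m - 1) * x = x" by simp
      moreover have "CARD('a) ^ m > 0" by simp
      ultimately show ?thesis
        by (metis (mono_tags, lifting) GF_def One_nat_def Suc_pred mem_Collect_eq power_Suc2)
    qed simp
  qed
  show ?thesis
    by (rule card_seteq) (use sub m_pos card in \<open>auto simp: card_GF\<close>)
qed

lemma ev_bij: "bij_betw (\<lambda>f. ev f \<alpha>) (polys m) (GF m)"
  using ev_inj ev_image by (simp add: bij_betw_def)

lemma root_in_GF: "\<alpha> \<in> GF m"
proof -
  have "ev (monom 1 1) \<alpha> = ev (monom 1 1 mod P) \<alpha>" by (rule ev_mod[symmetric])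
  also have "\<dots> \<in> GF m" using ev_image mod_polys by blast
  finally show ?thesis by simp
qed

text \<open>With r = k mod m, the root and hence every polynomial in it lies in \<open>GF r\<close>.
  These polynomials fill \<open>GF m\<close>, which is too large if 0 < r < m.\<close>

lemma frob_fixed_imp_dvd:
  assumes "\<alpha> ^ (CARD('a) ^ k) = \<alpha>"
  shows "m dvd k"
proof (rule ccontr)
  assume "\<not> m dvd k"
  define r where "r = k mod m"
  have r: "0 < r" "r < m" using \<open>\<not> m dvd k\<close> m_pos by (auto simp: r_def dvd_eq_mod_eq_0)
  have "\<alpha> \<in> GF (m * (k div m))" using root_in_GF GF_mono[of m "m * (k div m)"] by auto
  hence "\<alpha> ^ (CARD('a) ^ r) = (\<alpha> ^ (CARD('a) ^ (m * (k div m)))) ^ (CARD('a) ^ r)"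
    by (simp add: GF_def)
  also have "\<dots> = \<alpha> ^ (CARD('a) ^ k)"
    by (simp add: r_def flip: power_mult power_add)
  finally have "\<alpha> \<in> GF r" using assms by (simp add: GF_def)
  have "x \<in> GF r" if "x \<in> GF m" for x :: "'a alg_closure"
  proof -
    have "x \<in> (\<lambda>f. ev f \<alpha>) ` polys m" using that ev_image by simp
    then obtain f where "x = ev f \<alpha>" by (rule imageE)
    thus ?thesis using GF_ev[OF \<open>\<alpha> \<in> GF r\<close>] by simp
  qed
  hence "GF m \<subseteq> (GF r :: 'a alg_closure set)" by blast
  hence "card (GF m :: 'a alg_closure set) \<le> card (GF r :: 'a alg_closure set)" using r by (intro card_mono) auto
  hence "m \<le> r" using r card_gt_1[where 'a='a] by (simp add: card_GF)
  thus False using r by simp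
qed

lemma conj_inj: "inj_on (\<lambda>i. \<alpha> ^ (CARD('a) ^ i)) {..<m}"
proof (rule linorder_inj_onI)
  fix i j assume ij: "i < j" "i \<in> {..<m}" "j \<in> {..<m}"
  show "\<alpha> ^ (CARD('a) ^ i) \<noteq> \<alpha> ^ (CARD('a) ^ j)"
  proof
    assume "\<alpha> ^ (CARD('a) ^ i) = \<alpha> ^ (CARD('a) ^ j)"
    also have "\<dots> = (\<alpha> ^ (CARD('a) ^ (j - i))) ^ (CARD('a) ^ i)"
      using ij by (simp flip: power_mult power_add)
    finally have "\<alpha> = \<alpha> ^ (CARD('a) ^ (j - i))" by (rule frob_inj)
    hence "m dvd j - i" using frob_fixed_imp_dvd by simp
    thus False using ij by (auto dest: dvd_imp_le)
  qed
qed auto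

text \<open>Both sides are monic of degree m and vanish at the m distinct conjugates of
  \<alpha>.\<close>

lemma ac_poly_eq_prod: "ac_poly P = (\<Prod>i<m. [:- (\<alpha> ^ (CARD('a) ^ i)), 1:])"
proof (rule poly_eqI_degree_lead_coeff[where n = m and A = "(\<lambda>i. \<alpha> ^ (CARD('a) ^ i)) ` {..<m}"])
  have d: "degree (\<Prod>i<m. [:- (\<alpha> ^ (CARD('a) ^ i)), 1:]) = m"
    by (subst degree_prod_eq_sum_degree) auto
  show "degree (\<Prod>i<m. [:- (\<alpha> ^ (CARD('a) ^ i)), 1:]) \<le> m" using d by simp
  have "lead_coeff (\<Prod>i<m. [:- (\<alpha> ^ (CARD('a) ^ i)), 1:]) = 1"
    by (simp add: lead_coeff_prod)
  thus "coeff (ac_poly P) m = coeff (\<Prod>i<m. [:- (\<alpha> ^ (CARD('a) ^ i)), 1:]) m"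
    using d monic deg by simp
  show "m \<le> card ((\<lambda>i. \<alpha> ^ (CARD('a) ^ i)) ` {..<m})"
    by (simp add: card_image conj_inj)
  show "degree (ac_poly P) \<le> m" using deg by simp
  show "poly (ac_poly P) z = poly (\<Prod>i<m. [:- (\<alpha> ^ (CARD('a) ^ i)), 1:]) z"
    if z: "z \<in> (\<lambda>i. \<alpha> ^ (CARD('a) ^ i)) ` {..<m}" for z
  proof -
    obtain i where i: "z = \<alpha> ^ (CARD('a) ^ i)" "i \<in> {..<m}" using z by (rule imageE)
    have "poly (ac_poly P) z = ev P \<alpha> ^ (CARD('a) ^ i)" using i ev_frob[of P \<alpha> i] by (simp add: ev_def)
    moreover have "poly (\<Prod>i<m. [:- (\<alpha> ^ (CARD('a) ^ i)), 1:]) z = 0"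
      using i by (simp add: poly_prod prod_zero_iff) blast
    ultimately show ?thesis using root by (simp add: zero_power)
  qed
qed

lemma ev_P_eq: "ev P x = (\<Prod>i<m. x - \<alpha> ^ (CARD('a) ^ i))"
  by (simp add: ev_def ac_poly_eq_prod poly_prod)

lemma roots_eq: "{x. ev P x = 0} = (\<lambda>i. \<alpha> ^ (CARD('a) ^ i)) ` {..<m}"
  by (auto simp: ev_P_eq prod_zero_iff)

lemma card_roots: "card {x. ev P x = 0} = m"
  by (simp add: roots_eq card_image conj_inj)

end

lemma minimal_poly_degree_dvd:
  assumes "P \<in> monic_irreds d" "ev P x = 0" "x \<in> (GF m :: 'a::{field,finite} alg_closure set)"
  shows "d dvd m"
proof -
  interpret irred_root P d x by unfold_locales (use assms in auto)
  show ?thesis using assms by (intro frob_fixed_imp_dvd) (simp add: GF_def)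
qed

text \<open>The elements of exact degree m over F_q.\<close>

definition GFprim :: "nat \<Rightarrow> 'a::{field,finite} alg_closure set" where
  "GFprim m = {x. \<exists>P\<in>monic_irreds m. ev P x = 0}"

lemma GFprim_subset: "GFprim m \<subseteq> GF m"
proof
  fix x :: "'a alg_closure" assume "x \<in> GFprim m"
  then obtain P where "P \<in> monic_irreds m" "ev P x = 0" by (auto simp: GFprim_def)
  then interpret irred_root P m x by unfold_locales
  show "x \<in> GF m" by (rule root_in_GF)
qed

text \<open>Each prime of degree m has exactly m roots and distinct primes share none.\<close>

lemma sum_GFprim:
  fixes h :: "'a::{field,finite} alg_closure \<Rightarrow> int"
  assumes "\<And>P x. P \<in> monic_irreds m \<Longrightarrow> ev P x = 0 \<Longrightarrow> h x = H P"
  shows "(\<Sum>x\<in>GFprim m. h x) = int m * (\<Sum>P\<in>monic_irreds m. H P)"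
proof -
  have "GFprim m = (\<Union>P\<in>monic_irreds m. {x :: 'a alg_closure. ev P x = 0})" by (auto simp: GFprim_def)
  also have "sum h \<dots> = (\<Sum>P\<in>monic_irreds m. \<Sum>x | ev P x = 0. h x)"
  proof (rule sum.UNION_disjoint)
    show "\<forall>P\<in>monic_irreds m. finite {x :: 'a alg_closure. ev P x = 0}"
    proof
      fix P :: "'a poly" assume "P \<in> monic_irreds m"
      hence "ac_poly P \<noteq> 0" by (auto simp: monic_irreds_def)
      thus "finite {x :: 'a alg_closure. ev P x = 0}" unfolding ev_def by (rule poly_roots_finite)
    qed
    show "\<forall>P\<in>monic_irreds m. \<forall>R\<in>monic_irreds m. P \<noteq> R \<longrightarrow>
            {x :: 'a alg_closure. ev P x = 0} \<inter> {x. ev R x = 0} = {}"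
      using monic_irreds_root_unique by blast
  qed simp
  also have "\<dots> = (\<Sum>P\<in>monic_irreds m. int m * H P)"
  proof (rule sum.cong)
    fix P :: "'a poly" assume P: "P \<in> monic_irreds m"
    then obtain \<alpha> where "ev P \<alpha> = 0" using exists_root by (auto simp: monic_irreds_def)
    then interpret irred_root P m \<alpha> by unfold_locales (use P in auto)
    have "(\<Sum>x | ev P x = 0. h x) = (\<Sum>x | ev P x = 0. H P)"
      by (rule sum.cong) (use assms P in auto)
    thus "(\<Sum>x | ev P x = 0. h x) = int m * H P" by (simp add: card_roots)
  qed simp
  finally show ?thesis by (simp add: sum_distrib_left)
qed

text \<open>The degree d of such an element is a proper divisor of m, so it lies in
  \<open>GF d\<close> with d \<le> m/2; the geometric sum of the sizes of these fields is at most
  twice its last term.\<close>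

lemma card_GF_minus_GFprim:
  assumes "m > 0"
  shows "card (GF m - GFprim m :: 'a::{field,finite} alg_closure set) \<le> 2 * CARD('a) ^ (m div 2)"
proof -
  have "GF m - GFprim m \<subseteq> (\<Union>d\<in>{1..m div 2}. GF d :: 'a alg_closure set)"
  proof
    fix x :: "'a alg_closure" assume x: "x \<in> GF m - GFprim m"
    obtain P where P: "lead_coeff P = 1" "irreducible P" "ev P x = 0"
      using exists_minimal_poly by blast
    define d where "d = degree P"
    have Pd: "P \<in> monic_irreds d" using P by (simp add: monic_irreds_def d_def)
    then interpret irred_root P d x by unfold_locales (use P in auto)
    have "x \<in> GF m" using x by simp
    hence "d dvd m" by (rule minimal_poly_degree_dvd[OF Pd root])
    moreover have "d \<noteq> m" using x Pd root by (auto simp: GFprim_def)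
    ultimately obtain k where k: "m = d * k" "k \<noteq> 1" by auto
    hence "k \<ge> 2" using assms by (cases k) auto
    hence "d * 2 \<le> m" using k by simp
    hence "d \<in> {1..m div 2}" using m_pos by auto
    thus "x \<in> (\<Union>d\<in>{1..m div 2}. GF d)" using root_in_GF by blast
  qed
  hence "card (GF m - GFprim m :: 'a alg_closure set) \<le> card (\<Union>d\<in>{1..m div 2}. GF d :: 'a alg_closure set)"
    by (intro card_mono) auto
  also have "\<dots> \<le> (\<Sum>d\<in>{1..m div 2}. card (GF d :: 'a alg_closure set))"
    by (rule card_UN_le) simp
  also have "\<dots> = (\<Sum>d\<in>{1..m div 2}. CARD('a) ^ d)"
    by (rule sum.cong) (auto simp: card_GF)
  also have "\<dots> \<le> 2 * CARD('a) ^ (m div 2)"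
  proof (induction "m div 2")
    case (Suc n)
    have "(\<Sum>d\<in>{1..n}. CARD('a) ^ d) \<le> 2 * CARD('a) ^ n" for n
    proof (induction n)
      case (Suc n)
      have "2 * CARD('a) ^ n \<le> CARD('a) * CARD('a) ^ n" using card_gt_1[where 'a='a] by (intro mult_right_mono) auto
      moreover have "(\<Sum>d\<in>{1..Suc n}. CARD('a) ^ d) = (\<Sum>d\<in>{1..n}. CARD('a) ^ d) + CARD('a) * CARD('a) ^ n"
        by simp
      ultimately show ?case using Suc unfolding power_Suc by linarith
    qed simp
    thus ?case by blast
  qed simp
  finally show ?thesis .
qed

text \<open>The prime polynomial theorem with an error of square root size, the error being the
  elements of smaller subfields.\<close>

lemma card_monic_irreds_bounds:
  assumes "m > 0"
  shows "m * card (monic_irreds m :: 'a::{field,finite} poly set) \<le> CARD('a) ^ m"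
    and "CARD('a) ^ m \<le> m * card (monic_irreds m :: 'a poly set) + 2 * CARD('a) ^ (m div 2)"
proof -
  have "int (card (GFprim m :: 'a alg_closure set)) = int m * int (card (monic_irreds m :: 'a poly set))"
    using sum_GFprim[where ?'a='a and h = "\<lambda>_. 1" and H = "\<lambda>_. 1" and m = m] by simp
  hence c: "card (GFprim m :: 'a alg_closure set) = m * card (monic_irreds m :: 'a poly set)"
    by (metis of_nat_eq_iff of_nat_mult)
  have fin: "finite (GF m :: 'a alg_closure set)" using assms by simp
  have "card (GF m - GFprim m :: 'a alg_closure set) = card (GF m :: 'a alg_closure set) - card (GFprim m :: 'a alg_closure set)"
    using fin GFprim_subset by (intro card_Diff_subset) (auto intro: finite_subset)
  moreover have "card (GFprim m :: 'a alg_closure set) \<le> card (GF m :: 'a alg_closure set)"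
    using fin GFprim_subset by (intro card_mono) auto
  ultimately show "m * card (monic_irreds m :: 'a poly set) \<le> CARD('a) ^ m"
    and "CARD('a) ^ m \<le> m * card (monic_irreds m :: 'a poly set) + 2 * CARD('a) ^ (m div 2)"
    using c card_GF_minus_GFprim[OF assms, where 'a='a] assms by (auto simp: card_GF)
qed

section \<open>The Jacobi symbol and quadratic reciprocity\<close>

context irred_root
begin

lemma poly_legendre_eq_eta:
  assumes "odd CARD('a)"
  shows "poly_legendre f P = eta m (ev f \<alpha>)"
proof -
  have "(\<exists>h. [h ^ 2 = f] (mod P)) \<longleftrightarrow> (\<exists>y\<in>GF m. y ^ 2 = ev f \<alpha>)"
  proof -
    have "[h ^ 2 = f] (mod P) \<longleftrightarrow> ev h \<alpha> ^ 2 = ev f \<alpha>" for h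
      using ev_0_iff[of "h ^ 2 - f"] by (simp add: cong_iff_dvd_diff)
    moreover have "(\<exists>h. ev h \<alpha> ^ 2 = ev f \<alpha>) \<longleftrightarrow> (\<exists>y\<in>GF m. y ^ 2 = ev f \<alpha>)"
    proof
      assume "\<exists>y\<in>GF m. y ^ 2 = ev f \<alpha>"
      then obtain y where y: "y \<in> (\<lambda>f. ev f \<alpha>) ` polys m" "y ^ 2 = ev f \<alpha>"
        by (auto simp: ev_image)
      from y(1) obtain h where "y = ev h \<alpha>" by (rule imageE)
      thus "\<exists>h. ev h \<alpha> ^ 2 = ev f \<alpha>" using y by auto
    qed (use GF_ev[OF root_in_GF] in blast)
    ultimately show ?thesis by simp
  qed
  moreover have "ev f \<alpha> \<in> GF m" using root_in_GF by (rule GF_ev)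
  ultimately have "eta m (ev f \<alpha>) = 1 \<longleftrightarrow> ev f \<alpha> \<noteq> 0 \<and> (\<exists>h. [h ^ 2 = f] (mod P))"
    using eta_eq_1_iff[OF assms m_pos] by simp
  thus ?thesis using eta_cases[of m "ev f \<alpha>"] ev_0_iff[of f] by (auto simp: poly_legendre_def)
qed

end

lemma sum_powers_half:
  assumes "odd (q::nat)"
  shows "(\<Sum>i<m. q ^ i) * ((q - 1) div 2) = (q ^ m - 1) div 2"
proof -
  have "q > 0" using assms by (auto intro: Nat.gr0I)
  have "(q - 1) * (\<Sum>i<m. q ^ i) = q ^ m - 1"
  proof (induction m)
    case (Suc m)
    have "(q - 1) * q ^ m + (q ^ m - 1) = q ^ Suc m - 1"
      using \<open>q > 0\<close> by (simp add: algebra_simps)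
    with Suc show ?case by (simp add: algebra_simps)
  qed simp
  moreover obtain k where "q - 1 = 2 * k" using assms by (auto elim!: oddE)
  ultimately show ?thesis by (auto simp: mult_ac)
qed

text \<open>Euler's exponent is (1 + q + ... + q^(m-1)) (q - 1)/2: the character of
  \<open>GF m\<close> is the character of F_q composed with the norm.\<close>

lemma half_power_eq_norm_power:
  fixes x :: "'a::{field,finite} alg_closure"
  assumes "odd CARD('a)"
  shows "x ^ ((CARD('a) ^ m - 1) div 2) = (\<Prod>i<m. x ^ (CARD('a) ^ i)) ^ ((CARD('a) - 1) div 2)"
  using sum_powers_half[OF assms, of m] by (simp flip: power_sum power_mult)

text \<open>By the norm formula both symbols are (q - 1)/2-th powers of the resultant, the product
  of all differences between roots of P and roots of R. Exchanging P and R changes the sign of each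
  of the m l factors.\<close>

lemma reciprocity:
  fixes P R :: "'a::{field,finite} poly"
  assumes odd: "odd CARD('a)" and P: "P \<in> monic_irreds m" "ev P \<alpha> = 0" and R: "R \<in> monic_irreds l" "ev R \<beta> = 0"
  shows "eta l (ev P \<beta>) = (-1) ^ ((CARD('a) - 1) div 2 * m * l) * eta m (ev R \<alpha>)"
proof -
  interpret P: irred_root P m \<alpha> by unfold_locales (use P in auto)
  interpret R: irred_root R l \<beta> by unfold_locales (use R in auto)
  let ?q = "CARD('a)" and ?h = "(CARD('a) - 1) div 2"
  let ?a = "\<lambda>i. \<alpha> ^ (?q ^ i)" and ?b = "\<lambda>j. \<beta> ^ (?q ^ j)"
  have 1: "ev R \<alpha> ^ ((?q ^ m - 1) div 2) = (\<Prod>i<m. \<Prod>j<l. ?a i - ?b j) ^ ?h"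
    by (simp only: half_power_eq_norm_power[OF odd] ev_frob, simp only: R.ev_P_eq)
  have "ev P \<beta> ^ ((?q ^ l - 1) div 2) = (\<Prod>j<l. \<Prod>i<m. ?b j - ?a i) ^ ?h"
    by (simp only: half_power_eq_norm_power[OF odd] ev_frob, simp only: P.ev_P_eq)
  also have "(\<Prod>j<l. \<Prod>i<m. ?b j - ?a i) = (\<Prod>i<m. \<Prod>j<l. - 1 * (?a i - ?b j))"
    by (subst prod.swap) (intro prod.cong, auto)
  also have "\<dots> = (- 1) ^ (m * l) * (\<Prod>i<m. \<Prod>j<l. ?a i - ?b j)"
    by (simp only: prod.distrib) (simp flip: power_mult, simp add: mult.commute)
  also have "\<dots> ^ ?h = (- 1) ^ (?h * m * l) * ev R \<alpha> ^ ((?q ^ m - 1) div 2)"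
    unfolding 1 by (simp add: power_mult_distrib mult_ac flip: power_mult)
  also have "\<dots> = of_int ((-1) ^ (?h * m * l) * eta m (ev R \<alpha>))"
    using of_int_eta[OF odd GF_ev[OF P.root_in_GF] P.m_pos, of R] by simp
  finally show ?thesis
    using eta_cases[of m "ev R \<alpha>"]
    by (intro eta_eqI[OF odd GF_ev[OF R.root_in_GF] R.m_pos])
       (auto simp: minus_one_power_iff)
qed

text \<open>The norm exponent 1 + q + ... + q^(m-1) has the parity of m because q is odd, and for a
  value in {-1, 0, 1} only this parity matters.\<close>

lemma eta_const:
  assumes odd: "odd CARD('a::{field,finite})" and m: "m > 0"
  shows "eta m (to_ac (c::'a)) = eta 1 (to_ac c) ^ m"
proof -
  have par: "odd (\<Sum>i<m. CARD('a) ^ i) \<longleftrightarrow> odd m"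
    by (induction m) (use odd in auto)
  have e: "eta 1 (to_ac c) \<in> {-1, 0, 1}" by (rule eta_cases)
  have h: "to_ac c ^ ((CARD('a) - 1) div 2) = of_int (eta 1 (to_ac c))"
    using of_int_eta[OF odd, of "to_ac c" 1] by simp
  have "to_ac c ^ ((CARD('a) ^ m - 1) div 2) = (to_ac c ^ ((CARD('a) - 1) div 2)) ^ (\<Sum>i<m. CARD('a) ^ i)"
    unfolding sum_powers_half[OF odd, of m, symmetric] by (subst mult.commute) (rule power_mult)
  also have "\<dots> = of_int (eta 1 (to_ac c) ^ (\<Sum>i<m. CARD('a) ^ i))" by (simp only: h of_int_power)
  also have "eta 1 (to_ac c) ^ (\<Sum>i<m. CARD('a) ^ i) = eta 1 (to_ac c) ^ m"
  proof -
    have "(\<Sum>i<m. CARD('a) ^ i) > 0" using m by (intro sum_pos) auto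
    thus ?thesis using e par m by (auto simp: minus_one_power_iff zero_power)
  qed
  finally show ?thesis
  proof (rule eta_eqI[OF odd GF_to_ac m, rotated])
    show "eta 1 (to_ac c) ^ m \<in> {-1, 0, 1}" using e m by (cases "even m") (auto simp: minus_one_power_iff zero_power)
  qed
qed

text \<open>A generator is a nonsquare in F_q, since otherwise all nonzero elements, being its
  powers, would be squares.\<close>

lemma eta_generator:
  fixes \<gamma> :: "'a::{field,finite}"
  assumes odd: "odd CARD('a)" and gen: "\<gamma> \<noteq> 0" "\<forall>x::'a. x \<noteq> 0 \<longrightarrow> (\<exists>n::nat. x = \<gamma> ^ n)" and m: "m > 0"
  shows "eta m (to_ac \<gamma>) = (- 1) ^ m"
proof -
  have nsq: "eta 1 (to_ac \<gamma>) = -1"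
  proof (rule ccontr)
    assume "eta 1 (to_ac \<gamma>) \<noteq> -1"
    hence *: "eta 1 (to_ac \<gamma>) = 1" using gen eta_cases[of 1 "to_ac \<gamma>"] by auto
    obtain z where z: "z \<in> (GF 1 :: 'a alg_closure set)" "eta 1 z = -1"
      using exists_eta_minus_1[OF odd, of 1] by auto
    then obtain x where x: "z = to_ac x" using GF_1_eq by auto
    hence "x \<noteq> 0" using z by auto
    then obtain n where "x = \<gamma> ^ n" using gen by blast
    hence "eta 1 z = 1" using * x eta_power[OF odd, of "to_ac \<gamma>" 1 n] by simp
    thus False using z by simp
  qed
  show ?thesis unfolding eta_const[OF odd m] nsq ..
qed

section \<open>Factorization into monic irreducibles and multiplicativity of the Jacobi
  symbol\<close>

lemma exists_irreducible_dvd: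
  fixes f :: "'a::field poly"
  assumes "degree f > 0"
  obtains R where "lead_coeff R = 1" "irreducible R" "R dvd f"
proof -
  have "f dvd f \<and> degree f > 0" using assms by simp
  from ex_has_least_nat[of "\<lambda>d. d dvd f \<and> degree d > 0", OF this, of degree]
  obtain d where d: "d dvd f" "degree d > 0"
    and least: "\<And>d'. d' dvd f \<Longrightarrow> degree d' > 0 \<Longrightarrow> degree d \<le> degree d'"
    by auto
  define R where "R = smult (inverse (lead_coeff d)) d"
  have [simp]: "d \<noteq> 0" using d by auto
  have deg: "degree R = degree d" and lc: "lead_coeff R = 1" and dvd: "R dvd f"
    using d by (simp_all add: R_def smult_dvd_iff)
  have "irreducible R"
  proof (rule irreducibleI)
    show R0: "R \<noteq> 0" using lc by auto
    show "\<not> is_unit R" using is_unit_iff_degree[OF R0] deg d(2) by simp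
  next
    fix a b assume ab: "R = a * b"
    hence nz: "a \<noteq> 0" "b \<noteq> 0" using lc by auto
    hence "degree a + degree b = degree d" using ab deg by (simp add: degree_mult_eq)
    moreover have "degree a = 0 \<or> degree d \<le> degree a"
      using least[of a] ab dvd by (metis dvd_mult_left gr0I)
    ultimately have "degree a = 0 \<or> degree b = 0" by linarith
    thus "is_unit a \<or> is_unit b" using nz by (simp add: is_unit_iff_degree)
  qed
  thus ?thesis using lc dvd that by blast
qed

lemma monic_induct [consumes 1, case_names one mult]:
  fixes f :: "'a::field poly"
  assumes "lead_coeff f = 1" "Q 1"
    "\<And>R g. lead_coeff R = 1 \<Longrightarrow> irreducible R \<Longrightarrow> lead_coeff g = 1 \<Longrightarrow> Q g \<Longrightarrow> Q (R * g)"
  shows "Q f"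
  using assms(1)
proof (induction "degree f" arbitrary: f rule: less_induct)
  case less
  show ?case
  proof (cases "degree f = 0")
    case True
    then obtain c where "f = [:c:]" by (rule degree_eq_zeroE)
    thus ?thesis using less.prems assms(2) by (simp add: one_pCons)
  next
    case False
    then obtain R where R: "lead_coeff R = 1" "irreducible R" "R dvd f"
      using exists_irreducible_dvd by blast
    then obtain g where g: "f = R * g" by auto
    have "g \<noteq> 0" "R \<noteq> 0" using less.prems g by auto
    have lc: "lead_coeff g = 1" using less.prems R by (simp add: g lead_coeff_mult)
    have "degree g < degree f"
      using irreducible_degree_pos[OF R(2)] \<open>g \<noteq> 0\<close> \<open>R \<noteq> 0\<close> by (simp add: g degree_mult_eq)
    hence "Q g" using less.hyps lc by blast
    thus ?thesis using assms(3) R lc g by blast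
  qed
qed

text \<open>Identifies the maximum in the definition of \<open>chi\<close> with the exponent of R in
  a factorization.\<close>

lemma Max_power_dvd:
  fixes R :: "'a::field poly"
  assumes "irreducible R" "\<not> R dvd h"
  shows "Max {n. R ^ n dvd R ^ a * h} = a"
proof -
  have [simp]: "R \<noteq> 0" using assms by auto
  have "n \<le> a" if "R ^ n dvd R ^ a * h" for n
  proof (rule ccontr)
    assume "\<not> n \<le> a"
    hence "R ^ Suc a dvd R ^ n" by (intro le_imp_power_dvd) simp
    hence "R ^ a * R dvd R ^ a * h" using dvd_trans that by (simp only: power_Suc2)
    thus False using assms(2) by simp
  qed
  moreover have "finite {n. R ^ n dvd R ^ a * h}"
    by (rule finite_subset[of _ "{..a}"]) (use calculation in auto)
  ultimately show ?thesis by (intro Max_eqI) auto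
qed

lemma irreducible_power_decomp:
  fixes R :: "'a::field poly"
  assumes "irreducible R" "f \<noteq> 0"
  obtains a h where "f = R ^ a * h" "\<not> R dvd h"
proof -
  have "\<exists>a h. f = R ^ a * h \<and> \<not> R dvd h"
    using assms(2)
  proof (induction "degree f" arbitrary: f rule: less_induct)
    case less
    show ?case
    proof (cases "R dvd f")
      case False
      thus ?thesis by (intro exI[of _ 0] exI[of _ f]) simp
    next
      case True
      then obtain g where g: "f = R * g" by auto
      hence "g \<noteq> 0" "R \<noteq> 0" using less.prems by auto
      hence "degree g < degree f"
        using irreducible_degree_pos[OF assms(1)] by (simp add: g degree_mult_eq)
      then obtain a h where "g = R ^ a * h" "\<not> R dvd h" using less.hyps \<open>g \<noteq> 0\<close> by blast
      thus ?thesis using g by (intro exI[of _ "Suc a"] exI[of _ h]) (simp add: mult_ac)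
    qed
  qed
  thus ?thesis using that by blast
qed

abbreviation prime_divs :: "'a::field poly \<Rightarrow> 'a poly set" where
  "prime_divs f \<equiv> {P. lead_coeff P = 1 \<and> irreducible P \<and> P dvd f}"

lemma prime_divs_mult:
  fixes R f :: "'a::field poly"
  assumes "lead_coeff R = 1" "irreducible R"
  shows "prime_divs (R * f) = insert R (prime_divs f)"
proof -
  have "P dvd R * f \<longleftrightarrow> P = R \<or> P dvd f" if "lead_coeff P = 1" "irreducible P" for P
  proof
    assume "P dvd R * f"
    hence "P dvd R \<or> P dvd f"
      using field_poly_irreducible_imp_prime[OF that(2)] by (auto dest: prime_elem_dvd_multD)
    thus "P = R \<or> P dvd f" using monic_dvd_monic_eq[of P R] that assms by auto
  qed auto
  thus ?thesis using assms by auto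
qed

lemma prime_divs_1: "prime_divs (1 :: 'a::field poly) = {}"
  by (auto dest: irreducible_not_unit)

lemma finite_prime_divs: "lead_coeff f = 1 \<Longrightarrow> finite (prime_divs (f :: 'a::field poly))"
proof (induction f rule: monic_induct)
  case one
  show ?case by (simp only: prime_divs_1 finite.emptyI)
next
  case (mult R g)
  thus ?case by (simp add: prime_divs_mult)
qed

lemma chi_1 [simp]: "chi D 1 = 1"
  by (simp only: chi_def prime_divs_1 prod.empty)

text \<open>Multiplying by R raises the exponent of R by one and leaves those of all other primes
  alone. With \<open>monic_induct\<close>, identities for \<open>chi\<close> reduce to
  irreducibles.\<close>

lemma chi_mult_irreducible:
  fixes R g :: "'a::{field,finite} poly"
  assumes R: "lead_coeff R = 1" "irreducible R" and g: "lead_coeff g = 1"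
  shows "chi D (R * g) = poly_legendre D R * chi D g"
proof -
  let ?M = "\<lambda>P f. Max {n. P ^ n dvd f}"
  have g0: "g \<noteq> 0" using g by auto
  have other: "?M P (R * g) = ?M P g" if P: "P \<in> prime_divs g - {R}" for P
  proof -
    obtain a h where ah: "g = P ^ a * h" "\<not> P dvd h"
      using irreducible_power_decomp[of P g] P g0 by auto
    have "\<not> P dvd R" using monic_dvd_monic_eq[of P R] P R by auto
    hence "\<not> P dvd R * h"
      using field_poly_irreducible_imp_prime[of P] P ah by (auto dest: prime_elem_dvd_multD)
    hence "Max {n. P ^ n dvd P ^ a * (R * h)} = a" using P by (intro Max_power_dvd) auto
    moreover have "R * g = P ^ a * (R * h)" by (simp add: ah mult_ac)
    moreover have "Max {n. P ^ n dvd g} = a" unfolding ah(1) using P ah(2) by (intro Max_power_dvd) auto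
    ultimately show ?thesis by (simp only:)
  qed
  obtain a h where ah: "g = R ^ a * h" "\<not> R dvd h"
    using irreducible_power_decomp[OF R(2) g0] by blast
  have M1: "?M R (R * g) = Suc a" and M0: "?M R g = a"
    using Max_power_dvd[OF R(2) ah(2)] by (simp_all add: ah(1) flip: mult.assoc power_Suc)
  have fin: "finite (prime_divs g)" using finite_prime_divs[OF g] .
  have "chi D (R * g) = (\<Prod>P\<in>insert R (prime_divs g - {R}). poly_legendre D P ^ ?M P (R * g))"
    unfolding chi_def prime_divs_mult[OF R] by simp
  also have "\<dots> = poly_legendre D R ^ Suc a * (\<Prod>P\<in>prime_divs g - {R}. poly_legendre D P ^ ?M P (R * g))"
    using fin M1 by (subst prod.insert) auto
  also have "(\<Prod>P\<in>prime_divs g - {R}. poly_legendre D P ^ ?M P (R * g)) =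
             (\<Prod>P\<in>prime_divs g - {R}. poly_legendre D P ^ ?M P g)"
    by (rule prod.cong) (use other in auto)
  also have "poly_legendre D R ^ Suc a * \<dots> = poly_legendre D R * chi D g"
  proof (cases "R dvd g")
    case True
    hence "R \<in> prime_divs g" using R by simp
    thus ?thesis using fin M0 unfolding chi_def by (subst prod.remove[of _ R]) (auto simp: mult_ac)
  next
    case False
    hence "a = 0" using ah by (cases a) auto
    moreover have "prime_divs g - {R} = prime_divs g" using False by auto
    ultimately show ?thesis unfolding chi_def by simp
  qed
  finally show ?thesis .
qed

context irred_root
begin

text \<open>Reciprocity at each irreducible factor of f; the signs multiply because degrees add. The
  roles are now exchanged: P enters only through its root, so averaging over P becomes a character
  sum of the fixed polynomial f.\<close>

lemma chi_eq_eta: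
  assumes odd: "odd CARD('a)" and f: "lead_coeff f = 1"
  shows "chi P f = (- 1) ^ ((CARD('a) - 1) div 2 * m * degree f) * eta m (ev f \<alpha>)"
  using f
proof (induction f rule: monic_induct)
  case one
  show ?case by simp
next
  case (mult R g)
  define l where "l = degree R"
  have R: "R \<in> monic_irreds l" using mult by (simp add: monic_irreds_def l_def)
  obtain \<beta> where \<beta>: "ev R \<beta> = 0" using exists_root mult by blast
  interpret R: irred_root R l \<beta> by unfold_locales (use R \<beta> in auto)
  have "poly_legendre P R = (- 1) ^ ((CARD('a) - 1) div 2 * m * l) * eta m (ev R \<alpha>)"
    unfolding R.poly_legendre_eq_eta[OF odd] by (rule reciprocity[OF odd P root R \<beta>])
  moreover have "degree (R * g) = l + degree g"
    using mult by (subst degree_mult_eq) (auto simp: l_def)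
  moreover have "eta m (ev (R * g) \<alpha>) = eta m (ev R \<alpha>) * eta m (ev g \<alpha>)"
    using eta_mult[OF odd, of "ev R \<alpha>" m "ev g \<alpha>"] m_pos root_in_GF by (simp add: GF_ev)
  ultimately show ?case
    by (simp only: chi_mult_irreducible[OF mult(1-3)] mult(4) distrib_left power_add) (simp only: mult_ac)
qed

end

text \<open>The symbol of the nonsquare constant \<gamma> at a prime R is (-1)^(deg R). In the
  L-function the twist therefore replaces q^(-s) by -q^(-s).\<close>

lemma chi_generator:
  fixes \<gamma> :: "'a::{field,finite}"
  assumes odd: "odd CARD('a)" and gen: "\<gamma> \<noteq> 0" "\<forall>x::'a. x \<noteq> 0 \<longrightarrow> (\<exists>n::nat. x = \<gamma> ^ n)"
    and f: "lead_coeff f = 1"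
  shows "chi (smult \<gamma> D) f = (- 1) ^ degree f * chi D f"
  using f
proof (induction f rule: monic_induct)
  case one
  show ?case by simp
next
  case (mult R g)
  define l where "l = degree R"
  have R: "R \<in> monic_irreds l" using mult by (simp add: monic_irreds_def l_def)
  obtain \<beta> where \<beta>: "ev R \<beta> = 0" using exists_root mult by blast
  interpret R: irred_root R l \<beta> by unfold_locales (use R \<beta> in auto)
  have "poly_legendre (smult \<gamma> D) R = (- 1) ^ l * poly_legendre D R"
    unfolding R.poly_legendre_eq_eta[OF odd]
    using eta_mult[OF odd, of "to_ac \<gamma>" l "ev D \<beta>"] R.m_pos R.root_in_GF eta_generator[OF odd gen R.m_pos]
    by (simp add: GF_ev)
  moreover have "degree (R * g) = l + degree g"
    using mult by (subst degree_mult_eq) (auto simp: l_def)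
  ultimately show ?case using mult
    by (simp add: chi_mult_irreducible power_add mult_ac)
qed

section \<open>Hasse derivatives\<close>

text \<open>The coefficient of Y^k in p(X + Y), formally the k-th derivative over k!. Ordinary
  derivatives of order at least the characteristic vanish identically and cannot detect
  multiplicities. For i < k the truncated exponent \<open>i - k\<close> is harmless, the binomial
  coefficient being 0.\<close>

definition hasse :: "nat \<Rightarrow> 'b::comm_ring_1 poly \<Rightarrow> 'b poly" where
  "hasse k p = (\<Sum>i\<le>degree p. monom (of_nat (i choose k) * coeff p i) (i - k))"

lemma coeff_hasse: "coeff (hasse k p) n = of_nat (n + k choose k) * coeff p (n + k)"
proof -
  have "coeff (hasse k p) n = (\<Sum>i\<le>degree p. if i = n + k then of_nat (n + k choose k) * coeff p (n + k) else 0)"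
    unfolding hasse_def coeff_sum
  proof (rule sum.cong)
    fix i
    show "coeff (monom (of_nat (i choose k) * coeff p i) (i - k)) n =
          (if i = n + k then of_nat (n + k choose k) * coeff p (n + k) else 0)"
      by (cases "i < k") (auto simp: binomial_eq_0)
  qed simp
  also have "\<dots> = of_nat (n + k choose k) * coeff p (n + k)"
    by (simp add: coeff_eq_0)
  finally show ?thesis .
qed

lemma hasse_0 [simp]: "hasse 0 p = p"
  and hasse_zero [simp]: "hasse k 0 = 0"
  and hasse_add: "hasse k (p + r) = hasse k p + hasse k r"
  and hasse_diff: "hasse k (p - r) = hasse k p - hasse k r"
  and hasse_smult: "hasse k (smult c p) = smult c (hasse k p)"
  by (auto simp: poly_eq_iff coeff_hasse algebra_simps)

lemma hasse_sum: "hasse k (sum h A) = (\<Sum>i\<in>A. hasse k (h i))"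
  by (induction A rule: infinite_finite_induct) (auto simp: hasse_add)

lemma hasse_ac_poly: "hasse k (ac_poly p) = ac_poly (hasse k p)"
  by (simp add: poly_eq_iff coeff_hasse)

lemma hasse_Suc_pCons: "hasse (Suc k) (pCons a p) = pCons 0 (hasse (Suc k) p) + hasse k p"
proof (rule poly_eqI)
  fix n
  show "coeff (hasse (Suc k) (pCons a p)) n = coeff (pCons 0 (hasse (Suc k) p) + hasse k p) n"
    by (cases n) (simp_all add: coeff_hasse algebra_simps)
qed

lemma hasse_mult: "hasse k (p * r) = (\<Sum>i\<le>k. hasse i p * hasse (k - i) r)"
proof (induction p arbitrary: k)
  case (pCons a p)
  show ?case
  proof (cases k)
    case 0
    thus ?thesis by simp
  next
    case (Suc k')
    have "(\<Sum>i\<le>k. hasse i (pCons a p) * hasse (k - i) r) =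
        pCons a p * hasse k r + (\<Sum>i\<le>k'. (pCons 0 (hasse (Suc i) p) + hasse i p) * hasse (k' - i) r)"
      unfolding Suc by (subst sum.atMost_Suc_shift) (simp add: hasse_Suc_pCons)
    also have "\<dots> = smult a (hasse k r) + pCons 0 (p * hasse k r + (\<Sum>i\<le>k'. hasse (Suc i) p * hasse (k' - i) r))
        + (\<Sum>i\<le>k'. hasse i p * hasse (k' - i) r)"
    proof -
      have "(\<Sum>i\<le>k'. pCons 0 (hasse (Suc i) p) * hasse (k' - i) r) =
            [:0, 1:] * (\<Sum>i\<le>k'. hasse (Suc i) p * hasse (k' - i) r)"
        by (simp add: sum_distrib_left)
      thus ?thesis by (simp add: distrib_right sum.distrib)
    qed
    also have "p * hasse k r + (\<Sum>i\<le>k'. hasse (Suc i) p * hasse (k' - i) r) = hasse k (p * r)"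
    proof -
      have "hasse k (p * r) = (\<Sum>i\<le>Suc k'. hasse i p * hasse (Suc k' - i) r)"
        unfolding Suc by (rule pCons.IH)
      also have "\<dots> = p * hasse k r + (\<Sum>i\<le>k'. hasse (Suc i) p * hasse (k' - i) r)"
        unfolding Suc by (subst sum.atMost_Suc_shift) simp
      finally show ?thesis by simp
    qed
    also have "(\<Sum>i\<le>k'. hasse i p * hasse (k' - i) r) = hasse k' (p * r)"
      by (simp add: pCons.IH)
    also have "smult a (hasse k r) + pCons 0 (hasse k (p * r)) + hasse k' (p * r) = hasse k (pCons a p * r)"
      by (simp add: Suc hasse_add hasse_smult hasse_Suc_pCons)
    finally show ?thesis by simp
  qed
qed simp

text \<open>If p = (X - x) g, the Hasse derivatives of g at x are those of p shifted by one
  order.\<close>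

lemma hasse_zeros_imp_dvd:
  fixes p :: "'b::idom poly"
  assumes "\<And>k. k < l \<Longrightarrow> poly (hasse k p) x = 0"
  shows "[:-x, 1:] ^ l dvd p"
  using assms
proof (induction l arbitrary: p)
  case (Suc l)
  have "poly p x = 0" using Suc.prems[of 0] by simp
  then obtain g where g: "p = [:-x, 1:] * g" by (auto simp: poly_eq_0_iff_dvd)
  have "poly (hasse k g) x = 0" if "k < l" for k
  proof -
    have "p = smult (- x) g + pCons 0 g" by (simp add: g)
    hence "hasse (Suc k) p = smult (- x) (hasse (Suc k) g) + pCons 0 (hasse (Suc k) g) + hasse k g"
      by (simp only: hasse_add hasse_smult hasse_Suc_pCons add.assoc)
    hence "poly (hasse (Suc k) p) x = poly (hasse k g) x" by simp
    thus ?thesis using Suc.prems[of "Suc k"] that by simp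
  qed
  hence "[:-x, 1:] ^ l dvd g" by (rule Suc.IH)
  thus ?case unfolding g power_Suc by (intro mult_dvd_mono) auto
qed simp

lemma degree_hasse:
  assumes "hasse k p \<noteq> 0"
  shows "degree (hasse k p) + k \<le> degree p"
proof -
  have "coeff (hasse k p) (degree (hasse k p)) \<noteq> 0" using assms by simp
  hence "coeff p (degree (hasse k p) + k) \<noteq> 0" unfolding coeff_hasse by auto
  thus ?thesis by (rule le_degree)
qed

text \<open>By the product rule, each order of differentiation costs at most one factor f.\<close>

lemma power_dvd_hasse:
  "k \<le> n \<Longrightarrow> f ^ (n - k) dvd hasse k (f ^ n * r)"
proof (induction n arbitrary: k)
  case (Suc n)
  have "f ^ (Suc n - k) dvd hasse i f * hasse (k - i) (f ^ n * r)" if i: "i \<le> k" for i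
  proof (cases "k - i \<le> n")
    case True
    hence *: "f ^ (n - (k - i)) dvd hasse (k - i) (f ^ n * r)" by (rule Suc.IH)
    show ?thesis
    proof (cases "i = 0")
      case True
      hence "f ^ (Suc n - k) = f * f ^ (n - k)" using \<open>k - i \<le> n\<close> by (simp add: Suc_diff_le)
      thus ?thesis using * True by (simp add: mult_dvd_mono)
    next
      case False
      hence "f ^ (Suc n - k) dvd f ^ (n - (k - i))" using i by (intro le_imp_power_dvd) auto
      thus ?thesis using * by (meson dvd_mult dvd_trans)
    qed
  next
    case False
    hence "Suc n - k = 0" by auto
    thus ?thesis by simp
  qed
  thus ?case by (simp only: hasse_mult[of k f "f ^ n * r"] mult.assoc power_Suc) (rule dvd_sum, auto)
qed simp

lemma of_nat_choose_card_power_eq_0: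
  assumes "0 < i" "i < CARD('a::{field,finite}) ^ m"
  shows "of_nat (CARD('a) ^ m choose i) = (0::'a)"
proof -
  let ?Q = "CARD('a) ^ m"
  have "(\<Sum>k\<le>?Q. monom (of_nat (?Q choose k)) k) = (monom 1 1 + 1 :: 'a poly) ^ ?Q"
    by (simp add: binomial_ring of_nat_monom mult_monom monom_power flip: of_nat_mult)
  also have "\<dots> = monom 1 ?Q + 1" unfolding frob_poly_add by (simp add: monom_power)
  finally have "coeff (\<Sum>k\<le>?Q. monom (of_nat (?Q choose k) :: 'a) k) i = coeff (monom 1 ?Q + 1) i" by simp
  thus ?thesis using assms by (simp add: coeff_sum)
qed

lemma hasse_monom_card_power:
  assumes "0 < i" "i < CARD('a::{field,finite}) ^ m"
  shows "hasse i (monom (1::'a) (j * CARD('a) ^ m)) = 0"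
  using assms
proof (induction j arbitrary: i)
  case 0
  thus ?case by (auto simp: poly_eq_iff coeff_hasse)
next
  case (Suc j)
  let ?Q = "CARD('a) ^ m"
  have base: "hasse t (monom (1::'a) ?Q) = 0" if "0 < t" "t < ?Q" for t
  proof (rule poly_eqI)
    fix n
    show "coeff (hasse t (monom (1::'a) ?Q)) n = coeff 0 n"
      using of_nat_choose_card_power_eq_0[OF that] by (auto simp: coeff_hasse)
  qed
  have "monom (1::'a) (Suc j * ?Q) = monom 1 ?Q * monom 1 (j * ?Q)" by (simp add: mult_monom)
  hence "hasse i (monom (1::'a) (Suc j * ?Q)) = (\<Sum>t\<le>i. hasse t (monom 1 ?Q) * hasse (i - t) (monom 1 (j * ?Q)))"
    by (simp only: hasse_mult)
  also have "\<dots> = (\<Sum>t\<le>i. 0)"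
  proof (rule sum.cong)
    fix t assume t: "t \<in> {..i}"
    show "hasse t (monom 1 ?Q) * hasse (i - t) (monom (1::'a) (j * ?Q)) = 0"
    proof (cases "t = 0")
      case True
      thus ?thesis using Suc by simp
    next
      case False
      thus ?thesis using base[of t] t Suc.prems by simp
    qed
  qed simp
  finally show ?case by simp
qed

text \<open>Below order Q the power T^(j Q) is a constant for differentiation, while on
  \<open>GF m\<close> it takes the value x^j. This double nature lets the auxiliary polynomial have
  large degree and yet be subject to cheap vanishing conditions.\<close>

lemma hasse_mult_monom_card_power:
  assumes "k < CARD('a::{field,finite}) ^ m"
  shows "hasse k (p * monom (1::'a) (j * CARD('a) ^ m)) = hasse k p * monom 1 (j * CARD('a) ^ m)"
proof -
  have "hasse k (p * monom (1::'a) (j * CARD('a) ^ m)) =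
    (\<Sum>i\<le>k. hasse i p * hasse (k - i) (monom (1::'a) (j * CARD('a) ^ m)))" by (rule hasse_mult)
  also have "\<dots> = (\<Sum>i\<in>{k}. hasse i p * hasse (k - i) (monom (1::'a) (j * CARD('a) ^ m)))"
    using assms by (intro sum.mono_neutral_right) (auto simp: hasse_monom_card_power)
  finally show ?thesis by simp
qed

section \<open>Stepanov's method\<close>

lemma card_zeros_order_bound:
  fixes p :: "'b::idom poly"
  assumes "finite S" "p \<noteq> 0" "\<And>x. x \<in> S \<Longrightarrow> [:-x, 1:] ^ l dvd p"
  shows "l * card S \<le> degree p"
  using assms
proof (induction S arbitrary: p)
  case (insert x S)
  obtain g where g: "p = [:-x, 1:] ^ l * g" using insert.prems(2)[of x] by auto
  have g0: "g \<noteq> 0" using g insert.prems by auto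
  have "[:-y, 1:] ^ l dvd g" if y: "y \<in> S" for y
  proof -
    have "y \<noteq> x" using y insert by auto
    hence "order y ([:-x, 1:] ^ l) = 0" by (simp add: order_0I)
    hence "order y p = order y g" using insert.prems(1) by (simp add: g order_mult)
    moreover have "l \<le> order y p" using insert.prems y by (simp add: order_divides)
    ultimately show ?thesis by (simp add: order_divides)
  qed
  hence "l * card S \<le> degree g" using insert.IH g0 by blast
  moreover have "degree p = l + degree g"
    using g0 by (simp add: g degree_mult_eq degree_power_eq)
  ultimately show ?case using insert by simp
qed simp

text \<open>An irreducible factor of r also divides s and cancels; in the end r is constant. For a
  nonsquare f this rules out f r^2 = s^2 with r \<noteq> 0.\<close>

lemma square_quotient:
  fixes f :: "'a::field poly"
  assumes "r \<noteq> 0" "f * r ^ 2 = s ^ 2"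
  shows "\<exists>h. f = h ^ 2"
  using assms
proof (induction "degree r" arbitrary: r s rule: less_induct)
  case less
  show ?case
  proof (cases "degree r = 0")
    case True
    then obtain c where c: "r = [:c:]" by (rule degree_eq_zeroE)
    hence "c \<noteq> 0" using less.prems by auto
    have "smult (c ^ 2) f = s ^ 2" using less.prems c by (simp add: power2_eq_square)
    hence "f = smult (inverse (c ^ 2)) (s ^ 2)" using \<open>c \<noteq> 0\<close> by (metis left_inverse power_not_zero smult_1_left smult_smult)
    also have "\<dots> = (smult (inverse c) s) ^ 2" by (simp add: smult_power power_inverse)
    finally show ?thesis by blast
  next
    case False
    hence "degree r > 0" by simp
    from exists_irreducible_dvd[OF this] obtain R where R: "irreducible R" "R dvd r" by blast
    then obtain r' where r': "r = R * r'" by auto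
    have "R dvd f * r ^ 2" using R by (simp add: power2_eq_square)
    hence "R dvd s ^ 2" using less.prems(2) by simp
    hence "R dvd s" using field_poly_irreducible_imp_prime[OF R(1)] prime_elem_dvd_power by blast
    then obtain s' where s': "s = R * s'" by auto
    have nz: "R \<noteq> 0" "r' \<noteq> 0" using less.prems r' by auto
    have "R ^ 2 * (f * r' ^ 2) = R ^ 2 * s' ^ 2"
      using less.prems(2) by (simp add: r' s' power_mult_distrib mult_ac)
    hence "f * r' ^ 2 = s' ^ 2" using nz by simp
    moreover have "degree r' < degree r"
      using irreducible_degree_pos[OF R(1)] nz by (simp add: r' degree_mult_eq)
    ultimately show ?thesis using less.hyps nz by blast
  qed
qed

lemma polys_mono: "n \<le> k \<Longrightarrow> p \<in> polys n \<Longrightarrow> p \<in> polys k"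
  and polys_0 [simp]: "0 \<in> polys n"
  by (auto simp: polys_def)

lemma polys_add: "p \<in> polys n \<Longrightarrow> r \<in> polys n \<Longrightarrow> p + r \<in> polys n"
  for p r :: "'a::comm_monoid_add poly"
  by (auto simp: polys_def)

lemma polys_diff: "p \<in> polys n \<Longrightarrow> r \<in> polys n \<Longrightarrow> p - r \<in> polys n"
  for p r :: "'a::ab_group_add poly"
  by (auto simp: polys_def)

lemma polys_smult: "p \<in> polys n \<Longrightarrow> smult c p \<in> polys n"
  for p :: "'a::comm_ring_1 poly"
  by (auto simp: polys_def)

lemma polys_sum: "(\<And>i. i \<in> A \<Longrightarrow> h i \<in> polys n) \<Longrightarrow> sum h A \<in> polys n"
  for h :: "'i \<Rightarrow> 'a::comm_monoid_add poly"
  by (induction A rule: infinite_finite_induct) (auto intro: polys_add)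

lemma polys_mult:
  fixes p r :: "'a::comm_ring_1 poly"
  assumes "p \<in> polys a" "r \<in> polys b" "a + b \<le> Suc n"
  shows "p * r \<in> polys n"
proof (cases "a = 0 \<or> b = 0")
  case True
  hence "p = 0 \<or> r = 0" using assms by (auto simp: polys_def poly_eq_iff)
  thus ?thesis by auto
next
  case False
  hence "degree p < a" "degree r < b" using assms by (auto simp: polys_iff_degree)
  moreover have "degree (p * r) \<le> degree p + degree r" by (rule degree_mult_le)
  ultimately have "degree (p * r) < n" using assms(3) by linarith
  thus ?thesis by (auto simp: polys_def intro: coeff_eq_0)
qed

lemma polys_degree: "p \<in> polys (Suc (degree p))"
  by (auto simp: polys_def intro: coeff_eq_0)

text \<open>Uniqueness of the expansion in base T^Q, with digits of degree below Q.\<close>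

lemma base_expansion_eq_0:
  fixes H :: "'a::comm_ring_1 poly poly"
  assumes "\<And>n. coeff H n \<in> polys Q" "poly H (monom 1 Q) = 0"
  shows "H = 0"
  using assms
proof (induction H)
  case (pCons h H)
  have h: "h \<in> polys Q" using pCons.prems(1)[of 0] by simp
  have eq: "h + monom 1 Q * poly H (monom 1 Q) = 0" using pCons.prems(2) by simp
  have "coeff h k = 0" for k
  proof (cases "k < Q")
    case True
    have "coeff (h + monom 1 Q * poly H (monom 1 Q)) k = 0" using eq by simp
    thus ?thesis using True by (simp add: coeff_monom_mult)
  next
    case False
    thus ?thesis using h by (simp add: polys_def)
  qed
  hence "h = 0" by (simp add: poly_eq_iff)
  moreover have "poly H (monom 1 Q) = 0"
  proof (rule poly_eqI)
    fix k
    have "coeff (monom 1 Q * poly H (monom 1 Q)) (k + Q) = 0" using eq \<open>h = 0\<close> by simp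
    thus "coeff (poly H (monom 1 Q)) k = coeff 0 k" by (simp add: coeff_monom_mult)
  qed
  moreover have "coeff H n \<in> polys Q" for n using pCons.prems(1)[of "Suc n"] by simp
  ultimately show ?case using pCons.IH by simp
qed simp

text \<open>Here it matters that f is not a square. As 2 c + 1 = Q, squaring the relation and
  multiplying by f gives f Gr^2 = f^Q Gs^2 at Y = T^Q, where f^Q = f(Y). The bound on D makes all
  coefficients digits in base T^Q, so the relation holds for an indeterminate Y.\<close>

lemma stepanov_nonvanishing:
  fixes f :: "'a::{field,finite} poly" and r s :: "nat \<Rightarrow> 'a poly"
  assumes odd: "odd CARD('a)" and monic: "lead_coeff f = 1" and nsq: "\<And>h. f \<noteq> h ^ 2"
    and D: "2 * D + degree f \<le> CARD('a) ^ m + 1"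
    and rs: "\<And>j. j < J \<Longrightarrow> r j \<in> polys D" "\<And>j. j < J \<Longrightarrow> s j \<in> polys D"
    and zero: "(\<Sum>j<J. (r j + s j * f ^ ((CARD('a) ^ m - 1) div 2)) * monom 1 (j * CARD('a) ^ m)) = 0"
    and j: "j < J"
  shows "r j = 0 \<and> s j = 0"
proof -
  let ?Q = "CARD('a) ^ m" and ?c = "(CARD('a) ^ m - 1) div 2"
  let ?Y = "monom (1::'a) ?Q"
  define Gr where "Gr = (\<Sum>j<J. monom (r j) j)"
  define Gs where "Gs = (\<Sum>j<J. monom (s j) j)"
  define F where "F = map_poly (\<lambda>x. [:x:]) f"
  have f0: "f \<noteq> 0" using monic by auto
  have Y: "?Y ^ i = monom 1 (i * ?Q)" for i by (simp add: monom_power mult.commute)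
  have "poly Gr ?Y + f ^ ?c * poly Gs ?Y = 0"
    using zero by (simp add: Gr_def Gs_def poly_sum poly_monom Y algebra_simps sum.distrib sum_distrib_left)
  hence "poly Gr ?Y = - (f ^ ?c * poly Gs ?Y)" by (simp add: eq_neg_iff_add_eq_0)
  hence "poly Gr ?Y ^ 2 = f ^ (2 * ?c) * poly Gs ?Y ^ 2"
    by (simp add: power_mult_distrib mult.commute flip: power_mult)
  moreover have "f * f ^ (2 * ?c) = f ^ ?Q"
    using two_mul_half[OF odd, of m] by (simp flip: power_Suc)
  moreover have "f ^ ?Q = poly F ?Y" unfolding poly_frob pcompose_altdef F_def by simp
  ultimately have "f * poly Gr ?Y ^ 2 = poly F ?Y * poly Gs ?Y ^ 2" by (simp flip: mult.assoc)
  hence "poly (smult f (Gr ^ 2) - F * Gs ^ 2) ?Y = 0" by simp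
  moreover have "coeff (smult f (Gr ^ 2) - F * Gs ^ 2) n \<in> polys ?Q" for n
  \<comment> \<open>The degree bound \<open>2 * D - 1\<close> of the second case would be truncated
    at D = 0.\<close>
  proof (cases "D = 0")
    case True
    hence "r j = 0" "s j = 0" if "j < J" for j using rs that by (auto simp: polys_def poly_eq_iff)
    hence "Gr = 0" "Gs = 0" by (auto simp: Gr_def Gs_def)
    thus ?thesis by simp
  next
    case D0: False
    have Gr: "coeff Gr i \<in> polys D" and Gs: "coeff Gs i \<in> polys D" for i
      using rs by (auto simp: Gr_def Gs_def coeff_sum intro!: polys_sum)
    have sq: "coeff (G ^ 2) i \<in> polys (2 * D - 1)" if "\<And>i. coeff G i \<in> polys D" for G :: "'a poly poly" and i
      unfolding power2_eq_square coeff_mult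
      by (intro polys_sum polys_mult[of _ D _ D]) (use that D0 in auto)
    have "f * coeff (Gr ^ 2) n \<in> polys ?Q"
      by (rule polys_mult[OF polys_degree sq[OF Gr]]) (use D D0 in simp)
    moreover have "coeff (F * Gs ^ 2) n \<in> polys ?Q"
      unfolding coeff_mult
    proof (intro polys_sum)
      fix i
      have "[:coeff f i:] \<in> polys (Suc 0)" by (auto simp: polys_def coeff_pCons split: nat.splits)
      thus "coeff F i * coeff (Gs ^ 2) (n - i) \<in> polys ?Q"
        unfolding F_def using D D0 by (intro polys_mult[OF _ sq[OF Gs]]) (auto simp: coeff_map_poly)
    qed
    ultimately show ?thesis by (simp add: polys_diff)
  qed
  ultimately have "smult f (Gr ^ 2) - F * Gs ^ 2 = 0" by (intro base_expansion_eq_0) auto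
  hence eq: "smult f (Gr ^ 2) = F * Gs ^ 2" by simp
  have "lead_coeff F = [:lead_coeff f:]"
    unfolding F_def by (rule lead_coeff_map_poly_nz) (use monic in auto)
  \<comment> \<open>F is monic in Y, so comparing leading coefficients in Y leaves f times a square
    equal to a square in F_q[T].\<close>
  hence "f * lead_coeff Gr ^ 2 = lead_coeff Gs ^ 2"
    using arg_cong[OF eq, of lead_coeff] monic
    by (simp only: lead_coeff_smult lead_coeff_mult lead_coeff_power) (simp flip: one_pCons)
  hence "Gr = 0" using square_quotient[of "lead_coeff Gr" f "lead_coeff Gs"] nsq by auto
  moreover from this have "F * Gs ^ 2 = 0" using eq by simp
  moreover have "F \<noteq> 0" using \<open>lead_coeff F = _\<close> monic by auto
  ultimately have "Gr = 0" "Gs = 0" by auto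
  moreover have "coeff Gr j = r j" "coeff Gs j = s j"
    using j by (simp_all add: Gr_def Gs_def coeff_sum)
  ultimately show ?thesis by simp
qed

section \<open>The auxiliary polynomial\<close>

definition hasse_quot :: "nat \<Rightarrow> nat \<Rightarrow> 'a::field poly \<Rightarrow> 'a poly \<Rightarrow> 'a poly" where
  "hasse_quot n k f r = hasse k (f ^ n * r) div f ^ (n - k)"

lemma hasse_quot_mult: "k \<le> n \<Longrightarrow> hasse_quot n k f r * f ^ (n - k) = hasse k (f ^ n * r)"
  unfolding hasse_quot_def by (intro dvd_div_mult_self power_dvd_hasse)

lemma hasse_quot_diff: "hasse_quot n k f (r - s) = hasse_quot n k f r - hasse_quot n k f s"
  unfolding hasse_quot_def by (simp add: right_diff_distrib hasse_diff poly_div_diff_left)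

text \<open>Differentiation lowers the degree by k, and dividing out f^(n-k) leaves k deg f of the
  degree of f^n. The growth is deg f - 1 per order and independent of n, which keeps the linear
  conditions few even for the large exponent l + c.\<close>

lemma hasse_quot_polys:
  assumes "k \<le> n" "degree f > 0" "r \<in> polys D"
  shows "hasse_quot n k f r \<in> polys (D + k * (degree f - 1))"
proof (cases "hasse_quot n k f r = 0")
  case False
  let ?d = "degree f" and ?h = "hasse_quot n k f r"
  have f0: "f \<noteq> 0" using assms by auto
  have nz: "hasse k (f ^ n * r) \<noteq> 0" using False by (auto simp: hasse_quot_def)
  hence r0: "r \<noteq> 0" by auto
  hence "D > 0" using assms(3) by (auto simp: polys_def poly_eq_iff)
  hence "degree r < D" using assms(3) by (simp add: polys_iff_degree)
  have "degree (hasse k (f ^ n * r)) = degree ?h + (n - k) * ?d"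
    using False f0 by (subst hasse_quot_mult[OF assms(1), symmetric]) (simp add: degree_mult_eq degree_power_eq)
  moreover have "degree (f ^ n * r) = n * ?d + degree r"
    using f0 r0 by (simp add: degree_mult_eq degree_power_eq)
  ultimately have "degree ?h + (n - k) * ?d + k \<le> n * ?d + degree r"
    using degree_hasse[OF nz] by simp
  moreover have "n * ?d = (n - k) * ?d + k * ?d" using assms(1) by (simp flip: add_mult_distrib)
  moreover have "k * ?d = k * (?d - 1) + k" using assms(2) by (cases ?d) auto
  ultimately have "degree ?h < D + k * (?d - 1)" using \<open>degree r < D\<close> by linarith
  thus ?thesis by (auto simp: polys_def intro: coeff_eq_0)
qed simp

lemma polys_mult_monom: "p \<in> polys n \<Longrightarrow> n + j \<le> k \<Longrightarrow> p * monom 1 j \<in> polys k"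
  for p :: "'a::comm_ring_1 poly"
  by (rule polys_mult[of _ n _ "Suc j"]) (auto simp: polys_def)

text \<open>The vanishing conditions on the auxiliary polynomial are linear, and there are fewer of them
  than coefficients; over a finite field a nontrivial solution exists by the pigeonhole principle.\<close>

lemma stepanov_auxiliary:
  fixes f :: "'a::{field,finite} poly"
  assumes deg: "degree f > 0"
    and count: "(\<Sum>k<l. D + k * (degree f - 1) + J - 1) < 2 * D * J"
  obtains r s :: "nat \<Rightarrow> 'a poly" where
    "\<And>j. j < J \<Longrightarrow> r j \<in> polys D" "\<And>j. j < J \<Longrightarrow> s j \<in> polys D"
    "\<exists>j<J. r j \<noteq> 0 \<or> s j \<noteq> 0"
    "\<And>k. k < l \<Longrightarrow>
       (\<Sum>j<J. (hasse_quot l k f (r j) + smult a (hasse_quot (l + c) k f (s j))) * monom 1 j) = 0"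
proof -
  define T where "T = (\<lambda>k r s. \<Sum>j<J. (hasse_quot l k f (r j) + smult a (hasse_quot (l + c) k f (s j))) * monom 1 j)"
  define A where "A = PiE {..<J} (\<lambda>_. polys D :: 'a poly set)"
  define B where "B = PiE {..<l} (\<lambda>k. polys (D + k * (degree f - 1) + J - 1) :: 'a poly set)"
  define \<Phi> where "\<Phi> = (\<lambda>(r, s). restrict (\<lambda>k. T k r s) {..<l})"
  have \<Phi>: "\<Phi> ` (A \<times> A) \<subseteq> B"
  proof
    fix z assume "z \<in> \<Phi> ` (A \<times> A)"
    then obtain r s where rs: "r \<in> A" "s \<in> A" "z = \<Phi> (r, s)" by auto
    \<comment> \<open>D + k (deg f - 1) coefficients come from the quotients and J - 1 more from the
      shifts by T^j with j < J.\<close>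
    have "T k r s \<in> polys (D + k * (degree f - 1) + J - 1)" if "k < l" for k
      unfolding T_def
    proof (intro polys_sum)
      fix j assume j: "j \<in> {..<J}"
      have "r j \<in> polys D" "s j \<in> polys D" using rs j by (auto simp: A_def)
      hence "hasse_quot l k f (r j) + smult a (hasse_quot (l + c) k f (s j)) \<in> polys (D + k * (degree f - 1))"
        using deg that by (intro polys_add polys_smult hasse_quot_polys) auto
      thus "(hasse_quot l k f (r j) + smult a (hasse_quot (l + c) k f (s j))) * monom 1 j
              \<in> polys (D + k * (degree f - 1) + J - 1)"
        using j by (rule_tac polys_mult_monom) auto
    qed
    thus "z \<in> B" using rs by (auto simp: \<Phi>_def B_def)
  qed
  have finA: "finite A" and finB: "finite B" unfolding A_def B_def by (auto intro!: finite_PiE)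
  have "card (A \<times> A) = (CARD('a) ^ D) ^ J * (CARD('a) ^ D) ^ J"
    unfolding A_def by (simp add: card_PiE card_polys card_cartesian_product)
  also have "\<dots> = CARD('a) ^ (2 * D * J)"
    unfolding power_mult[symmetric] power_add[symmetric]
    by (rule arg_cong[where f = "\<lambda>n. CARD('a) ^ n"]) simp
  finally have "card (A \<times> A) = CARD('a) ^ (2 * D * J)" .
  moreover have "card B = CARD('a) ^ (\<Sum>k<l. D + k * (degree f - 1) + J - 1)"
    unfolding B_def by (simp add: card_PiE card_polys power_sum)
  ultimately have "card B < card (A \<times> A)" using count card_gt_1[where 'a='a] by simp
  hence "card (\<Phi> ` (A \<times> A)) < card (A \<times> A)" using card_mono[OF finB \<Phi>] by linarith
  hence "\<not> inj_on \<Phi> (A \<times> A)" by (rule pigeonhole)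
  then obtain r1 s1 r2 s2 where rs: "r1 \<in> A" "s1 \<in> A" "r2 \<in> A" "s2 \<in> A"
    and eq: "\<Phi> (r1, s1) = \<Phi> (r2, s2)" and neq: "(r1, s1) \<noteq> (r2, s2)"
    unfolding inj_on_def by blast
  \<comment> \<open>The conditions are additive, so the difference of two colliding families solves
    the homogeneous system.\<close>
  show ?thesis
  proof (rule that[of "\<lambda>j. r1 j - r2 j" "\<lambda>j. s1 j - s2 j"])
    show "r1 j - r2 j \<in> polys D" "s1 j - s2 j \<in> polys D" if "j < J" for j
      using rs that by (auto simp: A_def intro!: polys_diff)
    show "\<exists>j<J. r1 j - r2 j \<noteq> 0 \<or> s1 j - s2 j \<noteq> 0"
    proof (rule ccontr)
      assume *: "\<not> ?thesis"
      have "r1 = r2" by (rule PiE_ext[of _ "{..<J}" "\<lambda>_. polys D"]) (use rs * in \<open>auto simp: A_def\<close>)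
      moreover have "s1 = s2" by (rule PiE_ext[of _ "{..<J}" "\<lambda>_. polys D"]) (use rs * in \<open>auto simp: A_def\<close>)
      ultimately show False using neq by simp
    qed
    show "(\<Sum>j<J. (hasse_quot l k f (r1 j - r2 j) + smult a (hasse_quot (l + c) k f (s1 j - s2 j))) * monom 1 j) = 0"
      if "k < l" for k
    proof -
      have "T k r1 s1 = T k r2 s2" using fun_cong[OF eq, of k] that by (simp add: \<Phi>_def)
      thus ?thesis unfolding T_def
        by (simp add: hasse_quot_diff smult_diff_right algebra_simps sum_subtractf sum.distrib)
    qed
  qed
qed

text \<open>At a point x of \<open>GF m\<close> with f(x)^c = a, the factors f^c and T^(j Q) take
  the values a and x^j. The k-th Hasse derivative of R is then f(x)^(l-k) times the k-th linear
  condition, hence 0. So x is a zero of order l, and deg R bounds the number of such x. The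
  prefactor f^l in R is what allows f^(l-k) to be split off for every k < l.\<close>

lemma stepanov_bound:
  fixes f :: "'a::{field,finite} poly" and a :: 'a
  assumes odd: "odd CARD('a)" and monic: "lead_coeff f = 1" and nsq: "\<And>h. f \<noteq> h ^ 2"
    and deg: "degree f > 0" and m: "m > 0"
    and D: "2 * D + degree f \<le> CARD('a) ^ m + 1" and l: "l \<le> CARD('a) ^ m"
    and count: "(\<Sum>k<l. D + k * (degree f - 1) + J - 1) < 2 * D * J"
  defines "c \<equiv> (CARD('a) ^ m - 1) div 2"
  shows "l * card {x \<in> GF m. ev f x ^ c = to_ac a} \<le> l * degree f + (J - 1) * CARD('a) ^ m + D + c * degree f"
proof -
  let ?Q = "CARD('a) ^ m" and ?S = "{x \<in> GF m. ev f x ^ c = to_ac a}"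
  obtain r s :: "nat \<Rightarrow> 'a poly" where
    rs: "\<And>j. j < J \<Longrightarrow> r j \<in> polys D" "\<And>j. j < J \<Longrightarrow> s j \<in> polys D"
    and nz: "\<exists>j<J. r j \<noteq> 0 \<or> s j \<noteq> 0"
    and T: "\<And>k. k < l \<Longrightarrow>
       (\<Sum>j<J. (hasse_quot l k f (r j) + smult a (hasse_quot (l + c) k f (s j))) * monom 1 j) = 0"
    using stepanov_auxiliary[OF deg count, of a c] by blast
  have f0: "f \<noteq> 0" using deg by auto
  define G where "G = (\<Sum>j<J. (r j + s j * f ^ c) * monom 1 (j * ?Q))"
  define R where "R = f ^ l * G"
  have "G \<noteq> 0"
  proof
    assume "G = 0"
    hence "r j = 0 \<and> s j = 0" if "j < J" for j
      using that rs unfolding G_def c_def by (intro stepanov_nonvanishing[OF odd monic nsq D, of J r s]) auto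
    thus False using nz by blast
  qed
  hence R0: "R \<noteq> 0" using f0 by (simp add: R_def)
  have R_eq: "R = (\<Sum>j<J. (f ^ l * r j) * monom 1 (j * ?Q) + (f ^ (l + c) * s j) * monom 1 (j * ?Q))"
    unfolding R_def G_def by (simp add: sum_distrib_left algebra_simps power_add)
  have "[:-x, 1:] ^ l dvd ac_poly R" if x: "x \<in> ?S" for x
  proof (rule hasse_zeros_imp_dvd)
    fix k assume k: "k < l"
    have xQ: "x ^ (j * ?Q) = x ^ j" for j
      using x by (simp add: GF_def power_mult mult.commute[of j])
    have split: "hasse k (f ^ (l + c) * s j) = hasse_quot (l + c) k f (s j) * (f ^ c * f ^ (l - k))" for j
    proof -
      have "f ^ (l + c - k) = f ^ c * f ^ (l - k)"
        using k by (simp add: add.commute flip: power_add)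
      thus ?thesis using hasse_quot_mult[of k "l + c" f "s j"] k by simp
    qed
    have "hasse k R = (\<Sum>j<J. hasse_quot l k f (r j) * f ^ (l - k) * monom 1 (j * ?Q)
        + hasse_quot (l + c) k f (s j) * (f ^ c * f ^ (l - k)) * monom 1 (j * ?Q))"
      unfolding R_eq hasse_sum using k l
      by (simp add: hasse_add hasse_mult_monom_card_power hasse_quot_mult split)
    hence "ev (hasse k R) x = (\<Sum>j<J. ev f x ^ (l - k) *
        (ev (hasse_quot l k f (r j)) x + to_ac a * ev (hasse_quot (l + c) k f (s j)) x) * x ^ j)"
      using x by (simp add: ev_sum xQ algebra_simps)
    also have "\<dots> = ev f x ^ (l - k) *
        ev (\<Sum>j<J. (hasse_quot l k f (r j) + smult a (hasse_quot (l + c) k f (s j))) * monom 1 j) x"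
      by (simp add: ev_sum sum_distrib_left mult.assoc)
    also have "\<dots> = 0" using T[OF k] by simp
    finally show "poly (hasse k (ac_poly R)) x = 0" by (simp add: hasse_ac_poly ev_def)
  qed
  hence "l * card ?S \<le> degree (ac_poly R)"
    using R0 m by (intro card_zeros_order_bound) auto
  also have "\<dots> = l * degree f + degree G"
    using f0 \<open>G \<noteq> 0\<close> by (simp add: R_def degree_mult_eq degree_power_eq)
  also have "degree G \<le> (J - 1) * ?Q + D + c * degree f"
    unfolding G_def
  proof (rule degree_sum_le)
    fix j assume j: "j \<in> {..<J}"
    have dr: "degree p \<le> D" if "p \<in> polys D" for p :: "'a poly"
      using that by (auto simp: polys_def intro: degree_le)
    have "degree (s j * f ^ c) \<le> D + c * degree f"
      using degree_mult_le[of "s j" "f ^ c"] degree_power_le[of f c] dr[OF rs(2)] j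
      by (simp add: mult.commute) (meson add_mono dr le_trans rs(2))
    hence "degree (r j + s j * f ^ c) \<le> D + c * degree f"
      using dr[OF rs(1)] j by (intro degree_add_le) (auto intro: trans_le_add1)
    moreover have "degree (monom (1::'a) (j * ?Q)) \<le> (J - 1) * ?Q"
      using j by (intro order.trans[OF degree_monom_le] mult_right_mono) auto
    ultimately show "degree ((r j + s j * f ^ c) * monom 1 (j * ?Q)) \<le> (J - 1) * ?Q + D + c * degree f"
      using degree_mult_le[of "r j + s j * f ^ c" "monom 1 (j * ?Q)"] by linarith
  qed simp
  finally show ?thesis by simp
qed

text \<open>The conditions cost about l D + l J + l^2 (d - 1)/2 against 2 D J coefficients, so J
  must exceed l/2. The excess d + 5/2 yields a surplus D (2 d + 5), which covers the other terms
  because D \<ge> l^2.\<close>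

lemma stepanov_count:
  fixes d l D J Q :: nat
  assumes "odd l" "0 < d" "d \<le> l" "3 * (l * l) \<le> Q" "2 * D \<ge> Q - d" "2 * J = l + 2 * d + 5"
  shows "(\<Sum>k<l. D + k * (d - 1) + J - 1) < 2 * D * J"
proof -
  have J: "J \<ge> 1" using assms(6) by linarith
  have "(\<Sum>k<l. D + k * (d - 1) + J - 1) = (\<Sum>k<l. D + (J - 1)) + (\<Sum>k<l. k * (d - 1))"
    using J by (subst sum.distrib[symmetric]) (auto intro!: sum.cong)
  also have "(\<Sum>k<l. k * (d - 1)) = (\<Sum>k<l. k) * (d - 1)" by (simp add: sum_distrib_right)
  finally have "2 * (\<Sum>k<l. D + k * (d - 1) + J - 1) = 2 * (l * (D + (J - 1))) + (2 * (\<Sum>k<l. k)) * (d - 1)" by simp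
  also have "2 * (\<Sum>k<l. k) = l * (l - 1)" by (induction l) (auto simp: algebra_simps)
  also have "l * (l - 1) * (d - 1) \<le> l * l * (d - 1)" by simp
  finally have 1: "2 * (\<Sum>k<l. D + k * (d - 1) + J - 1) \<le> 2 * (l * D) + l * (2 * (J - 1)) + l * l * (d - 1)"
    by (simp add: algebra_simps)
  have 2: "2 * (2 * D * J) = 2 * (l * D) + 2 * D * (2 * d + 5)"
    using assms(6) by (simp add: algebra_simps flip: mult.assoc)
  have ll: "d \<le> l * l" "l \<le> l * l" using assms(3) by (cases l; simp)+
  have 3: "2 * (l * l) \<le> 2 * D" using assms ll by linarith
  hence "2 * (l * l) * (2 * d + 5) \<le> 2 * D * (2 * d + 5)" by (rule mult_right_mono) simp
  moreover have "l * (2 * (J - 1)) + l * l * (d - 1) < 2 * (l * l) * (2 * d + 5)"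
  proof -
    have "2 * (J - 1) = l + 2 * d + 3" using assms(6) J by linarith
    hence "l * (2 * (J - 1)) = l * l + 2 * (l * d) + 3 * l" by (simp add: algebra_simps)
    moreover have "l * d \<le> l * l" using assms by simp
    moreover have "l * l * (d - 1) \<le> l * l * d" by simp
    moreover have "2 * (l * l) * (2 * d + 5) = 4 * (l * l * d) + 10 * (l * l)" by (simp add: algebra_simps)
    moreover have "l * l > 0" using assms by auto
    ultimately show ?thesis using ll by linarith
  qed
  ultimately show ?thesis using 1 2 by linarith
qed

text \<open>The order of vanishing is l = q^g, of the size of the square root of Q: q l^2 \<le> Q
  \<le> l q^(g+2). D is as large as \<open>stepanov_nonvanishing\<close> permits and J is the value
  in \<open>stepanov_count\<close>. Dividing the degree bound by l leaves Q/2 and an error of order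
  d Q / l.\<close>

lemma stepanov_count_sign:
  fixes f :: "'a::{field,finite} poly" and a :: 'a
  assumes odd: "odd CARD('a)" and monic: "lead_coeff f = 1" and nsq: "\<And>h. f \<noteq> h ^ 2"
    and deg: "0 < degree f" "degree f \<le> g" and m: "2 * g < m" "m \<le> 2 * g + 2"
  defines "c \<equiv> (CARD('a) ^ m - 1) div 2"
  shows "2 * card {x \<in> GF m. ev f x ^ c = to_ac a} \<le> CARD('a) ^ m + 10 * degree f * CARD('a) ^ (g + 2)"
proof -
  define q l Q d where "q = CARD('a)" and "l = q ^ g" and "Q = q ^ m" and "d = degree f"
  have "q > 1" using card_gt_1[where 'a='a] by (simp add: q_def)
  hence q3: "q \<ge> 3" using odd unfolding q_def[symmetric] by (cases "q = 2") auto
  have "g < q ^ g" using \<open>q > 1\<close> by (intro power_gt_expt) simp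
  hence dl: "d \<le> l" using deg by (simp add: d_def l_def)
  have "q * (l * l) = q ^ (2 * g + 1)" by (simp add: l_def mult_2 flip: power_add)
  also have "\<dots> \<le> Q" unfolding Q_def using m q3 by (intro power_increasing) auto
  finally have "q * (l * l) \<le> Q" .
  moreover have "3 * (l * l) \<le> q * (l * l)" using q3 by (rule mult_right_mono) simp
  ultimately have Q3: "3 * (l * l) \<le> Q" by linarith
  have "Q \<le> q ^ (2 * g + 2)" unfolding Q_def using m q3 by (intro power_increasing) auto
  also have "\<dots> = l * q ^ (g + 2)" by (simp add: l_def mult_2 flip: power_add)
  finally have Q_le: "Q \<le> l * q ^ (g + 2)" .
  have "odd l" using odd by (simp add: l_def q_def)
  have "odd Q" using odd by (simp add: Q_def q_def)
  define D where "D = (Q + 1 - d) div 2"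
  define J where "J = (l + 2 * d + 5) div 2"
  have J: "2 * J = l + 2 * d + 5" using \<open>odd l\<close> unfolding J_def by (intro even_two_times_div_two) auto
  have "l \<le> l * l" using \<open>odd l\<close> by (cases l) auto
  hence "d \<le> Q" using dl Q3 by linarith
  hence D: "2 * D + d \<le> Q + 1" "2 * D \<ge> Q - d" unfolding D_def by linarith+
  have "l * card {x \<in> GF m. ev f x ^ c = to_ac a} \<le> l * d + (J - 1) * Q + D + c * d"
    unfolding c_def d_def Q_def q_def
  proof (rule stepanov_bound[OF odd monic nsq deg(1)])
    have "l \<le> Q" using \<open>l \<le> l * l\<close> Q3 by linarith
    thus "l \<le> CARD('a) ^ m" by (simp add: Q_def q_def)
    show "(\<Sum>k<l. D + k * (degree f - 1) + J - 1) < 2 * D * J"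
      by (rule stepanov_count[of l _ Q]) (use \<open>odd l\<close> deg dl Q3 D J in \<open>auto simp: d_def\<close>)
  qed (use m D in \<open>auto simp: d_def Q_def q_def\<close>)
  hence "l * (2 * card {x \<in> GF m. ev f x ^ c = to_ac a}) \<le> 2 * (l * d) + 2 * (J - 1) * Q + 2 * D + 2 * c * d"
    by simp
  \<comment> \<open>Besides l Q there remain at most 2 l d, 3 d Q and 4 Q; each of l d, d Q and Q is
    at most l d q^(g+2).\<close>
  also have "\<dots> \<le> l * Q + 10 * (l * d * q ^ (g + 2))"
  proof -
    have "2 * (J - 1) = l + 2 * d + 3" using J by linarith
    hence a1: "2 * (J - 1) * Q = l * Q + 2 * (d * Q) + 3 * Q" by (simp add: algebra_simps)
    have "2 * c \<le> Q" unfolding c_def Q_def q_def using two_mul_half[OF odd, of m] by simp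
    hence "2 * c * d \<le> Q * d" by (rule mult_le_mono1)
    hence a2: "2 * c * d \<le> d * Q" by (simp only: mult.commute[of Q d])
    have "Q > 0" "d > 0" using \<open>odd Q\<close> deg by (auto simp: d_def intro: Nat.gr0I)
    have a3: "2 * D \<le> Q" using D(1) \<open>d > 0\<close> by linarith
    have "d * Q \<le> d * (l * q ^ (g + 2))" using Q_le by simp
    hence a4: "d * Q \<le> l * d * q ^ (g + 2)" by (simp add: mult_ac)
    have a5: "Q \<le> d * Q" using \<open>d > 0\<close> by simp
    have a6: "l * d \<le> l * d * q ^ (g + 2)" using q3 by simp
    show ?thesis using a1 a2 a3 a4 a5 a6 by linarith
  qed
  also have "\<dots> = l * (Q + 10 * d * q ^ (g + 2))" by (simp add: algebra_simps)
  finally show ?thesis using \<open>odd l\<close> by (auto simp: Q_def q_def d_def)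
qed

text \<open>Stepanov's method bounds the number of x with a given sign only from above. Since the
  two numbers add up to Q apart from the zeros of f, an upper bound for one sign is a lower bound
  for the other. The zeros, at most deg f, turn 10 into 11.\<close>

lemma abs_sum_eta_le:
  fixes f :: "'a::{field,finite} poly"
  assumes odd: "odd CARD('a)" and monic: "lead_coeff f = 1" and nsq: "\<And>h. f \<noteq> h ^ 2"
    and deg: "0 < degree f" "degree f \<le> g" and m: "2 * g < m" "m \<le> 2 * g + 2"
  shows "\<bar>\<Sum>x\<in>GF m. eta m (ev f x)\<bar> \<le> 11 * int (degree f) * int (CARD('a) ^ (g + 2))"
proof -
  let ?c = "(CARD('a) ^ m - 1) div 2"
  let ?N = "\<lambda>a. {x \<in> GF m. eta m (ev f x) = a}"
  have fin: "finite (GF m :: 'a alg_closure set)" using m by simp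
  have eq: "{x \<in> GF m. ev f x ^ ?c = to_ac (of_int a)} = ?N a" if "a = 1 \<or> a = -1" for a
  proof -
    have "ev f x ^ ?c = to_ac (of_int a) \<longleftrightarrow> eta m (ev f x) = a" if x: "x \<in> GF m" for x
    proof -
      have "ev f x ^ ?c = of_int (eta m (ev f x))"
        using of_int_eta[OF odd GF_ev[OF x]] m by simp
      thus ?thesis using of_int_sign_inj[OF odd eta_cases, of a m "ev f x"] \<open>a = 1 \<or> a = -1\<close>
        by (metis insertCI to_ac_of_int)
    qed
    thus ?thesis by blast
  qed
  have le: "2 * int (card (?N a)) \<le> int (CARD('a) ^ m) + 10 * int (degree f) * int (CARD('a) ^ (g + 2))"
    if "a = 1 \<or> a = -1" for a
    using stepanov_count_sign[OF odd monic nsq deg m, of "of_int a"] unfolding eq[OF that]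
    by (metis (mono_tags, lifting) of_nat_add of_nat_le_iff of_nat_mult of_nat_numeral)
  have part: "GF m = ?N 1 \<union> ?N (-1) \<union> ?N 0" using eta_cases by blast
  have "card (GF m :: 'a alg_closure set) = card (?N 1) + card (?N (-1)) + card (?N 0)"
    using fin by (subst part, subst card_Un_disjoint, force, force, force, subst card_Un_disjoint) auto
  hence tot: "int (CARD('a) ^ m) = int (card (?N 1)) + int (card (?N (-1))) + int (card (?N 0))"
    using m by (simp add: card_GF)
  have "f \<noteq> 0" using deg by auto
  have "card (?N 0) \<le> card {x. poly (ac_poly f) x = 0}"
    using \<open>f \<noteq> 0\<close> by (intro card_mono poly_roots_finite) (auto simp: ev_def)
  also have "\<dots> \<le> degree f" using card_poly_roots_bound[of "ac_poly f"] \<open>f \<noteq> 0\<close> by simp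
  finally have N0: "int (card (?N 0)) \<le> int (degree f)" by simp
  have "(\<Sum>x\<in>GF m. eta m (ev f x)) = (\<Sum>x\<in>GF m. (if eta m (ev f x) = 1 then 1 else 0) - (if eta m (ev f x) = -1 then 1 else 0))"
  proof (rule sum.cong)
    fix x assume "x \<in> (GF m :: 'a alg_closure set)"
    show "eta m (ev f x) = (if eta m (ev f x) = 1 then 1 else 0) - (if eta m (ev f x) = -1 then 1 else 0)"
      using eta_cases[of m "ev f x"] by auto
  qed simp
  also have "\<dots> = int (card (?N 1)) - int (card (?N (-1)))"
    using fin by (simp add: sum_subtractf sum.If_cases Int_def)
  finally have S: "(\<Sum>x\<in>GF m. eta m (ev f x)) = int (card (?N 1)) - int (card (?N (-1)))" .
  have "1 \<le> CARD('a) ^ (g + 2)" by simp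
  hence "1 \<le> int (CARD('a) ^ (g + 2))" by linarith
  hence "int (degree f) * 1 \<le> int (degree f) * int (CARD('a) ^ (g + 2))"
    by (rule mult_left_mono) simp
  thus ?thesis unfolding S using le[of 1] le[of "-1"] tot N0 by linarith
qed

text \<open>The sum over \<open>GFprim m\<close> is m times the sum over primes, up to a sign, and
  differs from the sum over \<open>GF m\<close> by at most 2 q^(m/2). Division by m removes deg f,
  and 13 = 11 + 2.\<close>

lemma abs_sum_chi_le:
  fixes f :: "'a::{field,finite} poly"
  assumes odd: "odd CARD('a)" and lc: "lead_coeff f = 1" and nsq: "\<And>h. f \<noteq> h ^ 2"
    and deg: "degree f \<le> g" and m: "2 * g < m" "m \<le> 2 * g + 2"
  shows "\<bar>\<Sum>P\<in>monic_irreds m. chi P f\<bar> \<le> 13 * int (CARD('a) ^ (g + 2))"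
proof -
  have d: "degree f > 0"
  proof (rule Nat.gr0I)
    assume "degree f = 0"
    then obtain c where "f = [:c:]" by (rule degree_eq_zeroE)
    hence "f = 1" using lc by (simp add: one_pCons)
    hence "f = 1 ^ 2" by simp
    thus False using nsq by blast
  qed
  have m0: "m > 0" using m by simp
  define s :: int where "s = (- 1) ^ ((CARD('a) - 1) div 2 * m * degree f)"
  have s: "s * s = 1" "\<bar>s\<bar> = 1" by (simp_all add: s_def flip: power_mult_distrib)
  let ?h = "\<lambda>x. eta m (ev f x)"
  have "(\<Sum>x\<in>GFprim m. ?h x) = int m * (\<Sum>P\<in>(monic_irreds m :: 'a poly set). s * chi P f)"
  proof (rule sum_GFprim)
    fix P :: "'a poly" and x assume "P \<in> monic_irreds m" "ev P x = 0"
    then interpret irred_root P m x by unfold_locales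
    show "eta m (ev f x) = s * chi P f"
      using chi_eq_eta[OF odd lc] s by (simp add: s_def flip: mult.assoc)
  qed
  also have "\<dots> = int m * (s * (\<Sum>P\<in>(monic_irreds m :: 'a poly set). chi P f))"
    by (simp add: sum_distrib_left)
  finally have "int m * \<bar>\<Sum>P\<in>(monic_irreds m :: 'a poly set). chi P f\<bar> = \<bar>\<Sum>x\<in>GFprim m. ?h x\<bar>"
    using s by (simp add: abs_mult)
  also have "(\<Sum>x\<in>GFprim m. ?h x) = (\<Sum>x\<in>GF m. ?h x) - (\<Sum>x\<in>GF m - GFprim m. ?h x)"
    using sum.subset_diff[OF GFprim_subset finite_GF[OF m0], of ?h] by simp
  also have "\<bar>\<dots>\<bar> \<le> \<bar>\<Sum>x\<in>GF m. ?h x\<bar> + \<bar>\<Sum>x\<in>GF m - GFprim m. ?h x\<bar>" by simp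
  also have "\<bar>\<Sum>x\<in>GF m - GFprim m. ?h x\<bar> \<le> (\<Sum>x\<in>(GF m - GFprim m :: 'a alg_closure set). 1)"
    by (rule order.trans[OF sum_abs]) (intro sum_mono abs_eta_le)
  also have "\<dots> \<le> 2 * int (CARD('a) ^ (m div 2))"
    using card_GF_minus_GFprim[OF m0, where 'a='a] by (simp flip: of_nat_power)
  also have "CARD('a) ^ (m div 2) \<le> CARD('a) ^ (g + 2)"
    using m card_gt_1[where 'a='a] by (intro power_increasing) auto
  also have "\<bar>\<Sum>x\<in>GF m. ?h x\<bar> + 2 * int (CARD('a) ^ (g + 2)) \<le> int m * (13 * int (CARD('a) ^ (g + 2)))"
  proof -
    have "\<bar>\<Sum>x\<in>GF m. ?h x\<bar> \<le> 11 * (int (degree f) * int (CARD('a) ^ (g + 2)))"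
      using abs_sum_eta_le[OF odd lc nsq d deg m] by (simp add: mult.assoc)
    moreover have "int (degree f) * int (CARD('a) ^ (g + 2)) \<le> int m * int (CARD('a) ^ (g + 2))"
      using deg m by (intro mult_right_mono) auto
    moreover have "1 * int (CARD('a) ^ (g + 2)) \<le> int m * int (CARD('a) ^ (g + 2))"
      using m0 by (intro mult_right_mono) auto
    ultimately show ?thesis by linarith
  qed
  finally show ?thesis using m0 by (simp add: mult_le_cancel_left_pos)
qed

section \<open>The functional equation\<close>

definition eta1 :: "'a::{field,finite} \<Rightarrow> int" where
  "eta1 c = eta 1 (to_ac c)"

lemma eta1_0 [simp]: "eta1 0 = 0" and eta1_1 [simp]: "eta1 1 = 1"
  by (simp_all add: eta1_def)

lemma eta1_square: "odd CARD('a) \<Longrightarrow> c \<noteq> 0 \<Longrightarrow> eta1 (c::'a::{field,finite}) * eta1 c = 1"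
  using eta_cases[of 1 "to_ac c"] by (auto simp: eta1_def)

lemma sum_eta1: "odd CARD('a) \<Longrightarrow> (\<Sum>c\<in>UNIV. eta1 (c::'a::{field,finite})) = 0"
  using sum_eta_GF[of 1, where 'a='a] by (simp add: GF_1_eq eta1_def sum.reindex inj_to_ac del: One_nat_def)

lemma sum_polys_Suc:
  fixes h :: "'a::{field,finite} poly \<Rightarrow> int"
  shows "(\<Sum>g\<in>polys (Suc n). h g) = (\<Sum>g\<in>polys n. h g) + (\<Sum>c\<in>UNIV - {0}. \<Sum>f\<in>monics n. h (smult c f))"
proof -
  have split: "polys (Suc n) = polys n \<union> (\<Union>c\<in>UNIV - {0::'a}. smult c ` monics n)"
  proof (intro Set.set_eqI iffI)
    fix f :: "'a poly" assume f: "f \<in> polys (Suc n)"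
    show "f \<in> polys n \<union> (\<Union>c\<in>UNIV - {0::'a}. smult c ` monics n)"
    proof (cases "coeff f n = 0")
      case True
      hence "f \<in> polys n" using f by (auto simp: polys_def) (metis Suc_leI le_neq_implies_less)
      thus ?thesis by simp
    next
      case False
      let ?c = "coeff f n"
      have "degree f \<le> n" using f by (intro degree_le) (auto simp: polys_def)
      hence deg: "degree f = n" using False le_degree[of f n] by simp
      hence "smult (inverse ?c) f \<in> monics n" using False by (auto simp: monics_def)
      moreover have "f = smult ?c (smult (inverse ?c) f)" using False by simp
      ultimately show ?thesis using False by blast
    qed
  next
    fix f :: "'a poly" assume "f \<in> polys n \<union> (\<Union>c\<in>UNIV - {0::'a}. smult c ` monics n)"
    thus "f \<in> polys (Suc n)" by (auto simp: polys_def monics_def intro: coeff_eq_0)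
  qed
  have lc: "coeff f n = 1" if "f \<in> monics n" for f :: "'a poly" using that by (auto simp: monics_def)
  have "(\<Sum>g\<in>polys (Suc n). h g) = (\<Sum>g\<in>polys n. h g) + (\<Sum>g\<in>(\<Union>c\<in>UNIV - {0::'a}. smult c ` monics n). h g)"
  proof -
    have "polys n \<inter> (\<Union>c\<in>UNIV - {0::'a}. smult c ` monics n) = {}"
      using lc by (force simp: polys_def)
    thus ?thesis unfolding split by (intro sum.union_disjoint) auto
  qed
  also have "(\<Sum>g\<in>(\<Union>c\<in>UNIV - {0::'a}. smult c ` monics n). h g) = (\<Sum>c\<in>UNIV - {0}. \<Sum>g\<in>smult c ` monics n. h g)"
  proof (rule sum.UNION_disjoint)
    show "\<forall>c\<in>UNIV - {0::'a}. \<forall>d\<in>UNIV - {0}. c \<noteq> d \<longrightarrow> smult c ` monics n \<inter> smult d ` monics n = {}"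
    proof safe
      fix c d :: 'a and f g :: "'a poly"
      assume "c \<noteq> d" "f \<in> monics n" "g \<in> monics n" "smult c f = smult d g"
      thus "smult c f \<in> {}" using lc by (metis coeff_smult mult.right_neutral)
    qed
  qed auto
  also have "\<dots> = (\<Sum>c\<in>UNIV - {0}. \<Sum>f\<in>monics n. h (smult c f))"
  proof (rule sum.cong)
    fix c :: 'a assume c: "c \<in> UNIV - {0}"
    have "inj_on (smult c) (monics n)"
    proof (rule inj_onI)
      fix f g assume "smult c f = smult c g"
      from arg_cong[OF this, of "smult (inverse c)"] show "f = g" using c by simp
    qed
    thus "sum h (smult c ` monics n) = (\<Sum>f\<in>monics n. h (smult c f))" by (simp add: sum.reindex)
  qed simp
  finally show ?thesis .
qed

lemma odd_sum_odd:
  fixes h :: "'i \<Rightarrow> int"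
  assumes "finite A" "\<And>i. i \<in> A \<Longrightarrow> odd (h i)"
  shows "odd (sum h A) \<longleftrightarrow> odd (card A)"
  using assms by (induction A) auto

lemma sum_lessThan_add: "(\<Sum>i<a + b. h i) = (\<Sum>i<a. h i) + (\<Sum>i<b. h (a + i))"
  for h :: "nat \<Rightarrow> 'b::comm_monoid_add"
  by (induction b) (auto simp: add.assoc)

section \<open>Duality on the residue field\<close>

locale irred_root_odd = irred_root P m \<alpha>
  for P :: "'a::{field,finite} poly" and m and \<alpha> +
  assumes odd: "odd CARD('a)"
begin

abbreviation \<psi> :: "'a alg_closure \<Rightarrow> int" where "\<psi> \<equiv> eta m"

lemma fin_GF: "finite (GF m :: 'a alg_closure set)"
  using m_pos by simp

definition rp :: "'a alg_closure \<Rightarrow> 'a poly" where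
  "rp x = inv_into (polys m) (\<lambda>f. ev f \<alpha>) x"

lemma rp_polys: "x \<in> GF m \<Longrightarrow> rp x \<in> polys m"
  and ev_rp: "x \<in> GF m \<Longrightarrow> ev (rp x) \<alpha> = x"
  unfolding rp_def using ev_image inv_into_into[of x "\<lambda>f. ev f \<alpha>" "polys m"]
    f_inv_into_f[of x "\<lambda>f. ev f \<alpha>" "polys m"] by auto

lemma rp_ev: "f \<in> polys m \<Longrightarrow> rp (ev f \<alpha>) = f"
  unfolding rp_def using ev_inj by (rule inv_into_f_f)

text \<open>The form x -> Tr(x / P'(\<alpha>)), see \<open>trace_lam\<close>. Read as the top
  coefficient, it makes orthogonality of polynomial spaces a matter of degrees; the trace
  description enters for the sign in even degree.\<close>

definition lam :: "'a alg_closure \<Rightarrow> 'a" where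
  "lam x = coeff (rp x) (m - 1)"

lemma lam_ev: "f \<in> polys m \<Longrightarrow> lam (ev f \<alpha>) = coeff f (m - 1)"
  by (simp add: lam_def rp_ev)

lemma ev_GF [simp]: "ev f \<alpha> \<in> GF m"
  by (rule GF_ev[OF root_in_GF])

lemma lam_add: "x \<in> GF m \<Longrightarrow> y \<in> GF m \<Longrightarrow> lam (x + y) = lam x + lam y"
  using lam_ev[of "rp x + rp y"] by (simp add: ev_rp rp_polys polys_add) (simp add: lam_def)

lemma lam_smult: "x \<in> GF m \<Longrightarrow> lam (to_ac c * x) = c * lam x"
  using lam_ev[of "smult c (rp x)"] by (simp add: ev_rp rp_polys polys_smult) (simp add: lam_def)

lemma lam_0 [simp]: "lam 0 = 0"
  using lam_ev[of 0] by simp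

definition subspace :: "'a alg_closure set \<Rightarrow> bool" where
  "subspace W \<longleftrightarrow> W \<subseteq> GF m \<and> 0 \<in> W \<and> (\<forall>x\<in>W. \<forall>y\<in>W. x + y \<in> W) \<and> (\<forall>c. \<forall>x\<in>W. to_ac c * x \<in> W)"

text \<open>Adding multiples of h0, on which the form does not vanish, maps any fibre injectively
  into any other. The offset b admits cosets, such as the monic polynomials of fixed degree.\<close>

lemma lam_equidistributed:
  assumes W: "subspace W" and a: "a \<in> GF m" and h0: "h0 \<in> W" "lam (a * h0) \<noteq> 0" and b: "b \<in> GF m"
  shows "CARD('a) * card {h \<in> W. lam (a * (b + h)) = c} = card W"
proof -
  have finW: "finite W" using W fin_GF by (auto simp: subspace_def intro: finite_subset)
  have WGF: "h \<in> GF m" if "h \<in> W" for h using that W by (auto simp: subspace_def)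
  let ?F = "\<lambda>c. {h \<in> W. lam (a * (b + h)) = c}"
  have shift: "card (?F c) \<le> card (?F d)" for c d
  proof -
    define t where "t = (d - c) / lam (a * h0)"
    define k where "k = to_ac t * h0"
    have kW: "k \<in> W" using W h0(1) unfolding k_def subspace_def by blast
    have "a * k = to_ac t * (a * h0)" by (simp add: k_def mult_ac)
    hence "lam (a * k) = t * lam (a * h0)" by (simp only: lam_smult[OF GF_mult[OF a WGF[OF h0(1)]]])
    hence lk: "lam (a * k) = d - c" using h0(2) by (simp add: t_def)
    have "lam (a * (b + (h + k))) = d" if "h \<in> ?F c" for h
    proof -
      have "a * (b + (h + k)) = a * (b + h) + a * k" by (simp add: algebra_simps)
      thus ?thesis using that lk a b WGF kW by (simp add: lam_add GF_add GF_mult)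
    qed
    hence "(\<lambda>h. h + k) ` ?F c \<subseteq> ?F d" using W kW by (auto simp: subspace_def)
    thus ?thesis using finW by (intro card_inj_on_le[of "\<lambda>h. h + k"]) auto
  qed
  have "card W = (\<Sum>d\<in>UNIV. card (?F d))"
    using sum.group[of W "UNIV :: 'a set" "\<lambda>h. lam (a * (b + h))" "\<lambda>_. 1::nat"] finW by simp
  also have "\<dots> = (\<Sum>d\<in>(UNIV :: 'a set). card (?F c))"
    using shift by (intro sum.cong) (auto intro: antisym)
  finally show ?thesis by simp
qed

definition V :: "nat \<Rightarrow> 'a alg_closure set" where
  "V l = (\<lambda>f. ev f \<alpha>) ` polys l"

lemma subspace_V: "subspace (V l)"
  unfolding subspace_def V_def
proof (intro conjI ballI allI)
  show "0 \<in> (\<lambda>f. ev f \<alpha>) ` polys l" by (rule image_eqI[of _ _ 0]) auto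
next
  fix x y assume "x \<in> (\<lambda>f. ev f \<alpha>) ` polys l" "y \<in> (\<lambda>f. ev f \<alpha>) ` polys l"
  then obtain f g where "f \<in> polys l" "g \<in> polys l" "x = ev f \<alpha>" "y = ev g \<alpha>" by auto
  thus "x + y \<in> (\<lambda>f. ev f \<alpha>) ` polys l" by (intro image_eqI[of _ _ "f + g"]) (auto intro: polys_add)
next
  fix c x assume "x \<in> (\<lambda>f. ev f \<alpha>) ` polys l"
  then obtain f where "f \<in> polys l" "x = ev f \<alpha>" by auto
  thus "to_ac c * x \<in> (\<lambda>f. ev f \<alpha>) ` polys l"
    by (intro image_eqI[of _ _ "smult c f"]) (auto intro: polys_smult)
qed auto

lemma inj_on_ev_polys: "l \<le> m \<Longrightarrow> inj_on (\<lambda>f. ev f \<alpha>) (polys l)"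
  using ev_inj by (rule inj_on_subset) (auto intro: polys_mono)

lemma card_V: "l \<le> m \<Longrightarrow> card (V l) = CARD('a) ^ l"
  unfolding V_def by (simp add: card_image inj_on_ev_polys card_polys)

text \<open>A product of degree below m - 1 has top coefficient 0. Conversely, if f has degree at
  least m - l, the monomial of complementary degree lies in \<open>polys l\<close> and moves the
  leading coefficient of f to position m - 1.\<close>

lemma perp_V:
  assumes l: "l \<le> m" and f: "f \<in> polys m"
  shows "(\<forall>h\<in>V l. lam (ev f \<alpha> * h) = 0) \<longleftrightarrow> f \<in> polys (m - l)"
proof
  assume f: "f \<in> polys (m - l)"
  show "\<forall>h\<in>V l. lam (ev f \<alpha> * h) = 0"
  proof
    fix h assume "h \<in> V l"
    then obtain g where g: "g \<in> polys l" "h = ev g \<alpha>" by (auto simp: V_def)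
    have fg: "f * g \<in> polys (m - 1)" using f g l m_pos by (intro polys_mult) auto
    hence "f * g \<in> polys m" by (rule polys_mono[rotated]) simp
    hence "lam (ev (f * g) \<alpha>) = coeff (f * g) (m - 1)" by (rule lam_ev)
    thus "lam (ev f \<alpha> * h) = 0" using fg g by (simp add: polys_def)
  qed
next
  assume *: "\<forall>h\<in>V l. lam (ev f \<alpha> * h) = 0"
  show "f \<in> polys (m - l)"
  proof (rule ccontr)
    assume nf: "f \<notin> polys (m - l)"
    hence f0: "f \<noteq> 0" by auto
    define e where "e = degree f"
    have e: "e < m" using f m_pos by (simp add: e_def polys_iff_degree)
    have "m - l \<le> e"
    proof (rule ccontr)
      assume "\<not> m - l \<le> e"
      hence "f \<in> polys (m - l)" by (auto simp: polys_def e_def intro: coeff_eq_0)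
      thus False using nf by simp
    qed
    define g :: "'a poly" where "g = monom 1 (m - 1 - e)"
    have "g \<in> polys l" using e \<open>m - l \<le> e\<close> l by (auto simp: g_def polys_def)
    hence "lam (ev f \<alpha> * ev g \<alpha>) = 0" using * by (simp add: V_def)
    moreover have "f * g \<in> polys m"
      using polys_mult_monom[OF polys_degree[of f], of "m - 1 - e" m] e by (simp add: g_def e_def)
    hence "lam (ev (f * g) \<alpha>) = coeff (f * g) (m - 1)" by (rule lam_ev)
    ultimately have "coeff (f * g) (m - 1) = 0" by simp
    moreover have "coeff (f * g) (m - 1) = coeff f e"
      using e by (simp add: g_def mult.commute[of f] coeff_monom_mult)
    ultimately show False using f0 by (simp add: e_def)
  qed
qed

lemma sum_GF_twist:
  assumes h: "h \<in> GF m" "h \<noteq> 0"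
  shows "(\<Sum>a\<in>GF m. \<psi> a * w (a * h)) = \<psi> h * (\<Sum>a\<in>GF m. \<psi> a * w a)"
proof -
  have "(\<Sum>a\<in>GF m. \<psi> a * w a) = (\<Sum>a\<in>GF m. \<psi> (h * a) * w (h * a))"
    using sum.reindex_bij_betw[OF bij_betw_GF_mult[OF h], of "\<lambda>a. \<psi> a * w a"] by simp
  also have "\<dots> = (\<Sum>a\<in>GF m. \<psi> h * (\<psi> a * w (a * h)))"
    using h odd m_pos by (intro sum.cong) (auto simp: eta_mult mult_ac)
  finally have "(\<Sum>a\<in>GF m. \<psi> a * w a) = \<psi> h * (\<Sum>a\<in>GF m. \<psi> a * w (a * h))"
    by (simp add: sum_distrib_left)
  moreover have "\<psi> h * \<psi> h = 1" using h eta_cases[of m h] by auto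
  ultimately show ?thesis by (simp flip: mult.assoc)
qed

lemma sum_GF_eq_polys: "(\<Sum>a\<in>GF m. w a) = (\<Sum>g\<in>polys m. w (ev g \<alpha>))"
  using sum.reindex_bij_betw[OF ev_bij, of w] by simp

text \<open>Up to the reciprocity sign, the coefficients of L(s, chi_P); see
  \<open>chi_sum_eq_B\<close>.\<close>

definition B :: "nat \<Rightarrow> int" where
  "B n = (\<Sum>f\<in>monics n. \<psi> (ev f \<alpha>))"

lemma monic_ev_nz: "f \<in> monics n \<Longrightarrow> n < m \<Longrightarrow> ev f \<alpha> \<noteq> 0"
  using dvd_imp_degree_le[of P f] deg by (cases "f = 0") (auto simp: ev_0_iff monics_def)

text \<open>A sum of q^n signs with q odd. In particular \<open>B g\<close> is nonzero and may be
  cancelled in the functional equation.\<close>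

lemma odd_B: "n < m \<Longrightarrow> odd (B n)"
proof -
  assume n: "n < m"
  have "odd (\<psi> (ev f \<alpha>))" if "f \<in> monics n" for f
    using monic_ev_nz[OF that n] eta_cases[of m "ev f \<alpha>"] by auto
  hence "odd (B n) \<longleftrightarrow> odd (card (monics n :: 'a poly set))" unfolding B_def by (intro odd_sum_odd) auto
  thus ?thesis using odd by (simp add: card_monics)
qed

lemma B_0: "B 0 = 1"
proof -
  have "monics 0 = {1 :: 'a poly}"
    by (auto simp: monics_def one_pCons elim!: degree_eq_zeroE)
  thus ?thesis by (simp add: B_def)
qed

text \<open>For n \<ge> m adding polynomials of degree below m permutes the monic polynomials of
  degree n, so their residues are equidistributed and the character sums to 0.\<close>

lemma B_eq_0:
  assumes n: "n \<ge> m"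
  shows "B n = 0"
proof -
  have shift: "(\<Sum>f\<in>monics n. \<psi> (ev f \<alpha> + ev r \<alpha>)) = B n" if r: "r \<in> polys m" for r
  proof -
    have r': "r \<in> polys n" using r n by (rule polys_mono[rotated])
    have "bij_betw (\<lambda>f. f + r) (monics n) (monics n)"
    proof (rule bij_betw_byWitness[of _ "\<lambda>f. f - r"])
      show "(\<lambda>f. f + r) ` monics n \<subseteq> monics n" "(\<lambda>f. f - r) ` monics n \<subseteq> monics n"
        unfolding monics_eq using polys_add[OF _ r'] polys_diff[OF _ r']
        by (auto simp: image_iff add.assoc simp flip: add_diff_eq)
    qed auto
    from sum.reindex_bij_betw[OF this, of "\<lambda>f. \<psi> (ev f \<alpha>)"] show ?thesis by (simp add: B_def)
  qed
  have "int (CARD('a) ^ m) * B n = (\<Sum>r\<in>polys m. \<Sum>f\<in>monics n. \<psi> (ev f \<alpha> + ev r \<alpha>))"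
    by (simp add: shift card_polys)
  also have "\<dots> = (\<Sum>f\<in>monics n. \<Sum>y\<in>GF m. \<psi> (ev f \<alpha> + y))"
    by (subst sum.swap) (simp add: sum_GF_eq_polys)
  also have "\<dots> = (\<Sum>f\<in>(monics n :: 'a poly set). 0)"
  proof (rule sum.cong)
    fix f :: "'a poly"
    have "bij_betw (\<lambda>y. ev f \<alpha> + y) (GF m) (GF m)"
      by (rule bij_betw_byWitness[of _ "\<lambda>y. y - ev f \<alpha>"]) auto
    from sum.reindex_bij_betw[OF this, of \<psi>] show "(\<Sum>y\<in>GF m. \<psi> (ev f \<alpha> + y)) = 0"
      by (simp add: sum_eta_GF[OF odd m_pos])
  qed simp
  finally show ?thesis by simp
qed

section \<open>The functional equation in odd degree\<close>

lemma psi_smult: "\<psi> (to_ac c * x) = eta1 c ^ m * \<psi> x" if "x \<in> GF m"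
  using eta_mult[OF odd _ that m_pos, of "to_ac c"] eta_const[OF odd m_pos, of c] by (simp add: eta1_def)

text \<open>\<open>Z\<close> is a Gauss sum with the character of F_q in place of an additive one,
  so that everything stays integral. Expand Z B(l) over pairs (g, f) with f monic of degree l. If g
  has degree below m - l, the form at g f is the coefficient of g at n = m - 1 - l, whatever f;
  otherwise it is equidistributed and the sum over f is 0. For odd m the character restricted to F_q
  is \<open>eta1\<close>, so the leading coefficient of g drops out.\<close>

lemma odd_functional_aux:
  assumes m: "odd m" and l: "l < m"
  defines "Z \<equiv> (\<Sum>a\<in>GF m. \<psi> a * eta1 (lam a))"
  shows "Z * B l = int (CARD('a) ^ l * (CARD('a) - 1)) * B (m - 1 - l)"
proof -
  define n where "n = m - 1 - l"
  have ml: "m - l = Suc n" using l by (simp add: n_def)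
  have inner: "(\<Sum>f\<in>monics l. eta1 (lam (ev g \<alpha> * ev f \<alpha>))) =
        (if g \<in> polys (m - l) then int (CARD('a) ^ l) * eta1 (coeff g n) else 0)"
    if g: "g \<in> polys m" for g
  proof (cases "g \<in> polys (m - l)")
    case True
    have "lam (ev g \<alpha> * ev f \<alpha>) = coeff g n" if f: "f \<in> monics l" for f
    proof -
      obtain v where v: "f = monom 1 l + v" "v \<in> polys l" using f by (auto simp: monics_eq)
      have gv: "g * v \<in> polys (m - 1)" using True v l by (intro polys_mult) auto
      have "g * monom 1 l \<in> polys m" using True l by (intro polys_mult_monom[of _ "m - l"]) auto
      moreover have "g * v \<in> polys m" using gv by (rule polys_mono[rotated]) simp
      ultimately have "g * f \<in> polys m" by (simp add: v distrib_left polys_add)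
      hence "lam (ev (g * f) \<alpha>) = coeff (g * f) (m - 1)" by (rule lam_ev)
      also have "\<dots> = coeff (g * monom 1 l) (m - 1)" using gv by (simp add: v distrib_left polys_def)
      also have "\<dots> = coeff g n" using l by (simp add: mult.commute[of g] coeff_monom_mult n_def)
      finally show ?thesis by simp
    qed
    thus ?thesis using True by (simp add: card_monics)
  next
    case False
    then obtain h0 where h0: "h0 \<in> V l" "lam (ev g \<alpha> * h0) \<noteq> 0" using perp_V[of l g] l g by auto
    let ?b = "\<alpha> ^ l"
    have b: "?b \<in> GF m" using root_in_GF by (rule GF_power)
    have finV: "finite (V l)" by (simp add: V_def)
    have "(\<Sum>f\<in>monics l. eta1 (lam (ev g \<alpha> * ev f \<alpha>))) = (\<Sum>v\<in>polys l. eta1 (lam (ev g \<alpha> * (?b + ev v \<alpha>))))"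
      unfolding monics_eq by (subst sum.reindex) (auto simp: inj_on_def)
    also have "\<dots> = (\<Sum>v\<in>V l. eta1 (lam (ev g \<alpha> * (?b + v))))"
      unfolding V_def using l by (subst sum.reindex) (auto simp: inj_on_ev_polys)
    also have "\<dots> = (\<Sum>c\<in>UNIV. \<Sum>v | v \<in> V l \<and> lam (ev g \<alpha> * (?b + v)) = c. eta1 c)"
      using sum.group[OF finV, of "UNIV :: 'a set" "\<lambda>v. lam (ev g \<alpha> * (?b + v))" "\<lambda>v. eta1 (lam (ev g \<alpha> * (?b + v)))"]
      by simp
    also have "int CARD('a) * \<dots> = (\<Sum>c\<in>UNIV. int (CARD('a) * card {v \<in> V l. lam (ev g \<alpha> * (?b + v)) = c}) * eta1 c)"
      by (simp add: sum_distrib_left mult.assoc)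
    also have "\<dots> = int (card (V l)) * (\<Sum>c\<in>UNIV. eta1 (c::'a))"
      using lam_equidistributed[OF subspace_V _ h0 b] by (simp add: sum_distrib_left)
    also have "\<dots> = 0" by (simp add: sum_eta1[OF odd])
    finally show ?thesis using False by simp
  qed
  have "Z * B l = (\<Sum>f\<in>monics l. \<psi> (ev f \<alpha>) * Z)"
    by (simp add: B_def sum_distrib_left mult.commute)
  also have "\<dots> = (\<Sum>f\<in>monics l. \<Sum>a\<in>GF m. \<psi> a * eta1 (lam (a * ev f \<alpha>)))"
    unfolding Z_def using monic_ev_nz l by (intro sum.cong sum_GF_twist[symmetric]) auto
  also have "\<dots> = (\<Sum>a\<in>GF m. \<psi> a * (\<Sum>f\<in>monics l. eta1 (lam (a * ev f \<alpha>))))"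
    by (subst sum.swap) (simp add: sum_distrib_left)
  also have "\<dots> = (\<Sum>g\<in>polys m. \<psi> (ev g \<alpha>) * (\<Sum>f\<in>monics l. eta1 (lam (ev g \<alpha> * ev f \<alpha>))))"
    by (rule sum_GF_eq_polys)
  also have "\<dots> = (\<Sum>g\<in>polys m. if g \<in> polys (m - l) then int (CARD('a) ^ l) * (\<psi> (ev g \<alpha>) * eta1 (coeff g n)) else 0)"
    by (rule sum.cong) (auto simp: inner)
  also have "\<dots> = (\<Sum>g\<in>polys (Suc n). int (CARD('a) ^ l) * (\<psi> (ev g \<alpha>) * eta1 (coeff g n)))"
    unfolding ml[symmetric] by (rule sum.mono_neutral_cong_right) (auto intro: polys_mono[of "m - l" m])
  also have "\<dots> = int (CARD('a) ^ l) * (\<Sum>g\<in>polys (Suc n). \<psi> (ev g \<alpha>) * eta1 (coeff g n))"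
    by (simp add: sum_distrib_left)
  also have "(\<Sum>g\<in>polys (Suc n). \<psi> (ev g \<alpha>) * eta1 (coeff g n)) = (\<Sum>c\<in>UNIV - {0::'a}. \<Sum>f\<in>monics n. \<psi> (ev f \<alpha>))"
  proof -
    have 1: "(\<Sum>g\<in>polys n. \<psi> (ev g \<alpha>) * eta1 (coeff g n)) = 0"
      by (intro sum.neutral) (auto simp: polys_def)
    have 2: "\<psi> (ev (smult c f) \<alpha>) * eta1 (coeff (smult c f) n) = \<psi> (ev f \<alpha>)"
      if "c \<noteq> 0" "f \<in> monics n" for c f
    proof -
      have "coeff f n = 1" using that by (auto simp: monics_def)
      moreover have "eta1 c ^ m * eta1 c = 1"
        using m eta1_square[OF odd that(1)] by (auto elim!: oddE simp: power_mult power2_eq_square)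
      ultimately show ?thesis by (simp add: psi_smult mult_ac)
    qed
    show ?thesis unfolding sum_polys_Suc 1 using 2 by (auto intro!: sum.cong)
  qed
  also have "\<dots> = int (CARD('a) - 1) * B n" by (simp add: B_def card_Diff_subset)
  finally show ?thesis by (simp add: n_def)
qed

text \<open>The Gauss sum evaluates itself: l = 0 gives Z = (q - 1) B(2g), and then l = g, where
  \<open>B g\<close> is nonzero, gives B(2g) = q^g with its sign.\<close>

theorem functional_equation_odd:
  assumes m: "m = 2 * g + 1" and l: "l \<le> 2 * g"
  shows "int (CARD('a)) ^ l * B (2 * g - l) = int (CARD('a)) ^ g * B l"
proof -
  define Z where "Z = (\<Sum>a\<in>GF m. \<psi> a * eta1 (lam a))"
  let ?q = "int CARD('a)"
  have q: "int (CARD('a) - 1) = ?q - 1" "?q - 1 \<noteq> 0" using card_gt_1[where 'a='a] by auto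
  have Z: "Z * B k = ?q ^ k * (?q - 1) * B (2 * g - k)" if "k \<le> 2 * g" for k
    using odd_functional_aux[of k] that m q by (simp add: Z_def)
  have "Z = (?q - 1) * B (2 * g)" using Z[of 0] by (simp add: B_0)
  hence *: "B (2 * g) * B k = ?q ^ k * B (2 * g - k)" if "k \<le> 2 * g" for k
    using Z[OF that] q by simp
  have "B g \<noteq> 0" using odd_B[of g] m by auto
  hence "B (2 * g) = ?q ^ g" using *[of g] by simp
  thus ?thesis using *[OF l] by simp
qed


section \<open>The functional equation in even degree\<close>

definition perp :: "'a alg_closure set \<Rightarrow> 'a alg_closure set" where
  "perp W = {a \<in> GF m. \<forall>h\<in>W. lam (a * h) = 0}"

lemma lam_power_root: "lam (\<alpha> ^ (m - 1)) = 1"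
  using lam_ev[of "monom 1 (m - 1)"] m_pos by (simp add: polys_def)

lemma subspace_GF: "subspace (GF m)"
  by (auto simp: subspace_def)

text \<open>Pairs with \<open>lam (a * h) = 0\<close>, counted by a: an element of the complement is
  orthogonal to all of W, any other to exactly a q-th part of W. The factor q on the left clears the
  denominator.\<close>

lemma perp_count:
  fixes w :: "'a alg_closure \<Rightarrow> int"
  assumes W: "subspace W"
  shows "int CARD('a) * (\<Sum>h\<in>W. \<Sum>a | a \<in> GF m \<and> lam (a * h) = 0. w a) =
     int (card W) * ((\<Sum>a\<in>GF m. w a) + int (CARD('a) - 1) * (\<Sum>a\<in>perp W. w a))"
proof -
  have finW: "finite W" using W fin_GF by (auto simp: subspace_def intro: finite_subset)
  have q: "int (CARD('a) - 1) = int CARD('a) - 1" using card_gt_1[where 'a='a] by simp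
  have count: "int CARD('a) * int (card {h \<in> W. lam (a * h) = 0}) =
      int (card W) * (1 + (if a \<in> perp W then int (CARD('a) - 1) else 0))" if a: "a \<in> GF m" for a
  proof (cases "a \<in> perp W")
    case True
    hence "{h \<in> W. lam (a * h) = 0} = W" by (auto simp: perp_def)
    thus ?thesis using True q by simp
  next
    case False
    then obtain h0 where "h0 \<in> W" "lam (a * h0) \<noteq> 0" using a by (auto simp: perp_def)
    hence "CARD('a) * card {h \<in> W. lam (a * (0 + h)) = 0} = card W"
      by (intro lam_equidistributed[OF W a]) auto
    hence "int CARD('a) * int (card {h \<in> W. lam (a * h) = 0}) = int (card W)"
      by (simp flip: of_nat_mult)
    thus ?thesis using False by simp
  qed
  have "(\<Sum>h\<in>W. \<Sum>a | a \<in> GF m \<and> lam (a * h) = 0. w a) = (\<Sum>a\<in>GF m. \<Sum>h | h \<in> W \<and> lam (a * h) = 0. w a)"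
    using finW fin_GF by (rule sum.swap_restrict)
  also have "\<dots> = (\<Sum>a\<in>GF m. int (card {h \<in> W. lam (a * h) = 0}) * w a)" by simp
  also have "int CARD('a) * \<dots> = (\<Sum>a\<in>GF m. int CARD('a) * int (card {h \<in> W. lam (a * h) = 0}) * w a)"
    by (simp add: sum_distrib_left mult.assoc)
  also have "\<dots> = (\<Sum>a\<in>GF m. int (card W) * w a + int (card W) * (if a \<in> perp W then int (CARD('a) - 1) * w a else 0))"
    by (intro sum.cong refl, subst count) (auto simp: algebra_simps)
  also have "\<dots> = int (card W) * (\<Sum>a\<in>GF m. w a) + int (card W) * (\<Sum>a\<in>GF m. if a \<in> perp W then int (CARD('a) - 1) * w a else 0)"
    by (simp add: sum.distrib sum_distrib_left)
  also have "(\<Sum>a\<in>GF m. if a \<in> perp W then int (CARD('a) - 1) * w a else 0) = (\<Sum>a\<in>perp W. int (CARD('a) - 1) * w a)"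
    using fin_GF by (intro sum.mono_neutral_cong_right) (auto simp: perp_def)
  finally show ?thesis by (simp add: sum_distrib_left algebra_simps)
qed

text \<open>\<open>perp_count\<close> with weight 1, compared with the count by h, where every h
  \<noteq> 0 has a hyperplane of partners.\<close>

lemma card_perp:
  assumes W: "subspace W"
  shows "card W * card (perp W) = CARD('a) ^ m"
proof -
  let ?q = "int CARD('a)" and ?Q = "int (CARD('a) ^ m)"
  have finW: "finite W" using W fin_GF by (auto simp: subspace_def intro: finite_subset)
  have W0: "0 \<in> W" using W by (simp add: subspace_def)
  have q: "int (CARD('a) - 1) = ?q - 1" "?q - 1 \<noteq> 0" using card_gt_1[where 'a='a] by auto
  have Q: "int (card (GF m :: 'a alg_closure set)) = ?Q" using m_pos by (simp add: card_GF)
  have cnt: "?q * int (card {a \<in> GF m. lam (a * h) = 0}) = ?Q" if h: "h \<in> W" "h \<noteq> 0" for h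
  proof -
    have hGF: "h \<in> GF m" using h W by (auto simp: subspace_def)
    have "\<alpha> ^ (m - 1) / h \<in> GF m" using root_in_GF hGF by (intro GF_divide GF_power)
    moreover have "lam (h * (\<alpha> ^ (m - 1) / h)) \<noteq> 0" using h by (simp add: lam_power_root del: One_nat_def)
    ultimately have "CARD('a) * card {a \<in> GF m. lam (h * (0 + a)) = 0} = card (GF m :: 'a alg_closure set)"
      by (intro lam_equidistributed[OF subspace_GF hGF]) auto
    hence "CARD('a) * card {a \<in> GF m. lam (a * h) = 0} = CARD('a) ^ m"
      using m_pos by (simp add: mult.commute card_GF)
    thus ?thesis by (simp flip: of_nat_mult)
  qed
  have "?q * (\<Sum>h\<in>W. \<Sum>a | a \<in> GF m \<and> lam (a * h) = 0. 1) =
      (\<Sum>h\<in>W. ?q * int (card {a \<in> GF m. lam (a * h) = 0}))" by (simp add: sum_distrib_left)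
  also have "\<dots> = ?q * ?Q + (\<Sum>h\<in>W - {0}. ?Q)"
    using cnt Q by (subst sum.remove[OF finW W0]) simp
  also have "\<dots> = ?q * ?Q + (int (card W) - 1) * ?Q"
  proof -
    have "card W > 0" using finW W0 by (auto simp: card_gt_0_iff)
    thus ?thesis using W0 by (simp add: card_Diff_singleton of_nat_diff)
  qed
  finally have "int (card W) * (?Q + (?q - 1) * int (card (perp W))) = ?q * ?Q + (int (card W) - 1) * ?Q"
    using perp_count[OF W, of "\<lambda>_. 1"] Q q by simp
  hence "(?q - 1) * (int (card W) * int (card (perp W))) = (?q - 1) * ?Q" by (simp add: algebra_simps)
  hence "int (card W) * int (card (perp W)) = ?Q" using q by simp
  thus ?thesis by (metis of_nat_eq_iff of_nat_mult)
qed

lemma perp_V_eq: "l \<le> m \<Longrightarrow> perp (V l) = V (m - l)"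
proof -
  assume l: "l \<le> m"
  have "a \<in> perp (V l) \<longleftrightarrow> a \<in> V (m - l)" if a: "a \<in> GF m" for a
  proof -
    have "a \<in> perp (V l) \<longleftrightarrow> rp a \<in> polys (m - l)"
      using perp_V[OF l rp_polys[OF a]] a by (simp add: perp_def ev_rp)
    also have "\<dots> \<longleftrightarrow> a \<in> V (m - l)"
    proof
      assume "rp a \<in> polys (m - l)"
      thus "a \<in> V (m - l)" unfolding V_def using ev_rp[OF a] by (metis image_eqI)
    next
      assume "a \<in> V (m - l)"
      then obtain f where f: "f \<in> polys (m - l)" "a = ev f \<alpha>" by (auto simp: V_def)
      hence "f \<in> polys m" by (auto intro: polys_mono[of "m - l"])
      thus "rp a \<in> polys (m - l)" using f by (simp add: rp_ev)
    qed
    finally show ?thesis .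
  qed
  moreover have "V (m - l) \<subseteq> GF m" by (auto simp: V_def)
  ultimately show ?thesis by (auto simp: perp_def)
qed

text \<open>In even degree the character is trivial on nonzero constants, so a weight
  \<open>eta1\<close> would average out; the indicator of the hyperplane lam = 0 replaces it. W is
  left general in order to insert polynomial spaces as well as a subfield.\<close>

lemma even_functional_aux:
  assumes W: "subspace W"
  defines "Z \<equiv> (\<Sum>a | a \<in> GF m \<and> lam a = 0. \<psi> a)"
  shows "int CARD('a) * Z * (\<Sum>h\<in>W. \<psi> h) = int (card W) * int (CARD('a) - 1) * (\<Sum>h\<in>perp W. \<psi> h)"
proof -
  have Wsub: "W \<subseteq> GF m" using W by (simp add: subspace_def)
  have filt: "(\<Sum>a | a \<in> GF m \<and> lam (a * h) = 0. \<psi> a) = (\<Sum>a\<in>GF m. \<psi> a * (if lam (a * h) = 0 then 1 else 0))" for h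
    using fin_GF by (intro sum.mono_neutral_cong_left) auto
  have tw: "(\<Sum>a | a \<in> GF m \<and> lam (a * h) = 0. \<psi> a) = \<psi> h * Z" if "h \<in> W" for h
  proof (cases "h = 0")
    case True
    thus ?thesis using sum_eta_GF[OF odd m_pos] by simp
  next
    case False
    have "h \<in> GF m" using that Wsub by auto
    thus ?thesis using sum_GF_twist[OF _ False, of "\<lambda>x. if lam x = 0 then 1 else 0"] filt[of h] filt[of 1]
      by (simp add: Z_def)
  qed
  have "int CARD('a) * Z * (\<Sum>h\<in>W. \<psi> h) = int CARD('a) * (\<Sum>h\<in>W. \<Sum>a | a \<in> GF m \<and> lam (a * h) = 0. \<psi> a)"
    using tw by (simp add: sum_distrib_left mult_ac)
  also have "\<dots> = int (card W) * (int (CARD('a) - 1) * (\<Sum>a\<in>perp W. \<psi> a))"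
    using perp_count[OF W, of \<psi>] sum_eta_GF[OF odd m_pos] by simp
  finally show ?thesis by (simp add: mult.assoc)
qed

text \<open>Euler's formula: the trace dual basis of the powers of a root is expressed by the derivative.\<close>

lemma pderiv_root_conj:
  assumes i: "i < m"
  shows "ev (pderiv P) \<alpha> ^ (CARD('a) ^ i) = (\<Prod>k\<in>{..<m} - {i}. \<alpha> ^ (CARD('a) ^ i) - \<alpha> ^ (CARD('a) ^ k))"
proof -
  let ?a = "\<lambda>i. \<alpha> ^ (CARD('a) ^ i)"
  have "ac_poly (pderiv P) = pderiv (ac_poly P)"
    by (simp add: poly_eq_iff coeff_pderiv)
  hence "ev (pderiv P) (?a i) = poly (\<Sum>j<m. (\<Prod>k\<in>{..<m} - {j}. [:- ?a k, 1:]) * pderiv [:- ?a j, 1:]) (?a i)"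
    by (simp add: ev_def ac_poly_eq_prod pderiv_prod)
  also have "\<dots> = (\<Sum>j<m. \<Prod>k\<in>{..<m} - {j}. ?a i - ?a k)"
    by (simp add: poly_sum poly_prod pderiv_pCons)
  also have "\<dots> = (\<Sum>j\<in>{i}. \<Prod>k\<in>{..<m} - {j}. ?a i - ?a k)"
    using i by (intro sum.mono_neutral_right) (auto simp: prod_zero_iff)
  finally show ?thesis by (simp add: ev_frob)
qed

lemma conj_diff_nz: "i < m \<Longrightarrow> k < m \<Longrightarrow> i \<noteq> k \<Longrightarrow> \<alpha> ^ (CARD('a) ^ i) - \<alpha> ^ (CARD('a) ^ k) \<noteq> 0"
  using conj_inj by (auto simp: inj_on_def)

text \<open>Lagrange interpolation of the reduced polynomial of x at the conjugates of \<alpha>: its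
  top coefficient is the sum of the conjugates of x divided by those of P'(\<alpha>).\<close>

lemma trace_lam:
  assumes x: "x \<in> GF m"
  shows "(\<Sum>i<m. (x / ev (pderiv P) \<alpha>) ^ (CARD('a) ^ i)) = to_ac (lam x)"
proof -
  let ?a = "\<lambda>i. \<alpha> ^ (CARD('a) ^ i)"
  define f where "f = rp x"
  have f: "f \<in> polys m" "x = ev f \<alpha>" using x by (simp_all add: f_def rp_polys ev_rp)
  define c where "c = (\<lambda>i. (x / ev (pderiv P) \<alpha>) ^ (CARD('a) ^ i))"
  define L where "L = (\<Sum>i<m. smult (c i) (\<Prod>k\<in>{..<m} - {i}. [:- ?a k, 1:]))"
  have degp: "degree (\<Prod>k\<in>{..<m} - {i}. [:- ?a k, 1:]) = m - 1" if "i < m" for i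
    using that by (subst degree_prod_eq_sum_degree) auto
  have "ac_poly f = L"
  proof (rule poly_eqI_degree[of "?a ` {..<m}"])
    fix z assume "z \<in> ?a ` {..<m}"
    then obtain j where j: "j < m" "z = ?a j" by auto
    have "poly L z = (\<Sum>i<m. c i * (\<Prod>k\<in>{..<m} - {i}. ?a j - ?a k))"
      by (simp add: L_def poly_sum poly_prod j)
    also have "\<dots> = (\<Sum>i\<in>{j}. c i * (\<Prod>k\<in>{..<m} - {i}. ?a j - ?a k))"
      using j by (intro sum.mono_neutral_right) (auto simp: prod_zero_iff)
    also have "\<dots> = x ^ (CARD('a) ^ j)"
    proof -
      have "(\<Prod>k\<in>{..<m} - {j}. ?a j - ?a k) \<noteq> 0" using j conj_diff_nz by (auto simp: prod_zero_iff)
      thus ?thesis by (simp add: c_def power_divide pderiv_root_conj[OF j(1)])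
    qed
    also have "\<dots> = poly (ac_poly f) z" by (simp add: f(2) ev_frob j(2)) (simp add: ev_def)
    finally show "poly (ac_poly f) z = poly L z" by simp
  next
    have cd: "card (?a ` {..<m}) = m" by (simp add: card_image conj_inj)
    show "degree (ac_poly f) < card (?a ` {..<m})"
      unfolding cd using f(1) m_pos by (simp add: polys_iff_degree)
    have "degree L \<le> m - 1"
      unfolding L_def by (intro degree_sum_le) (auto intro: order.trans[OF degree_smult_le] simp: degp)
    thus "degree L < card (?a ` {..<m})" unfolding cd using m_pos by linarith
  qed
  hence "to_ac (coeff f (m - 1)) = coeff L (m - 1)" by (metis coeff_ac_poly)
  also have "\<dots> = (\<Sum>i<m. c i * coeff (\<Prod>k\<in>{..<m} - {i}. [:- ?a k, 1:]) (m - 1))"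
    by (simp add: L_def coeff_sum)
  also have "\<dots> = (\<Sum>i<m. c i)"
  proof (rule sum.cong)
    fix i assume i: "i \<in> {..<m}"
    have "lead_coeff (\<Prod>k\<in>{..<m} - {i}. [:- ?a k, 1:]) = 1" by (simp add: lead_coeff_prod)
    thus "c i * coeff (\<Prod>k\<in>{..<m} - {i}. [:- ?a k, 1:]) (m - 1) = c i" using i by (simp add: degp)
  qed simp
  finally show ?thesis by (simp add: c_def lam_def f_def)
qed

lemma psi_const_even: "even m \<Longrightarrow> c \<noteq> 0 \<Longrightarrow> eta1 (c :: 'a) ^ m = 1"
  using eta1_square[OF odd, of c] by (auto elim!: evenE simp: power_mult power2_eq_square)

text \<open>The test space is W = \<open>GF n\<close>, where the character is 1 on nonzero elements.
  Its complement is \<beta> W with \<beta> = P'(\<alpha>) (\<alpha> - \<alpha>^(q^n)), and \<beta>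
  has character 1. So both sums in \<open>even_functional_aux\<close> equal q^n - 1, and they
  cancel.\<close>

lemma even_gauss_sum:
  assumes m: "m = 2 * n"
  defines "Z \<equiv> (\<Sum>a | a \<in> GF m \<and> lam a = 0. \<psi> a)"
  shows "int CARD('a) * Z = int (CARD('a) ^ n) * int (CARD('a) - 1)"
proof -
  let ?q = "CARD('a)" and ?W = "GF n :: 'a alg_closure set"
  have n: "n > 0" using m m_pos by simp
  have WGF: "?W \<subseteq> GF m" using GF_mono[of n m] m by auto
  have W: "subspace ?W" using WGF by (auto simp: subspace_def)
  have cW: "card ?W = ?q ^ n" using n by (simp add: card_GF)
  \<comment> \<open>(q^m - 1)/2 is q^n - 1 times the integer (q^n + 1)/2, so elements of the
    subfield satisfy Euler's criterion.\<close>
  have psiW: "\<psi> k = 1" if k: "k \<in> ?W" "k \<noteq> 0" for k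
  proof -
    have "odd (?q ^ n)" using odd by simp
    hence "even (?q ^ n + 1)" by simp
    then obtain t where t: "?q ^ n + 1 = 2 * t" by (elim evenE)
    have "?q ^ m = ?q ^ n * ?q ^ n" by (simp add: m mult_2 power_add)
    hence "(?q ^ n - 1) * (?q ^ n + 1) = ?q ^ m - 1" by (simp add: algebra_simps)
    hence "?q ^ m - 1 = 2 * ((?q ^ n - 1) * t)" unfolding t by (simp only: mult.left_commute)
    hence "(?q ^ m - 1) div 2 = (?q ^ n - 1) * t" by simp
    hence "k ^ ((?q ^ m - 1) div 2) = 1" using GF_power_minus_1[OF k] by (simp add: power_mult)
    thus ?thesis using k by (simp add: eta_def)
  qed
  define z where "z = (\<lambda>k. \<alpha> - \<alpha> ^ (?q ^ k))"
  have zGF: "z k \<in> GF m" for k unfolding z_def using root_in_GF by (intro GF_diff GF_power)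
  have znz: "z k \<noteq> 0" if "0 < k" "k < m" for k using conj_diff_nz[of 0 k] that by (simp add: z_def)
  define \<delta> where "\<delta> = ev (pderiv P) \<alpha>"
  have "\<delta> = (\<Prod>k\<in>{..<m} - {0}. z k)" using pderiv_root_conj[of 0] m_pos by (simp add: \<delta>_def z_def)
  also have "{..<m} - {0} = {1..<m}" by auto
  finally have \<delta>: "\<delta> = (\<Prod>k\<in>{1..<m}. z k)" .
  have \<delta>nz: "\<delta> \<noteq> 0" unfolding \<delta> using znz by (auto simp: prod_zero_iff)
  define \<beta> where "\<beta> = \<delta> * z n"
  have \<beta>GF: "\<beta> \<in> GF m" unfolding \<beta>_def \<delta>_def by (intro GF_mult zGF ev_GF)
  have \<beta>nz: "\<beta> \<noteq> 0" using \<delta>nz znz[of n] n m by (simp add: \<beta>_def)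
  \<comment> \<open>The k-th Frobenius power of z(m - k) is -z(k), and -1 has character 1 in even
    degree. In the product for P'(\<alpha>) the factors k and m - k thus have equal signs, and only
    the sign of z(n) survives.\<close>
  have pair: "\<psi> (z (m - k)) = \<psi> (z k)" if k: "0 < k" "k < m" for k
  proof -
    have "z (m - k) ^ (?q ^ k) = to_ac (- 1) * z k"
    proof -
      have "(\<alpha> ^ (?q ^ (m - k))) ^ (?q ^ k) = \<alpha>"
        using root_in_GF k by (simp add: GF_def flip: power_mult power_add)
      thus ?thesis by (simp add: z_def frob_diff)
    qed
    hence "\<psi> (z (m - k)) = \<psi> (to_ac (- 1) * z k)" using eta_frob[OF zGF, of "m - k" k] by simp
    also have "\<dots> = \<psi> (z k)" using psi_smult[OF zGF, of "- 1"] psi_const_even[of "- 1"] m by simp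
    finally show ?thesis .
  qed
  have psi_sq: "\<psi> (z k) * \<psi> (z k) = 1" if "0 < k" "k < m" for k
    using eta_cases[of m "z k"] znz[OF that] by auto
  have "\<psi> \<delta> = (\<Prod>k\<in>{1..<m}. \<psi> (z k))" unfolding \<delta> using zGF by (intro eta_prod[OF odd m_pos]) auto
  also have "{1..<m} = insert n ({1..<n} \<union> {n+1..<m})" using n m by auto
  also have "(\<Prod>k\<in>insert n ({1..<n} \<union> {n+1..<m}). \<psi> (z k)) =
      \<psi> (z n) * ((\<Prod>k\<in>{1..<n}. \<psi> (z k)) * (\<Prod>k\<in>{n+1..<m}. \<psi> (z k)))"
    by (subst prod.insert) (auto simp: prod.union_disjoint)
  also have "(\<Prod>k\<in>{n+1..<m}. \<psi> (z k)) = (\<Prod>k\<in>{1..<n}. \<psi> (z (m - k)))"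
    by (rule prod.reindex_bij_witness[of _ "\<lambda>k. m - k" "\<lambda>k. m - k"]) (use m in auto)
  also have "\<dots> = (\<Prod>k\<in>{1..<n}. \<psi> (z k))" using pair m by (intro prod.cong) auto
  also have "(\<Prod>k\<in>{1..<n}. \<psi> (z k)) * \<dots> = 1"
    using psi_sq m by (simp flip: prod.distrib)
  finally have "\<psi> \<delta> = \<psi> (z n)" by simp
  moreover have "\<psi> \<beta> = \<psi> \<delta> * \<psi> (z n)"
    unfolding \<beta>_def by (rule eta_mult[OF odd _ zGF m_pos]) (simp add: \<delta>_def)
  ultimately have psi\<beta>: "\<psi> \<beta> = 1" using psi_sq[of n] n m by simp
  have perp: "perp ?W = (\<lambda>k. \<beta> * k) ` ?W"
  proof (rule card_seteq[symmetric])
    show "finite (perp ?W)" unfolding perp_def using fin_GF by simp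
    have "?q ^ n * card (perp ?W) = ?q ^ n * ?q ^ n"
      using card_perp[OF W] m by (simp add: cW power_add mult_2)
    hence "card (perp ?W) = ?q ^ n" by simp
    moreover have "card ((\<lambda>k. \<beta> * k) ` ?W) = ?q ^ n"
      using \<beta>nz by (simp add: card_image inj_on_def cW)
    ultimately show "card (perp ?W) \<le> card ((\<lambda>k. \<beta> * k) ` ?W)" by simp
    show "(\<lambda>k. \<beta> * k) ` ?W \<subseteq> perp ?W"
    proof
      fix b assume "b \<in> (\<lambda>k. \<beta> * k) ` ?W"
      then obtain k where k: "k \<in> ?W" "b = \<beta> * k" by auto
      have "lam (b * h) = 0" if h: "h \<in> ?W" for h
      proof -
        have bh: "b * h \<in> GF m" using k h \<beta>GF WGF by (auto intro!: GF_mult)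
        \<comment> \<open>y is the element whose trace is the form at b h. Since z(n) changes sign
          under the n-th Frobenius power and k h is fixed, the terms i and n + i of the trace
          cancel.\<close>
        define y where "y = z n * (k * h)"
        have kh: "(k * h) ^ (?q ^ n) = k * h" using GF_mult[OF k(1) h] by (simp add: GF_def)
        have "z n ^ (?q ^ n) = - z n"
        proof -
          have "(\<alpha> ^ (?q ^ n)) ^ (?q ^ n) = \<alpha>"
            using root_in_GF m by (simp add: GF_def mult_2 flip: power_mult power_add)
          thus ?thesis by (simp add: z_def frob_diff)
        qed
        hence yn: "y ^ (?q ^ n) = - y" using kh by (simp add: y_def power_mult_distrib[of "z n"])
        have "(b * h) / \<delta> = y" using \<delta>nz by (simp add: k(2) \<beta>_def y_def)
        hence "to_ac (lam (b * h)) = (\<Sum>i<n + n. y ^ (?q ^ i))"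
          using trace_lam[OF bh] m by (simp add: \<delta>_def mult_2)
        also have "\<dots> = (\<Sum>i<n. y ^ (?q ^ i)) + (\<Sum>i<n. y ^ (?q ^ (n + i)))"
          by (rule sum_lessThan_add)
        also have "(\<Sum>i<n. y ^ (?q ^ (n + i))) = (\<Sum>i<n. - (y ^ (?q ^ i)))"
          by (intro sum.cong refl) (simp add: power_add power_mult yn frob_minus)
        finally have "to_ac (lam (b * h)) = 0" by (simp add: sum_negf)
        thus ?thesis by simp
      qed
      moreover have "b \<in> GF m" using k \<beta>GF WGF by (auto intro!: GF_mult)
      ultimately show "b \<in> perp ?W" by (simp add: perp_def)
    qed
  qed
  have "(\<Sum>h\<in>perp ?W. \<psi> h) = (\<Sum>k\<in>?W. \<psi> (\<beta> * k))"
    unfolding perp using \<beta>nz by (subst sum.reindex) (auto simp: inj_on_def)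
  also have "\<dots> = (\<Sum>k\<in>?W. \<psi> k)"
    using WGF \<beta>GF by (intro sum.cong refl) (auto simp: eta_mult[OF odd _ _ m_pos] psi\<beta>)
  finally have eq: "(\<Sum>h\<in>perp ?W. \<psi> h) = (\<Sum>k\<in>?W. \<psi> k)" .
  have "(\<Sum>k\<in>?W. \<psi> k) = (\<Sum>k\<in>?W - {0}. \<psi> k)"
    using n by (intro sum.mono_neutral_right) auto
  also have "\<dots> = (\<Sum>k\<in>?W - {0}. 1)" using psiW by (intro sum.cong) auto
  also have "\<dots> \<noteq> 0"
  proof -
    have "?q ^ n > 1" by (rule one_less_power[OF card_gt_1 n])
    hence "card (?W - {0}) > 0" using n by (simp add: cW card_Diff_subset)
    hence "int (card (?W - {0})) \<noteq> 0" by linarith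
    thus ?thesis by (simp only: sum_constant mult_1_right not_False_eq_True)
  qed
  finally show ?thesis using even_functional_aux[OF W] eq by (simp add: cW Z_def)
qed

lemma sum_psi_V:
  assumes "even m" "l \<le> m"
  shows "(\<Sum>h\<in>V l. \<psi> h) = int (CARD('a) - 1) * (\<Sum>j<l. B j)"
proof -
  have "(\<Sum>g\<in>polys l. \<psi> (ev g \<alpha>)) = int (CARD('a) - 1) * (\<Sum>j<l. B j)"
  proof (induction l)
    case 0
    have "polys 0 = {0 :: 'a poly}" by (auto simp: polys_def poly_eq_iff)
    thus ?case by simp
  next
    case (Suc l)
    have "(\<Sum>c\<in>UNIV - {0::'a}. \<Sum>f\<in>monics l. \<psi> (ev (smult c f) \<alpha>)) = (\<Sum>c\<in>UNIV - {0::'a}. B l)"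
      unfolding B_def using assms(1) by (intro sum.cong refl) (auto simp: psi_smult psi_const_even)
    thus ?case using Suc by (simp add: sum_polys_Suc card_Diff_subset algebra_simps)
  qed
  thus ?thesis unfolding V_def using assms by (subst sum.reindex) (auto simp: inj_on_ev_polys)
qed

text \<open>The partial sum below l is, up to the factor q - 1, the character sum over
  \<open>V l\<close>, whose complement is \<open>V (m - l)\<close>. For l = m the right side is
  empty: this is the trivial zero of L.\<close>

theorem functional_equation_even:
  assumes m: "m = 2 * n" and l: "l \<le> m"
  shows "int (CARD('a)) ^ n * (\<Sum>j<l. B j) = int (CARD('a)) ^ l * (\<Sum>j<m - l. B j)"
proof -
  define Z where "Z = (\<Sum>a | a \<in> GF m \<and> lam a = 0. \<psi> a)"
  let ?q = "int CARD('a)"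
  have q: "int (CARD('a) - 1) = ?q - 1" "?q - 1 \<noteq> 0" using card_gt_1[where 'a='a] by auto
  have "even m" using m by simp
  have "?q * Z * ((?q - 1) * (\<Sum>j<l. B j)) = ?q ^ l * (?q - 1) * ((?q - 1) * (\<Sum>j<m - l. B j))"
    using even_functional_aux[OF subspace_V, of l] l \<open>even m\<close>
    by (simp add: perp_V_eq sum_psi_V card_V q Z_def)
  hence "?q ^ n * (?q - 1) * ((?q - 1) * (\<Sum>j<l. B j)) = ?q ^ l * (?q - 1) * ((?q - 1) * (\<Sum>j<m - l. B j))"
    using even_gauss_sum[OF m] by (simp add: Z_def q)
  thus ?thesis using q(2) by simp
qed

end

section \<open>The $L$-function as a polynomial and its average over primes\<close>

definition chi_sum :: "'a::{field,finite} poly \<Rightarrow> nat \<Rightarrow> int" where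
  "chi_sum D n = (\<Sum>f\<in>monics n. chi D f)"

lemma irred_root_oddI:
  assumes "odd CARD('a::{field,finite})" "P \<in> (monic_irreds m :: 'a poly set)"
  obtains \<alpha> where "irred_root_odd P m \<alpha>"
proof -
  obtain \<alpha> where "ev P \<alpha> = 0" using exists_root[of P] assms(2) by (auto simp: monic_irreds_def)
  hence "irred_root_odd P m \<alpha>" by unfold_locales (use assms in auto)
  thus ?thesis by (rule that)
qed

context irred_root_odd
begin

lemma chi_sum_eq_B: "chi_sum P n = ((- 1) ^ ((CARD('a) - 1) div 2 * m)) ^ n * B n"
  unfolding chi_sum_def B_def sum_distrib_left
  by (rule sum.cong) (auto simp: monics_def chi_eq_eta[OF odd] power_mult)

lemma chi_sum_eq_0: "n \<ge> m \<Longrightarrow> chi_sum P n = 0"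
  by (simp add: chi_sum_eq_B B_eq_0)

lemma chi_square:
  assumes "lead_coeff h = 1" "degree h < m"
  shows "chi P (h ^ 2) = 1"
proof -
  have "ev h \<alpha> \<noteq> 0" using monic_ev_nz[of h "degree h"] assms by (simp add: monics_def)
  moreover have "h \<noteq> 0" using assms by auto
  ultimately have "\<psi> (ev (h ^ 2) \<alpha>) = 1" "degree (h ^ 2) = 2 * degree h"
    using eta_square[OF odd ev_GF m_pos, of h] by (simp_all add: degree_power_eq power2_eq_square[of "ev h \<alpha>"])
  moreover have "lead_coeff (h ^ 2) = 1" using assms by (simp only: lead_coeff_power) simp
  ultimately show ?thesis using chi_eq_eta[OF odd, of "h ^ 2"] by simp
qed

end

lemma chi_sum_functional_odd:
  assumes odd: "odd CARD('a::{field,finite})" and P: "P \<in> (monic_irreds (2 * g + 1) :: 'a poly set)" and l: "l \<le> 2 * g"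
  shows "int CARD('a) ^ l * chi_sum P (2 * g - l) = int CARD('a) ^ g * chi_sum P l"
proof -
  obtain \<alpha> where "irred_root_odd P (2 * g + 1) \<alpha>" using irred_root_oddI[OF odd P] .
  then interpret irred_root_odd P "2 * g + 1" \<alpha> .
  define e :: int where "e = (- 1) ^ ((CARD('a) - 1) div 2 * (2 * g + 1))"
  have "e * e = 1" by (simp add: e_def flip: power_mult_distrib)
  have "e ^ (2 * g - l) * e ^ l = 1"
    using l \<open>e * e = 1\<close> by (simp add: power_mult power2_eq_square flip: power_add)
  moreover have "e ^ l * e ^ l = 1" using \<open>e * e = 1\<close> by (simp flip: power_mult_distrib)
  ultimately have "e ^ (2 * g - l) = e ^ l" by (metis mult.assoc mult.left_neutral mult.commute)
  thus ?thesis using functional_equation_odd[of g l] l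
    unfolding chi_sum_eq_B by (simp add: e_def)
qed

lemma chi_sum_functional_even:
  assumes odd: "odd CARD('a::{field,finite})" and P: "P \<in> (monic_irreds (2 * n) :: 'a poly set)" and l: "l \<le> 2 * n"
  shows "int CARD('a) ^ n * (\<Sum>j<l. chi_sum P j) = int CARD('a) ^ l * (\<Sum>j<2 * n - l. chi_sum P j)"
proof -
  obtain \<alpha> where "irred_root_odd P (2 * n) \<alpha>" using irred_root_oddI[OF odd P] .
  then interpret irred_root_odd P "2 * n" \<alpha> .
  have "chi_sum P j = B j" for j unfolding chi_sum_eq_B by (simp add: power_mult mult.commute[of _ "2 * n"])
  thus ?thesis using functional_equation_even[of n l] l by simp
qed

lemma of_nat_power_powr: "(of_nat (q ^ n) :: complex) powr z = (of_nat q powr z) ^ n"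
proof (induction n)
  case (Suc n)
  have "(of_nat (q ^ Suc n) :: complex) powr z = (of_nat q * of_nat (q ^ n)) powr z" by simp
  also have "\<dots> = of_nat q powr z * of_nat (q ^ n) powr z" by (rule powr_times_real) auto
  finally show ?case using Suc by simp
qed simp

lemma Lfun_eq_aux:
  fixes D :: "'a::{field,finite} poly"
  assumes "\<And>n. n \<ge> m \<Longrightarrow> chi_sum D n = 0"
  shows "Lfun s D = (\<Sum>n<m. of_int (chi_sum D n) * (of_nat CARD('a) powr (- s)) ^ n)"
proof -
  have inner: "(\<Sum>f\<in>monics n. of_int (chi D f) * of_nat (pnorm f) powr (- s)) =
       of_int (chi_sum D n) * (of_nat CARD('a) powr (- s)) ^ n" for n
    unfolding chi_sum_def of_int_sum sum_distrib_right
    by (rule sum.cong) (auto simp: pnorm_def monics_def of_nat_power_powr[symmetric] simp del: of_nat_power)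
  show ?thesis unfolding Lfun_def inner
    by (rule suminf_finite) (auto simp: assms)
qed

lemma Lfun_prime:
  assumes odd: "odd CARD('a::{field,finite})" and P: "P \<in> (monic_irreds m :: 'a poly set)"
  shows "Lfun s P = (\<Sum>n<m. of_int (chi_sum P n) * (of_nat CARD('a) powr (- s)) ^ n)"
proof (rule Lfun_eq_aux)
  obtain \<alpha> where "irred_root_odd P m \<alpha>" using irred_root_oddI[OF odd P] .
  then interpret irred_root_odd P m \<alpha> .
  show "chi_sum P n = 0" if "n \<ge> m" for n using that by (rule chi_sum_eq_0)
qed

lemma Lfun_generator_prime:
  fixes \<gamma> :: "'a::{field,finite}"
  assumes odd: "odd CARD('a)" and P: "P \<in> (monic_irreds m :: 'a poly set)"
    and gen: "\<gamma> \<noteq> 0" "\<forall>x::'a. x \<noteq> 0 \<longrightarrow> (\<exists>n::nat. x = \<gamma> ^ n)"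
  shows "Lfun s (smult \<gamma> P) = (\<Sum>n<m. of_int (chi_sum P n) * (- (of_nat CARD('a) powr (- s))) ^ n)"
proof -
  obtain \<alpha> where "irred_root_odd P m \<alpha>" using irred_root_oddI[OF odd P] .
  then interpret irred_root_odd P m \<alpha> .
  have tw: "chi_sum (smult \<gamma> P) n = (- 1) ^ n * chi_sum P n" for n
    unfolding chi_sum_def sum_distrib_left
    by (rule sum.cong) (auto simp: monics_def chi_generator[OF odd gen])
  have "Lfun s (smult \<gamma> P) = (\<Sum>n<m. of_int (chi_sum (smult \<gamma> P) n) * (of_nat CARD('a) powr (- s)) ^ n)"
    by (rule Lfun_eq_aux) (simp add: tw chi_sum_eq_0)
  also have "\<dots> = (\<Sum>n<m. of_int (chi_sum P n) * (- (of_nat CARD('a) powr (- s))) ^ n)"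
    by (rule sum.cong) (auto simp: tw power_minus[of "of_nat CARD('a) powr (- s)"])
  finally show ?thesis .
qed

text \<open>The number of monic squares of degree n, see \<open>card_monic_squares\<close>.\<close>

definition sqc :: "nat \<Rightarrow> nat \<Rightarrow> nat" where
  "sqc q n = (if even n then q ^ (n div 2) else 0)"

lemma monic_squares:
  "{f \<in> monics n. \<exists>h. f = h ^ 2} = (if even n then (\<lambda>h. h ^ 2) ` (monics (n div 2) :: 'a::{field,finite} poly set) else {})"
  (is "?L = ?R")
proof (intro Set.set_eqI iffI)
  fix f :: "'a poly" assume "f \<in> ?L"
  then obtain h where f: "f \<in> monics n" "f = h ^ 2" by auto
  hence h0: "h \<noteq> 0" by (auto simp: monics_def)
  have deg: "n = 2 * degree h" using f h0 by (auto simp: monics_def degree_power_eq)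
  have lc: "lead_coeff h ^ 2 = 1" using f by (auto simp: monics_def lead_coeff_power)
  define h' where "h' = smult (lead_coeff h) h"
  have "h' ^ 2 = f" using lc f by (simp add: h'_def power2_eq_square)
  moreover have "h' \<in> monics (n div 2)" using lc deg h0
    by (auto simp: h'_def monics_def power2_eq_square)
  ultimately show "f \<in> ?R" using deg by auto
next
  fix f :: "'a poly" assume "f \<in> ?R"
  then obtain h :: "'a poly" where h: "h \<in> monics (n div 2)" "f = h ^ 2" "even n" by (auto split: if_splits)
  hence "h \<noteq> 0" by (auto simp: monics_def)
  hence "degree (h ^ 2) = n" using h by (auto simp: monics_def degree_power_eq)
  moreover have "lead_coeff h = 1" using h(1) unfolding monics_def by blast
  hence "lead_coeff (h ^ 2) = 1" by (simp only: lead_coeff_power power_one)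
  ultimately show "f \<in> ?L" using h by (auto simp: monics_def)
qed

lemma card_monic_squares:
  assumes "odd CARD('a)"
  shows "card {f \<in> (monics n :: 'a::{field,finite} poly set). \<exists>h. f = h ^ 2} = sqc CARD('a) n"
proof -
  have "inj_on (\<lambda>h. h ^ 2) (monics k :: 'a poly set)" for k
  proof (rule inj_onI)
    fix f h :: "'a poly" assume fh: "f \<in> monics k" "h \<in> monics k" "f ^ 2 = h ^ 2"
    show "f = h"
    proof (rule ccontr)
      assume "f \<noteq> h"
      hence "f = - h" using fh by (simp add: power2_eq_iff)
      moreover have "coeff f k = 1" "coeff h k = 1" using fh by (auto simp: monics_def)
      ultimately have "(1::'a alg_closure) = - 1" by (metis coeff_minus to_ac_1 to_ac_minus)
      thus False using one_neq_minus_one[OF assms] by simp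
    qed
  qed
  thus ?thesis unfolding monic_squares sqc_def by (auto simp: card_image card_monics)
qed

text \<open>A square of degree n \<le> g is prime to P and contributes 1 for every P. Each of the at
  most q^n nonsquares is bounded by \<open>abs_sum_chi_le\<close>.\<close>

lemma sum_chi_sum_bound:
  assumes odd: "odd CARD('a::{field,finite})" and m: "2 * g < m" "m \<le> 2 * g + 2" and n: "n \<le> g"
  shows "\<bar>(\<Sum>P\<in>(monic_irreds m :: 'a poly set). chi_sum P n) -
      int (card (monic_irreds m :: 'a poly set)) * int (sqc CARD('a) n)\<bar> \<le> 13 * int (CARD('a) ^ (g + 2)) * int (CARD('a) ^ n)"
proof -
  let ?Pm = "monic_irreds m :: 'a poly set"
  let ?S = "{f \<in> (monics n :: 'a poly set). \<exists>h. f = h ^ 2}"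
  have sq: "chi P f = 1" if P: "P \<in> ?Pm" and f: "f \<in> ?S" for P f
  proof -
    obtain \<alpha> where "irred_root_odd P m \<alpha>" using irred_root_oddI[OF odd P] .
    then interpret irred_root_odd P m \<alpha> .
    have "f \<in> (if even n then (\<lambda>h. h ^ 2) ` (monics (n div 2) :: 'a poly set) else {})"
      using f by (simp only: monic_squares)
    then obtain h :: "'a poly" where h: "f = h ^ 2" "h \<in> monics (n div 2)" by (auto split: if_splits)
    thus ?thesis using chi_square[of h] n m by (auto simp: monics_def)
  qed
  have "(\<Sum>P\<in>?Pm. chi_sum P n) = (\<Sum>f\<in>monics n. \<Sum>P\<in>?Pm. chi P f)"
    unfolding chi_sum_def by (rule sum.swap)
  also have "\<dots> = (\<Sum>f\<in>monics n - ?S. \<Sum>P\<in>?Pm. chi P f) + (\<Sum>f\<in>?S. \<Sum>P\<in>?Pm. chi P f)"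
    by (rule sum.subset_diff) auto
  also have "(\<Sum>f\<in>?S. \<Sum>P\<in>?Pm. chi P f) = (\<Sum>f\<in>?S. \<Sum>P\<in>?Pm. 1)"
    using sq by (intro sum.cong) auto
  also have "\<dots> = int (card ?Pm) * int (sqc CARD('a) n)"
    by (simp only: sum_constant card_monic_squares[OF odd] mult_1_right) simp
  finally have "\<bar>(\<Sum>P\<in>?Pm. chi_sum P n) - int (card ?Pm) * int (sqc CARD('a) n)\<bar> =
      \<bar>\<Sum>f\<in>monics n - ?S. \<Sum>P\<in>?Pm. chi P f\<bar>" by simp
  also have "\<dots> \<le> (\<Sum>f\<in>monics n - ?S. \<bar>\<Sum>P\<in>?Pm. chi P f\<bar>)" by (rule sum_abs)
  also have "\<dots> \<le> (\<Sum>f\<in>monics n - ?S. 13 * int (CARD('a) ^ (g + 2)))"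
  proof (rule sum_mono)
    fix f assume f: "f \<in> monics n - ?S"
    show "\<bar>\<Sum>P\<in>?Pm. chi P f\<bar> \<le> 13 * int (CARD('a) ^ (g + 2))"
      by (rule abs_sum_chi_le[OF odd _ _ _ m]) (use f n in \<open>auto simp: monics_def\<close>)
  qed
  also have "\<dots> \<le> (\<Sum>f\<in>(monics n :: 'a poly set). 13 * int (CARD('a) ^ (g + 2)))"
    by (rule sum_mono2) auto
  also have "\<dots> = 13 * int (CARD('a) ^ (g + 2)) * int (CARD('a) ^ n)"
    by (simp add: card_monics)
  finally show ?thesis .
qed

section \<open>Folding the L-polynomial by its functional equation\<close>

definition dual :: "nat \<Rightarrow> nat \<Rightarrow> complex \<Rightarrow> (nat \<Rightarrow> complex) \<Rightarrow> complex" where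
  "dual q g w u = (\<Sum>n\<le>g. u n * w ^ n) + (\<Sum>k<g. of_nat q ^ (g - k) * u k * w ^ (2 * g - k))"

lemma dual_fold:
  assumes q: "q > 0" and fe: "\<And>l. l \<le> 2 * g \<Longrightarrow> of_nat q ^ l * u (2 * g - l) = of_nat q ^ g * u l"
  shows "(\<Sum>n\<le>2 * g. u n * w ^ n) = dual q g w u"
proof -
  have "{..2 * g} = {..g} \<union> {g<..2 * g}" by auto
  hence "(\<Sum>n\<le>2 * g. u n * w ^ n) = (\<Sum>n\<le>g. u n * w ^ n) + (\<Sum>n\<in>{g<..2 * g}. u n * w ^ n)"
    by (simp only:) (subst sum.union_disjoint, auto)
  also have "(\<Sum>n\<in>{g<..2 * g}. u n * w ^ n) = (\<Sum>k<g. u (2 * g - k) * w ^ (2 * g - k))"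
    by (rule sum.reindex_bij_witness[of _ "\<lambda>k. 2 * g - k" "\<lambda>n. 2 * g - n"]) auto
  also have "\<dots> = (\<Sum>k<g. of_nat q ^ (g - k) * u k * w ^ (2 * g - k))"
  proof (rule sum.cong)
    fix k assume k: "k \<in> {..<g}"
    have "(of_nat q :: complex) ^ g = of_nat q ^ k * of_nat q ^ (g - k)" using k by (simp flip: power_add)
    hence "of_nat q ^ k * u (2 * g - k) = of_nat q ^ k * (of_nat q ^ (g - k) * u k)"
      using fe[of k] k by simp
    hence "u (2 * g - k) = of_nat q ^ (g - k) * u k" using q by simp
    thus "u (2 * g - k) * w ^ (2 * g - k) = of_nat q ^ (g - k) * u k * w ^ (2 * g - k)" by simp
  qed simp
  finally show ?thesis by (simp add: dual_def)
qed

text \<open>Linearity is the point of the folded form: it may be applied to averaged coefficients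
  and to model coefficients, and their difference is then estimated for n \<le> g only.\<close>

lemma dual_add: "dual q g w (\<lambda>n. u n + u' n) = dual q g w u + dual q g w u'"
  and dual_cmult: "dual q g w (\<lambda>n. c * u n) = c * dual q g w u"
  by (simp_all add: dual_def algebra_simps sum.distrib sum_distrib_left)

lemma sum_telescope_poly:
  fixes w :: "'b::comm_ring_1"
  shows "(1 - w) * (\<Sum>n\<le>M. (\<Sum>j\<le>n. t j) * w ^ n) = (\<Sum>n\<le>M. t n * w ^ n) - (\<Sum>j\<le>M. t j) * w ^ Suc M"
proof (induction M)
  case (Suc M)
  have step: "(1 - w) * (\<Sum>n\<le>Suc M. (\<Sum>j\<le>n. t j) * w ^ n) =
      (1 - w) * (\<Sum>n\<le>M. (\<Sum>j\<le>n. t j) * w ^ n) + (1 - w) * ((\<Sum>j\<le>Suc M. t j) * w ^ Suc M)"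
    by (simp add: distrib_left)
  show ?case unfolding step Suc.IH by (simp add: algebra_simps)
qed (simp add: algebra_simps)

lemma sum_L_odd:
  fixes w :: complex and g :: nat
  assumes odd: "odd CARD('a::{field,finite})"
  defines "T \<equiv> \<lambda>n. \<Sum>P\<in>(monic_irreds (2 * g + 1) :: 'a poly set). chi_sum P n"
  shows "(\<Sum>P\<in>(monic_irreds (2 * g + 1) :: 'a poly set). \<Sum>n<2 * g + 1. of_int (chi_sum P n) * w ^ n) =
      dual CARD('a) g w (\<lambda>n. of_int (T n))"
proof -
  have "(\<Sum>P\<in>(monic_irreds (2 * g + 1) :: 'a poly set). \<Sum>n<2 * g + 1. of_int (chi_sum P n) * w ^ n) =
      (\<Sum>n<2 * g + 1. of_int (T n) * w ^ n)"
    unfolding T_def by (subst sum.swap) (simp add: sum_distrib_right)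
  also have "\<dots> = (\<Sum>n\<le>2 * g. of_int (T n) * w ^ n)" by (simp flip: lessThan_Suc_atMost)
  also have "\<dots> = dual CARD('a) g w (\<lambda>n. of_int (T n))"
  proof (rule dual_fold)
    fix l assume l: "l \<le> 2 * g"
    have "int CARD('a) ^ l * T (2 * g - l) = int CARD('a) ^ g * T l"
      unfolding T_def sum_distrib_left
      by (rule sum.cong) (use chi_sum_functional_odd[OF odd _ l] in auto)
    from arg_cong[OF this, of "of_int :: int \<Rightarrow> complex"]
    show "of_nat CARD('a) ^ l * of_int (T (2 * g - l)) = of_nat CARD('a) ^ g * (of_int (T l) :: complex)" by simp
  qed simp
  finally show ?thesis .
qed

text \<open>Dividing out the trivial zero leaves a polynomial of degree 2g whose coefficients are
  the partial sums U, and for these the functional equation has the same shape as in odd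
  degree.\<close>

lemma sum_L_even:
  fixes w :: complex and g :: nat
  assumes odd: "odd CARD('a::{field,finite})"
  defines "T \<equiv> \<lambda>n. \<Sum>P\<in>(monic_irreds (2 * g + 2) :: 'a poly set). chi_sum P n"
  shows "(\<Sum>P\<in>(monic_irreds (2 * g + 2) :: 'a poly set). \<Sum>n<2 * g + 2. of_int (chi_sum P n) * w ^ n) =
      (1 - w) * dual CARD('a) g w (\<lambda>n. \<Sum>j\<le>n. of_int (T j))"
proof -
  let ?q = "int CARD('a)"
  have FE: "?q ^ (g + 1) * (\<Sum>j<l. T j) = ?q ^ l * (\<Sum>j<2 * g + 2 - l. T j)" if l: "l \<le> 2 * g + 2" for l
  proof -
    have sw: "(\<Sum>j<k. T j) = (\<Sum>P\<in>(monic_irreds (2 * g + 2) :: 'a poly set). \<Sum>j<k. chi_sum P j)" for k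
      unfolding T_def by (rule sum.swap)
    have "?q ^ (g + 1) * (\<Sum>j<l. chi_sum P j) = ?q ^ l * (\<Sum>j<2 * g + 2 - l. chi_sum P j)"
      if "P \<in> monic_irreds (2 * g + 2)" for P :: "'a poly"
      using chi_sum_functional_even[OF odd, of P "g + 1" l] that l by simp
    hence "(\<Sum>P\<in>(monic_irreds (2 * g + 2) :: 'a poly set). ?q ^ (g + 1) * (\<Sum>j<l. chi_sum P j)) =
        (\<Sum>P\<in>(monic_irreds (2 * g + 2) :: 'a poly set). ?q ^ l * (\<Sum>j<2 * g + 2 - l. chi_sum P j))"
      by (intro sum.cong refl)
    thus ?thesis unfolding sw by (simp only: sum_distrib_left[symmetric])
  qed
  define U :: "nat \<Rightarrow> complex" where "U = (\<lambda>n. \<Sum>j\<le>n. of_int (T j))"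
  have Ueq: "U n = of_int (\<Sum>j<Suc n. T j)" for n by (simp add: U_def lessThan_Suc_atMost)
  have "(\<Sum>P\<in>(monic_irreds (2 * g + 2) :: 'a poly set). \<Sum>n<2 * g + 2. of_int (chi_sum P n) * w ^ n) =
      (\<Sum>n<2 * g + 2. of_int (T n) * w ^ n)"
    unfolding T_def by (subst sum.swap) (simp add: sum_distrib_right)
  also have "\<dots> = (\<Sum>n\<le>2 * g + 1. of_int (T n) * w ^ n) - U (2 * g + 1) * w ^ Suc (2 * g + 1)"
  proof -
    \<comment> \<open>At l = 2g + 2 the right side of the functional equation is an empty
      sum.\<close>
    have "?q ^ (g + 1) * (\<Sum>j<2 * g + 2. T j) = 0" using FE[of "2 * g + 2"] by simp
    hence "(\<Sum>j<2 * g + 2. T j) = 0" by simp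
    hence "U (2 * g + 1) = 0" by (simp add: Ueq)
    thus ?thesis by (simp flip: lessThan_Suc_atMost)
  qed
  also have "\<dots> = (1 - w) * (\<Sum>n\<le>2 * g + 1. U n * w ^ n)"
    unfolding U_def by (rule sum_telescope_poly[symmetric])
  also have "(\<Sum>n\<le>2 * g + 1. U n * w ^ n) = (\<Sum>n\<le>2 * g. U n * w ^ n)"
  proof -
    have "?q ^ (g + 1) * (\<Sum>j<2 * g + 2. T j) = 0" using FE[of "2 * g + 2"] by simp
    hence "(\<Sum>j<2 * g + 2. T j) = 0" by simp
    hence "U (2 * g + 1) = 0" by (simp add: Ueq)
    thus ?thesis by simp
  qed
  also have "\<dots> = dual CARD('a) g w U"
  proof (rule dual_fold)
    fix l assume l: "l \<le> 2 * g"
    \<comment> \<open>U l has l + 1 terms, so the functional equation is used at l + 1; one factor q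
      cancels.\<close>
    have "Suc (2 * g - l) = 2 * g + 2 - Suc l" using l by simp
    hence "?q * (?q ^ l * (\<Sum>j<Suc (2 * g - l). T j)) = ?q * (?q ^ g * (\<Sum>j<Suc l. T j))"
      using FE[of "Suc l"] l by (simp only: Suc_le_mono) (simp add: mult.assoc)
    hence "?q ^ l * (\<Sum>j<Suc (2 * g - l). T j) = ?q ^ g * (\<Sum>j<Suc l. T j)" by simp
    from arg_cong[OF this, of "of_int :: int \<Rightarrow> complex"]
    show "of_nat CARD('a) ^ l * U (2 * g - l) = of_nat CARD('a) ^ g * U l" by (simp only: Ueq) simp
  qed simp
  finally show ?thesis by (simp add: U_def)
qed

section \<open>Closed forms of the main terms\<close>

lemma sum_even_indices: "(\<Sum>k<g. if even k then h (k div 2) else 0) = (\<Sum>l<(g + 1) div 2. h l)"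
  for h :: "nat \<Rightarrow> 'b::comm_monoid_add"
proof (induction g)
  case (Suc g)
  show ?case
  proof (cases "even g")
    case True
    then obtain t where "g = 2 * t" by (elim evenE)
    thus ?thesis using Suc by simp
  next
    case False
    then obtain t where "g = 2 * t + 1" by (elim oddE)
    thus ?thesis using Suc by simp
  qed
qed simp

definition Sq :: "nat \<Rightarrow> nat \<Rightarrow> nat" where
  "Sq q n = (\<Sum>j\<le>n. sqc q j)"

lemma Sq_closed:
  fixes q n :: nat
  shows "(of_nat q - 1) * (of_nat (Sq q n) :: 'b::comm_ring_1) = of_nat q ^ (n div 2 + 1) - 1"
proof (induction n)
  case (Suc n)
  have e: "(of_nat (Sq q (Suc n)) :: 'b) = of_nat (Sq q n) + of_nat (sqc q (Suc n))" by (simp add: Sq_def)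
  show ?case
  proof (cases "even n")
    case True
    then obtain t where "n = 2 * t" by (elim evenE)
    thus ?thesis using Suc unfolding e by (simp add: sqc_def algebra_simps)
  next
    case False
    then obtain t where "n = 2 * t + 1" by (elim oddE)
    thus ?thesis using Suc unfolding e by (simp add: sqc_def algebra_simps)
  qed
qed (simp add: Sq_def sqc_def)

lemma sum_sqc:
  fixes y :: complex
  shows "(\<Sum>n\<le>g. of_nat (sqc q n) * y ^ n) = (\<Sum>l\<le>g div 2. (of_nat q * y ^ 2) ^ l)"
proof -
  have "(\<Sum>n\<le>g. of_nat (sqc q n) * y ^ n) = (\<Sum>n<Suc g. if even n then (of_nat q * y ^ 2) ^ (n div 2) else 0)"
    unfolding lessThan_Suc_atMost
    by (rule sum.cong) (auto simp: sqc_def power_mult_distrib simp flip: power_mult)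
  also have "\<dots> = (\<Sum>l<(Suc g + 1) div 2. (of_nat q * y ^ 2) ^ l)" by (rule sum_even_indices)
  also have "(Suc g + 1) div 2 = Suc (g div 2)" by simp
  finally show ?thesis by (simp add: lessThan_Suc_atMost)
qed

lemma sum_sqc_dual:
  fixes w :: complex
  shows "(\<Sum>k<g. of_nat q ^ (g - k) * of_nat (sqc q k) * w ^ (2 * g - k)) = (\<Sum>j\<in>{g div 2 + 1..g}. (of_nat q * w ^ 2) ^ j)"
proof -
  have "(\<Sum>k<g. of_nat q ^ (g - k) * of_nat (sqc q k) * w ^ (2 * g - k)) =
      (\<Sum>k<g. if even k then (of_nat q * w ^ 2) ^ (g - k div 2) else 0)"
  proof (rule sum.cong)
    fix k assume k: "k \<in> {..<g}"
    show "of_nat q ^ (g - k) * of_nat (sqc q k) * w ^ (2 * g - k) =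
        (if even k then (of_nat q * w ^ 2) ^ (g - k div 2) else 0)"
    proof (cases "even k")
      case True
      then obtain l where l: "k = 2 * l" by (elim evenE)
      have "g - k + l = g - l" "2 * (g - l) = 2 * g - k" using k l by auto
      thus ?thesis using True l
        by (simp add: sqc_def power_mult_distrib flip: power_add power_mult)
    qed (simp add: sqc_def)
  qed simp
  also have "\<dots> = (\<Sum>l<(g + 1) div 2. (of_nat q * w ^ 2) ^ (g - l))" by (rule sum_even_indices)
  also have "\<dots> = (\<Sum>j\<in>{g div 2 + 1..g}. (of_nat q * w ^ 2) ^ j)"
    by (rule sum.reindex_bij_witness[of _ "\<lambda>j. g - j" "\<lambda>l. g - l"]) auto
  finally show ?thesis .
qed

text \<open>Squares of degree up to g give the powers with exponent up to g div 2, and their dual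
  terms exactly the remaining ones up to g. The halves join to one geometric sum, the origin of
  I_g.\<close>

lemma dual_sqc: "dual q g w (\<lambda>n. of_nat (sqc q n)) = (\<Sum>j\<le>g. (of_nat q * w ^ 2) ^ j)"
proof -
  have "{..g} = {..g div 2} \<union> {g div 2 + 1..g}" by auto
  hence "(\<Sum>j\<le>g. (of_nat q * w ^ 2) ^ j) =
      (\<Sum>j\<le>g div 2. (of_nat q * w ^ 2) ^ j) + (\<Sum>j\<in>{g div 2 + 1..g}. (of_nat q * w ^ 2) ^ j)"
    by (simp only:) (subst sum.union_disjoint, auto)
  thus ?thesis unfolding dual_def sum_sqc sum_sqc_dual by simp
qed

text \<open>The exact main term in even degree, per prime: the model coefficients are the partial
  sums of \<open>sqc\<close>, and 1 - w is the trivial zero.\<close>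

definition Msq :: "nat \<Rightarrow> nat \<Rightarrow> complex \<Rightarrow> complex" where
  "Msq q g w = (1 - w) * dual q g w (\<lambda>n. of_nat (Sq q n))"

lemma abel_summation:
  fixes b S :: "nat \<Rightarrow> 'b::comm_ring_1"
  assumes "\<And>n. S (Suc n) = S n + t (Suc n)" "S 0 = t 0"
  shows "(\<Sum>k\<le>n. S k * (b k - b (Suc k))) = (\<Sum>k\<le>n. t k * b k) - S n * b (Suc n)"
  by (induction n) (simp_all add: assms algebra_simps)

lemma Msq_split:
  "Msq q g w = (\<Sum>l\<le>g div 2. (of_nat q * w ^ 2) ^ l) - of_nat (Sq q g) * w ^ (g + 1)
      + (1 - w) * (\<Sum>k<g. of_nat q ^ (g - k) * of_nat (Sq q k) * w ^ (2 * g - k))"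
proof -
  have "(1 - w) * (\<Sum>n\<le>g. of_nat (Sq q n) * w ^ n) = (\<Sum>n\<le>g. of_nat (sqc q n) * w ^ n) - of_nat (Sq q g) * w ^ Suc g"
    unfolding Sq_def of_nat_sum by (rule sum_telescope_poly)
  thus ?thesis by (simp add: Msq_def dual_def distrib_left sum_sqc)
qed

text \<open>Consecutive weights q^(g-k) w^(2g-k) have ratio 1/(q w), so Abel summation turns the
  partial sums back into \<open>sqc\<close>. The factor 1 - 1/(q w) is the source of the quotient
  zeta_A(2 - s)/zeta_A(1 + s), which is \<open>cfac\<close> at w = q^(-s).\<close>

lemma Msq_dual_part:
  fixes w :: complex
  assumes q: "q > 0" and w: "w \<noteq> 0" and g: "g \<ge> 1"
  shows "(1 - 1 / (of_nat q * w)) * (\<Sum>k<g. of_nat q ^ (g - k) * of_nat (Sq q k) * w ^ (2 * g - k)) =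
      (\<Sum>j\<in>{g div 2 + 1..g}. (of_nat q * w ^ 2) ^ j) - of_nat (Sq q (g - 1)) * w ^ g"
proof -
  define b where "b = (\<lambda>k. of_nat q ^ (g - k) * w ^ (2 * g - k))"
  have vb: "1 / (of_nat q * w) * b k = b (Suc k)" if "k < g" for k
  proof -
    have "g - k = Suc (g - Suc k)" "2 * g - k = Suc (2 * g - Suc k)" using that by auto
    thus ?thesis using q w by (simp only: b_def power_Suc) (simp add: field_simps)
  qed
  obtain n where n: "g = Suc n" using g by (cases g) auto
  have "(1 - 1 / (of_nat q * w)) * (\<Sum>k<g. of_nat q ^ (g - k) * of_nat (Sq q k) * w ^ (2 * g - k)) =
      (\<Sum>k<g. of_nat (Sq q k) * (b k - b (Suc k)))"
    unfolding sum_distrib_left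
  proof (rule sum.cong)
    fix k assume "k \<in> {..<g}"
    hence "b (Suc k) = 1 / (of_nat q * w) * b k" using vb by simp
    thus "(1 - 1 / (of_nat q * w)) * (of_nat q ^ (g - k) * of_nat (Sq q k) * w ^ (2 * g - k)) =
        of_nat (Sq q k) * (b k - b (Suc k))"
      by (simp add: b_def algebra_simps)
  qed simp
  also have "\<dots> = (\<Sum>k\<le>n. of_nat (Sq q k) * (b k - b (Suc k)))" by (simp add: n lessThan_Suc_atMost)
  also have "\<dots> = (\<Sum>k\<le>n. of_nat (sqc q k) * b k) - of_nat (Sq q n) * b (Suc n)"
    by (rule abel_summation) (simp_all add: Sq_def)
  also have "(\<Sum>k\<le>n. of_nat (sqc q k) * b k) = (\<Sum>k<g. of_nat q ^ (g - k) * of_nat (sqc q k) * w ^ (2 * g - k))"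
    unfolding n lessThan_Suc_atMost[symmetric] by (rule sum.cong) (simp_all add: b_def n mult_ac)
  also have "\<dots> = (\<Sum>j\<in>{g div 2 + 1..g}. (of_nat q * w ^ 2) ^ j)" by (rule sum_sqc_dual)
  also have "b (Suc n) = w ^ g" by (simp add: b_def n mult_2)
  finally show ?thesis by (simp add: n)
qed

text \<open>In the variable $w = q^{-s}$, resp. $w = -q^{-s}$ for the twist by $\gamma$, the main terms of parts 2
  and 3 become the same rational functions \<open>FJ1\<close> and \<open>FJ2\<close>. Their counterparts \<open>HJ1\<close> and \<open>HJ2\<close> have
  no removable singularities at $q w^2 = 1$, resp. $q w = 1$.\<close>

definition cfac :: "nat \<Rightarrow> complex \<Rightarrow> complex" where
  "cfac q w = (1 - w) / (1 - 1 / (of_nat q * w))"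

definition Zstar :: "nat \<Rightarrow> nat \<Rightarrow> complex \<Rightarrow> complex" where
  "Zstar q g w = of_nat q / (of_nat q - 1) *
     (of_nat q ^ (g div 2) * w ^ (g + 1) + cfac q w * (of_nat q ^ ((g - 1) div 2) * w ^ g))"

definition FJ1 :: "nat \<Rightarrow> nat \<Rightarrow> complex \<Rightarrow> complex" where
  "FJ1 q g w = (let x = of_nat q * w ^ 2 in
     1 / (1 - x) * (1 - x ^ (g div 2 + 1) + cfac q w * (x ^ (g div 2 + 1) - x ^ (g + 1))) - Zstar q g w)"

definition FJ2 :: "nat \<Rightarrow> nat \<Rightarrow> complex \<Rightarrow> complex" where
  "FJ2 q g w = (let x = of_nat q * w ^ 2 in
     1 / (1 - x) * (1 - x ^ (g div 2 + 1) + cfac q w * x ^ (g div 2 + 1)) - Zstar q g w)"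

definition HJ1 :: "nat \<Rightarrow> nat \<Rightarrow> complex \<Rightarrow> complex" where
  "HJ1 q g w = (let x = of_nat q * w ^ 2 in
     (\<Sum>l\<le>g div 2. x ^ l) + cfac q w * (\<Sum>j\<in>{g div 2 + 1..g}. x ^ j) - Zstar q g w)"

text \<open>This is cfac times x^(g+1)/(1 - x) - w^g/(q - 1). The numerator of that difference
  vanishes at v = 1; the combination of geometric sums is its quotient by 1 - v, the denominator of
  \<open>cfac\<close>.\<close>

definition Rest2 :: "nat \<Rightarrow> nat \<Rightarrow> complex \<Rightarrow> complex" where
  "Rest2 q g w = (let x = of_nat q * w ^ 2; v = 1 / (of_nat q * w) in
     (1 - w) * x ^ g * (of_nat q * (\<Sum>i<g + 2. v ^ i) - (\<Sum>i<g. v ^ i))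
       / ((of_nat q * v ^ 2 - 1) * (of_nat q - 1)))"

definition HJ2 :: "nat \<Rightarrow> nat \<Rightarrow> complex \<Rightarrow> complex" where
  "HJ2 q g w = Msq q g w - w ^ (g + 1) / (of_nat q - 1) + Rest2 q g w"

lemma geo_sum_tail:
  fixes x :: complex
  assumes "a \<le> b"
  shows "(1 - x) * (\<Sum>j\<in>{a..<b}. x ^ j) = x ^ a - x ^ b"
  using assms
proof (induction b rule: dec_induct)
  case (step n)
  have "(1 - x) * (\<Sum>j\<in>{a..<Suc n}. x ^ j) = (1 - x) * (\<Sum>j\<in>{a..<n}. x ^ j) + (1 - x) * x ^ n"
    using step by (simp add: distrib_left)
  also have "(1 - x) * (\<Sum>j\<in>{a..<n}. x ^ j) = x ^ a - x ^ n" by (rule step.IH)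
  also have "x ^ a - x ^ n + (1 - x) * x ^ n = x ^ a - x ^ Suc n" by (simp add: algebra_simps)
  finally show ?case .
qed simp

lemma FJ1_eq_HJ1:
  assumes x: "of_nat q * w ^ 2 \<noteq> 1"
  shows "FJ1 q g w = HJ1 q g w"
proof -
  define x where "x = of_nat q * w ^ 2"
  have x1: "1 - x \<noteq> 0" using assms by (simp add: x_def)
  let ?a = "g div 2 + 1"
  have "(\<Sum>l\<le>g div 2. x ^ l) = (\<Sum>l\<in>{0..<?a}. x ^ l)" by (rule sum.cong) auto
  hence "(1 - x) * (\<Sum>l\<le>g div 2. x ^ l) = 1 - x ^ ?a" using geo_sum_tail[of 0 ?a x] by simp
  hence 1: "(\<Sum>l\<le>g div 2. x ^ l) = 1 / (1 - x) * (1 - x ^ ?a)" using x1 by (simp add: field_simps)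
  have "(\<Sum>j\<in>{?a..g}. x ^ j) = (\<Sum>j\<in>{?a..<g+1}. x ^ j)" by (rule sum.cong) auto
  hence "(1 - x) * (\<Sum>j\<in>{?a..g}. x ^ j) = x ^ ?a - x ^ (g + 1)" using geo_sum_tail[of ?a "g+1" x] by simp
  hence 2: "(\<Sum>j\<in>{?a..g}. x ^ j) = 1 / (1 - x) * (x ^ ?a - x ^ (g + 1))" using x1 by (simp add: field_simps)
  show ?thesis unfolding FJ1_def HJ1_def Let_def x_def[symmetric] 1 2 by (simp add: algebra_simps)
qed

lemma Sq_eq: "q \<ge> 2 \<Longrightarrow> (of_nat (Sq q n) :: complex) = (of_nat q * of_nat q ^ (n div 2) - 1) / (of_nat q - 1)"
proof -
  assume q: "q \<ge> 2"
  have "(of_nat q :: complex) \<noteq> of_nat 1" using q unfolding of_nat_eq_iff by simp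
  thus ?thesis using Sq_closed[of q n, where ?'b = complex] by (simp add: field_simps)
qed

text \<open>By its closed form \<open>Sq\<close> is a power of q minus 1, over q - 1. In the two
  boundary terms the powers of q give \<open>Zstar\<close>, and the two -1 make up the whole
  difference.\<close>

lemma Msq_minus_HJ1:
  assumes q: "q \<ge> 2" and w: "w \<noteq> 0" and v: "1 / (of_nat q * w) \<noteq> 1" and g: "g \<ge> 1"
  shows "Msq q g w - HJ1 q g w = (w ^ (g + 1) + cfac q w * w ^ g) / (of_nat q - 1)"
proof -
  have q1: "(of_nat q :: complex) - 1 \<noteq> 0"
    using q by (metis One_nat_def Suc_1 eq_iff_diff_eq_0 not_less_eq_eq of_nat_1 of_nat_eq_iff order_refl)
  define x where "x = of_nat q * w ^ 2"
  define D where "D = (\<Sum>k<g. of_nat q ^ (g - k) * of_nat (Sq q k) * w ^ (2 * g - k))"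
  define E where "E = (\<Sum>j\<in>{g div 2 + 1..g}. x ^ j)"
  have "(1 - 1 / (of_nat q * w)) * D = E - of_nat (Sq q (g - 1)) * w ^ g"
    unfolding D_def E_def x_def using q w g by (intro Msq_dual_part) auto
  hence "D = (E - of_nat (Sq q (g - 1)) * w ^ g) / (1 - 1 / (of_nat q * w))" using v by (simp add: field_simps)
  hence D: "(1 - w) * D = cfac q w * (E - of_nat (Sq q (g - 1)) * w ^ g)" by (simp add: cfac_def)
  have M: "Msq q g w = (\<Sum>l\<le>g div 2. x ^ l) - of_nat (Sq q g) * w ^ (g + 1) + cfac q w * (E - of_nat (Sq q (g - 1)) * w ^ g)"
    unfolding Msq_split D_def[symmetric] D x_def by simp
  have S: "of_nat (Sq q n) * y = of_nat q / (of_nat q - 1) * (of_nat q ^ (n div 2) * y) - y / (of_nat q - 1)" for n and y :: complex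
    unfolding Sq_eq[OF q] by (simp add: diff_divide_distrib left_diff_distrib)
  show ?thesis
    unfolding M HJ1_def Let_def x_def[symmetric] E_def[symmetric] Zstar_def S
    by (simp add: algebra_simps add_divide_distrib)
qed

text \<open>FJ2 exceeds FJ1 by cfac x^(g+1)/(1 - x). This and the cfac term of
  \<open>Msq_minus_HJ1\<close> are both singular at q w = 1; together they form
  \<open>Rest2\<close>, which is regular there.\<close>

lemma FJ2_eq_HJ2:
  assumes q: "q \<ge> 2" and w: "w \<noteq> 0" and v: "1 / (of_nat q * w) \<noteq> 1" and g: "g \<ge> 1" and x: "of_nat q * w ^ 2 \<noteq> 1"
  shows "FJ2 q g w = HJ2 q g w"
proof -
  have q1: "(of_nat q :: complex) - 1 \<noteq> 0"
    using q by (metis One_nat_def Suc_1 eq_iff_diff_eq_0 not_less_eq_eq of_nat_1 of_nat_eq_iff order_refl)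
  have q0: "(of_nat q :: complex) \<noteq> 0" using q by simp
  define x v where "x = of_nat q * w ^ 2" and "v = 1 / (of_nat q * w)"
  have x1: "1 - x \<noteq> 0" and v1: "1 - v \<noteq> 0" using assms by (simp_all add: x_def v_def)
  have x0: "x \<noteq> 0" using q0 w by (simp add: x_def)
  have qv: "of_nat q * v ^ 2 = 1 / x" using q0 w by (simp add: x_def v_def power2_eq_square field_simps)
  have xv: "x * v = w" using q0 w by (simp add: x_def v_def power2_eq_square)
  have xvg: "x ^ g * v ^ g = w ^ g" by (simp add: xv flip: power_mult_distrib)
  define B where "B = of_nat q * (\<Sum>i<g + 2. v ^ i) - (\<Sum>i<g. v ^ i)"
  have gs: "(1 - v) * (\<Sum>i<n. v ^ i) = 1 - v ^ n" for n by (rule one_diff_power_eq[symmetric])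
  have "(1 - v) * B = of_nat q * ((1 - v) * (\<Sum>i<g + 2. v ^ i)) - (1 - v) * (\<Sum>i<g. v ^ i)"
    by (simp add: B_def algebra_simps del: sum.lessThan_Suc)
  also have "\<dots> = of_nat q * (1 - v ^ (g + 2)) - (1 - v ^ g)" unfolding gs ..
  also have "of_nat q * (1 - v ^ (g + 2)) = of_nat q - (1 / x) * v ^ g"
    by (simp add: qv[symmetric] power_add power2_eq_square algebra_simps)
  finally have B: "(1 - v) * B = of_nat q - 1 / x * v ^ g - (1 - v ^ g)" .
  have "x ^ (g + 1) / (1 - x) - w ^ g / (of_nat q - 1) = x ^ g * ((1 - v) * B) / ((1 / x - 1) * (of_nat q - 1))"
    unfolding B xvg[symmetric] using x0 x1 q1 by (simp add: field_simps)
  hence "cfac q w * (x ^ (g + 1) / (1 - x) - w ^ g / (of_nat q - 1)) =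
      (1 - w) * x ^ g * B / ((1 / x - 1) * (of_nat q - 1))"
    unfolding cfac_def v_def[symmetric] using v1 by simp
  also have "\<dots> = Rest2 q g w" unfolding Rest2_def Let_def x_def[symmetric] v_def[symmetric] B_def[symmetric] qv ..
  finally have R: "cfac q w * (x ^ (g + 1) / (1 - x) - w ^ g / (of_nat q - 1)) = Rest2 q g w" .
  have "FJ2 q g w = FJ1 q g w + cfac q w * (x ^ (g + 1) / (1 - x))"
    unfolding FJ1_def FJ2_def Let_def x_def[symmetric]
    by (simp add: algebra_simps add_divide_distrib diff_divide_distrib)
  also have "FJ1 q g w = Msq q g w - (w ^ (g + 1) + cfac q w * w ^ g) / (of_nat q - 1)"
    using Msq_minus_HJ1[OF q w _ g] v1 FJ1_eq_HJ1[OF x] by (simp add: v_def algebra_simps)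
  finally show ?thesis unfolding HJ2_def R[symmetric] by (simp add: algebra_simps add_divide_distrib)
qed

text \<open>If q w^2 = 1, then 1/(q w) = w, so cfac = 1, all summands are 1, and Zstar collapses to
  w/(1 - w). Both square roots are covered, w = q^(-1/2) for J and w = -q^(-1/2) for K.\<close>

lemma HJ1_central:
  assumes q: "q \<ge> 2" and w: "of_nat q * w ^ 2 = 1" "w \<noteq> 1" and g: "g \<ge> 1"
  shows "HJ1 q g w = of_nat g + 1 - w / (1 - w)"
proof -
  have q0: "(of_nat q :: complex) \<noteq> 0" using q by simp
  have w0: "w \<noteq> 0" using w by auto
  have qw: "of_nat q = 1 / w ^ 2" using w0 w by (simp add: field_simps)
  have "w ^ 2 \<noteq> 1"
  proof
    assume "w ^ 2 = 1"
    hence "(of_nat q :: complex) = of_nat 1" using w by simp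
    thus False using q unfolding of_nat_eq_iff by simp
  qed
  hence w2: "1 - w ^ 2 \<noteq> 0" "1 - w \<noteq> 0" using w by auto
  have "1 / (of_nat q * w) = w" using w0 by (simp add: qw power2_eq_square)
  hence c: "cfac q w = 1" using w2 by (simp add: cfac_def)
  have z: "of_nat q / (of_nat q - 1) = 1 / (1 - w ^ 2)"
    unfolding qw using w0 w2 by (simp add: field_simps)
  have k: "of_nat q ^ k * w ^ (2 * k) = 1" for k
    using w(1) by (simp add: power_mult flip: power_mult_distrib)
  have sum: "of_nat q ^ (g div 2) * w ^ (g + 1) + of_nat q ^ ((g - 1) div 2) * w ^ g = w + w ^ 2"
  proof (cases "even g")
    case True
    then obtain t where "g = 2 * t" by (elim evenE)
    with g obtain u where t: "g = 2 * t" "t = Suc u" by (cases t) auto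
    have 1: "(g - 1) div 2 = u" "g div 2 = t" using t by auto
    have "w ^ g = w ^ (2 * u) * w ^ 2" using t by (simp add: power2_eq_square mult_ac)
    hence "of_nat q ^ u * w ^ g = w ^ 2" using k[of u] by (simp flip: mult.assoc)
    moreover have "of_nat q ^ t * w ^ (g + 1) = w" using k[of t] t(1) by (simp add: mult_ac)
    ultimately show ?thesis by (simp only: 1 add.commute)
  next
    case False
    then obtain t where t: "g = 2 * t + 1" by (elim oddE)
    have 1: "(g - 1) div 2 = t" "g div 2 = t" using t by auto
    have "of_nat q ^ t * w ^ g = w" using k[of t] t by (simp add: mult_ac)
    moreover have "w ^ (g + 1) = w ^ (2 * t) * w ^ 2" using t by (simp add: power2_eq_square mult_ac)
    hence "of_nat q ^ t * w ^ (g + 1) = w ^ 2" using k[of t] by (simp flip: mult.assoc)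
    ultimately show ?thesis by (simp only: 1 add.commute)
  qed
  have "Zstar q g w = 1 / (1 - w ^ 2) * (w + w ^ 2)"
    unfolding Zstar_def z c by (simp only: mult_1 sum)
  also have "\<dots> = w / (1 - w)"
  proof -
    have "1 - w ^ 2 = (1 - w) * (1 + w)" by (simp add: power2_eq_square algebra_simps)
    moreover from this have "1 + w \<noteq> 0" using w2 by auto
    ultimately show ?thesis using w2 by (simp add: power2_eq_square field_simps)
  qed
  finally have Z: "Zstar q g w = w / (1 - w)" .
  have "card {g div 2 + 1..g} + card {..g div 2} = g + 1" by simp
  hence "of_nat (card {..g div 2}) + of_nat (card {g div 2 + 1..g}) = (of_nat g + 1 :: complex)"
    by (metis add.commute of_nat_1 of_nat_add)
  thus ?thesis unfolding HJ1_def Let_def w(1) c Z by simp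
qed

lemma sum_pow_half:
  "(of_nat q - 1) * (\<Sum>k<g. of_nat q ^ (k div 2)) = (of_nat q ^ (g div 2) + of_nat q ^ ((g + 1) div 2) - 2 :: complex)"
proof (induction g)
  case (Suc g)
  show ?case
  proof (cases "even g")
    case True
    then obtain t where "g = 2 * t" by (elim evenE)
    thus ?thesis using Suc by (simp add: algebra_simps)
  next
    case False
    then obtain t where "g = 2 * t + 1" by (elim oddE)
    thus ?thesis using Suc by (simp add: algebra_simps)
  qed
qed simp

text \<open>At $s = 1$ the three secondary terms of order $q^{-g/2}$ cancel.\<close>

lemma Msq_at_one:
  assumes q: "q \<ge> 2" and g: "g \<ge> 1"
  defines "w \<equiv> 1 / of_nat q :: complex"
  shows "Msq q g w - of_nat q / (of_nat q - 1) = ((w - 2) / (of_nat q - 1) - of_nat g * w) * w ^ g"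
proof -
  let ?q = "of_nat q :: complex"
  have q1: "?q - 1 \<noteq> 0"
    using q by (metis One_nat_def Suc_1 eq_iff_diff_eq_0 not_less_eq_eq of_nat_1 of_nat_eq_iff order_refl)
  have q0: "?q \<noteq> 0" using q by simp
  have x: "?q * w ^ 2 = w" using q0 by (simp add: w_def power2_eq_square)
  have w1: "1 - w = (?q - 1) / ?q" using q0 by (simp add: w_def field_simps)
  have qw: "?q ^ k * w ^ (k + j) = w ^ j" for k j
    using q0 by (simp add: w_def power_add power_one_over)
  let ?a = "g div 2 + 1"
  have "(1 - w) * (\<Sum>l\<le>g div 2. w ^ l) = 1 - w ^ ?a"
    using geo_sum_tail[of 0 ?a w] by (simp add: atLeast0LessThan lessThan_Suc_atMost)
  hence A: "(\<Sum>l\<le>g div 2. w ^ l) = ?q / (?q - 1) * (1 - w ^ ?a)"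
    unfolding w1 using q0 q1 by (simp add: field_simps)
  have "(\<Sum>k<g. ?q ^ (g - k) * of_nat (Sq q k) * w ^ (2 * g - k)) = (\<Sum>k<g. w ^ g * of_nat (Sq q k))"
  proof (rule sum.cong)
    fix k assume "k \<in> {..<g}"
    hence "2 * g - k = (g - k) + g" by auto
    thus "?q ^ (g - k) * of_nat (Sq q k) * w ^ (2 * g - k) = w ^ g * of_nat (Sq q k)"
      using qw[of "g - k" g] by (simp add: mult_ac)
  qed simp
  also have "\<dots> = w ^ g * (\<Sum>k<g. (?q * ?q ^ (k div 2) - 1) / (?q - 1))"
    unfolding Sq_eq[OF q] by (simp add: sum_distrib_left)
  also have "(\<Sum>k<g. (?q * ?q ^ (k div 2) - 1) / (?q - 1)) = (?q * (\<Sum>k<g. ?q ^ (k div 2)) - of_nat g) / (?q - 1)"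
    by (simp add: sum_subtractf sum_distrib_left flip: sum_divide_distrib)
  also have "(\<Sum>k<g. ?q ^ (k div 2)) = (?q ^ (g div 2) + ?q ^ ((g + 1) div 2) - 2) / (?q - 1)"
    using sum_pow_half[of q g] q1 by (simp add: field_simps)
  finally have B: "(\<Sum>k<g. ?q ^ (g - k) * of_nat (Sq q k) * w ^ (2 * g - k)) =
      w ^ g * ((?q * ((?q ^ (g div 2) + ?q ^ ((g + 1) div 2) - 2) / (?q - 1)) - of_nat g) / (?q - 1))" .
  \<comment> \<open>Over q - 1 these are the two kinds of secondary terms; each of them occurs below
    once with either sign.\<close>
  define p r where "p = w ^ g * ?q ^ (g div 2)" and "r = w ^ (g div 2)"
  have half: "g div 2 + (g + 1) div 2 = g" by simp
  have r: "w ^ g * ?q ^ ((g + 1) div 2) = r"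
    using qw[of "(g + 1) div 2" "g div 2"] half by (simp add: r_def mult.commute add.commute)
  have M: "Msq q g w = ?q / (?q - 1) * (1 - w * r) - (?q * ?q ^ (g div 2) - 1) / (?q - 1) * (w * w ^ g)
     + (?q - 1) / ?q * (w ^ g * ((?q * ((?q ^ (g div 2) + ?q ^ ((g + 1) div 2) - 2) / (?q - 1)) - of_nat g) / (?q - 1)))"
    unfolding Msq_split x A B unfolding Sq_eq[OF q] w1 r_def by simp
  also have "(?q * ?q ^ (g div 2) - 1) / (?q - 1) * (w * w ^ g) = (?q * w * p - w * w ^ g) / (?q - 1)"
    by (simp add: p_def algebra_simps)
  also have "?q * w = 1" using q0 by (simp add: w_def)
  also have "(?q - 1) / ?q * (w ^ g * ((?q * ((?q ^ (g div 2) + ?q ^ ((g + 1) div 2) - 2) / (?q - 1)) - of_nat g) / (?q - 1)))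
      = (?q - 1) / ?q * ((?q * ((p + r - 2 * w ^ g) / (?q - 1)) - of_nat g * w ^ g) / (?q - 1))"
    unfolding r[symmetric] p_def by (simp add: algebra_simps add_divide_distrib diff_divide_distrib)
  also have "\<dots> = (p + r - 2 * w ^ g) / (?q - 1) - of_nat g * w * w ^ g"
  proof -
    have "d / y * ((y * (u / d) - z) / d) = u / d - z / y" if "d \<noteq> 0" "y \<noteq> 0" for d y u z :: complex
      using that by (simp add: field_simps)
    from this[OF q1 q0] show ?thesis by (simp add: w_def)
  qed
  also have "?q / (?q - 1) * (1 - w * r) = ?q / (?q - 1) - r / (?q - 1)"
    using q0 by (simp add: w_def right_diff_distrib)
  finally have "Msq q g w - ?q / (?q - 1) = - r / (?q - 1) - (1 * p - w * w ^ g) / (?q - 1)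
      + ((p + r - 2 * w ^ g) / (?q - 1) - of_nat g * w * w ^ g)" by simp
  also have "\<dots> = ((w - 2) / (?q - 1) - of_nat g * w) * w ^ g"
    by (simp add: algebra_simps add_divide_distrib diff_divide_distrib)
  finally show ?thesis .
qed

section \<open>Translation between s and w = q^(-s)\<close>

lemma powr_of_nat_mult: "q > 0 \<Longrightarrow> (of_nat q :: complex) powr (of_nat k * y) = (of_nat q powr y) ^ k"
  by (simp add: powr_def mult.assoc flip: exp_of_nat_mult)

lemma powr_1_minus_2: "q > 0 \<Longrightarrow> (of_nat q :: complex) powr (1 - 2 * z) = of_nat q * (of_nat q powr (- z)) ^ 2"
proof -
  assume q: "q > 0"
  have "(of_nat q :: complex) powr (1 - 2 * z) = of_nat q powr (1 + of_nat 2 * (- z))" by simp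
  also have "\<dots> = of_nat q powr 1 * of_nat q powr (of_nat 2 * (- z))" by (rule powr_add)
  also have "\<dots> = of_nat q * (of_nat q powr (- z)) ^ 2" using q by (simp only: powr_of_nat_mult) simp
  finally show ?thesis .
qed

lemma powr_mixed:
  "q > 0 \<Longrightarrow> (of_nat q :: complex) powr (of_nat k - of_nat n * z) = of_nat q ^ k * (of_nat q powr (- z)) ^ n"
proof -
  assume q: "q > 0"
  have "(of_nat q :: complex) powr (of_nat k - of_nat n * z) = of_nat q powr (of_nat k * 1 + of_nat n * (- z))" by simp
  also have "\<dots> = of_nat q powr (of_nat k * 1) * of_nat q powr (of_nat n * (- z))" by (rule powr_add)
  also have "\<dots> = of_nat q ^ k * (of_nat q powr (- z)) ^ n" using q by (simp only: powr_of_nat_mult) simp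
  finally show ?thesis .
qed

lemma powr_minus_1: "q > 0 \<Longrightarrow> (of_nat q :: complex) powr (z - 1) = 1 / (of_nat q * of_nat q powr (- z))"
  by (simp add: powr_diff powr_minus field_simps)

lemma zetaA_2: "q \<ge> 2 \<Longrightarrow> zetaA q 2 = of_nat q / (of_nat q - 1)"
proof -
  assume q: "q \<ge> 2"
  have q0: "(of_nat q :: complex) \<noteq> 0" using q by simp
  have "(of_nat q :: complex) powr (1 - 2) = 1 / of_nat q" using q by (simp add: powr_minus field_simps)
  hence "zetaA q 2 = 1 / (1 - 1 / of_nat q)" by (simp add: zetaA_def)
  also have "1 - 1 / of_nat q = (of_nat q - 1) / (of_nat q :: complex)" using q0 by (simp add: field_simps)
  finally show ?thesis by simp
qed

lemma zetaA_double: "q > 0 \<Longrightarrow> zetaA q (2 * z) = 1 / (1 - of_nat q * (of_nat q powr (- z)) ^ 2)"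
  unfolding zetaA_def by (simp add: powr_1_minus_2)

lemma floor_half: "\<lfloor>real g / 2\<rfloor> = int (g div 2)"
  using floor_divide_of_nat_eq[of g 2, where ?'a = real] by simp

text \<open>At g = 0 the floor is -1 while subtraction of naturals gives 0; from here on closed
  forms are compared for g \<ge> 1.\<close>

lemma floor_half_pred: "g \<ge> 1 \<Longrightarrow> \<lfloor>(real g - 1) / 2\<rfloor> = int ((g - 1) div 2)"
  using floor_half[of "g - 1"] by (simp add: of_nat_diff)

lemma cfac_zetaA: "q > 0 \<Longrightarrow> zetaA q (2 - z) / zetaA q (1 + z) = cfac q (of_nat q powr (- z))"
  by (simp add: zetaA_def cfac_def powr_minus_1)

text \<open>The integer g - [(g - 1)/2] equals [g/2] + 1, so two exponents that look different in
  the statement coincide.\<close>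

lemma exponents:
  fixes z :: complex
  assumes q: "q > 0" and g: "g \<ge> 1"
  defines "u \<equiv> of_nat q powr (- z) :: complex"
  shows "of_nat q powr (of_int \<lfloor>real g / 2 + 1\<rfloor> * (1 - 2 * z)) = (of_nat q * u ^ 2) ^ (g div 2 + 1)"
    and "of_nat q powr ((of_nat g - of_int \<lfloor>(real g - 1) / 2\<rfloor>) * (1 - 2 * z)) = (of_nat q * u ^ 2) ^ (g div 2 + 1)"
    and "of_nat q powr ((of_nat g + 1) * (1 - 2 * z)) = (of_nat q * u ^ 2) ^ (g + 1)"
    and "of_nat q powr (of_int \<lfloor>real g / 2\<rfloor> - (of_nat g + 1) * z) = of_nat q ^ (g div 2) * u ^ (g + 1)"
    and "of_nat q powr (of_int \<lfloor>(real g - 1) / 2\<rfloor> - of_nat g * z) = of_nat q ^ ((g - 1) div 2) * u ^ g"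
proof -
  have p: "of_nat q powr (of_nat k * (1 - 2 * z)) = (of_nat q * u ^ 2) ^ k" for k
    unfolding u_def using q by (simp only: powr_of_nat_mult powr_1_minus_2)
  have "of_int \<lfloor>real g / 2 + 1\<rfloor> = (of_nat (g div 2 + 1) :: complex)" by (simp add: floor_half)
  thus "of_nat q powr (of_int \<lfloor>real g / 2 + 1\<rfloor> * (1 - 2 * z)) = (of_nat q * u ^ 2) ^ (g div 2 + 1)"
    by (simp only: p)
  have "int g - int ((g - 1) div 2) = int (g div 2 + 1)" using g by presburger
  hence "of_int (int g - int ((g - 1) div 2)) = (of_int (int (g div 2 + 1)) :: complex)" by (simp only:)
  hence "of_nat g - of_int \<lfloor>(real g - 1) / 2\<rfloor> = (of_nat (g div 2 + 1) :: complex)"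
    by (simp add: floor_half_pred[OF g])
  thus "of_nat q powr ((of_nat g - of_int \<lfloor>(real g - 1) / 2\<rfloor>) * (1 - 2 * z)) = (of_nat q * u ^ 2) ^ (g div 2 + 1)"
    by (simp only: p)
  show "of_nat q powr ((of_nat g + 1) * (1 - 2 * z)) = (of_nat q * u ^ 2) ^ (g + 1)"
    using p[of "g + 1"] by (simp add: add.commute)
  show "of_nat q powr (of_int \<lfloor>real g / 2\<rfloor> - (of_nat g + 1) * z) = of_nat q ^ (g div 2) * u ^ (g + 1)"
    using powr_mixed[OF q, of "g div 2" "g + 1" z] by (simp add: floor_half u_def add.commute)
  show "of_nat q powr (of_int \<lfloor>(real g - 1) / 2\<rfloor> - of_nat g * z) = of_nat q ^ ((g - 1) div 2) * u ^ g"
    using powr_mixed[OF q, of "(g - 1) div 2" g z] by (simp add: floor_half_pred[OF g] u_def)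
qed

lemma J_eq_FJ:
  assumes q: "q \<ge> 2" and g: "g \<ge> 1"
  shows "zetaA q (2 * z) * J1 q g z - zetaA q 2 * Jstar q g z = FJ1 q g (of_nat q powr (- z))"
    and "zetaA q (2 * z) * J2 q g z - zetaA q 2 * Jstar q g z = FJ2 q g (of_nat q powr (- z))"
proof -
  have q0: "q > 0" using q by simp
  note e = exponents[OF q0 g, of z]
  show "zetaA q (2 * z) * J1 q g z - zetaA q 2 * Jstar q g z = FJ1 q g (of_nat q powr (- z))"
    unfolding J1_def Jstar_def FJ1_def Let_def Zstar_def e zetaA_double[OF q0] zetaA_2[OF q] cfac_zetaA[OF q0] ..
  show "zetaA q (2 * z) * J2 q g z - zetaA q 2 * Jstar q g z = FJ2 q g (of_nat q powr (- z))"
    unfolding J2_def Jstar_def FJ2_def Let_def Zstar_def e zetaA_double[OF q0] zetaA_2[OF q] cfac_zetaA[OF q0] ..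
qed

lemma cfac_minus:
  assumes q: "q > 0"
  shows "(1 + of_nat q powr (- z)) / (1 + of_nat q powr (z - 1)) = cfac q (- (of_nat q powr (- z)))"
  using powr_minus_1[OF q, of z] by (simp add: cfac_def)

text \<open>The twist is w -> -w: it accounts for the signs (-1)^g in \<open>Kstar\<close> and turns
  cfac into the quotient (1 + q^(-s))/(1 + q^(s-1)).\<close>

lemma K_eq_FJ:
  assumes q: "q \<ge> 2" and g: "g \<ge> 1"
  shows "zetaA q (2 * z) * K1 q g z + zetaA q 2 * Kstar q g z = FJ1 q g (- (of_nat q powr (- z)))"
    and "zetaA q (2 * z) * K2 q g z + zetaA q 2 * Kstar q g z = FJ2 q g (- (of_nat q powr (- z)))"
proof -
  have q0: "q > 0" using q by simp
  note e = exponents[OF q0 g, of z]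
  define u :: complex where "u = of_nat q powr (- z)"
  have m: "(- u) ^ (g + 1) = (- 1) ^ (g + 1) * u ^ (g + 1)" "(- u) ^ g = (- 1) ^ g * u ^ g"
    by (rule power_minus)+
  have cfu: "(1 + u) / (1 + of_nat q powr (z - 1)) = cfac q (- u)"
    unfolding u_def by (rule cfac_minus[OF q0])
  have Z: "zetaA q 2 * Kstar q g z = - Zstar q g (- u)"
    unfolding Kstar_def Zstar_def e zetaA_2[OF q] u_def[symmetric] cfu m
    by (simp add: algebra_simps)
  have sq: "(- u) ^ 2 = u ^ 2" by simp
  show "zetaA q (2 * z) * K1 q g z + zetaA q 2 * Kstar q g z = FJ1 q g (- (of_nat q powr (- z)))"
    unfolding Z K1_def FJ1_def Let_def e zetaA_double[OF q0] u_def[symmetric] cfu sq by simp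
  show "zetaA q (2 * z) * K2 q g z + zetaA q 2 * Kstar q g z = FJ2 q g (- (of_nat q powr (- z)))"
    unfolding Z K2_def FJ2_def Let_def e zetaA_double[OF q0] u_def[symmetric] cfu sq by simp
qed

text \<open>The exponential z -> e q^(-z) has nonzero derivative, so for z \<noteq> s near s its
  value differs from the value at s and avoids the finite set B. The limit can thus be taken in the
  variable w.\<close>

lemma remove_sings_powr:
  fixes \<Phi> H :: "complex \<Rightarrow> complex"
  assumes q: "q \<ge> 2" and e: "e \<noteq> 0" and B: "finite B"
    and eq: "\<And>w. w \<notin> B \<Longrightarrow> w \<noteq> 0 \<Longrightarrow> \<Phi> w = H w"
    and cont: "isCont H (e * of_nat q powr (- s))"
  shows "remove_sings (\<lambda>z. \<Phi> (e * of_nat q powr (- z))) s = H (e * of_nat q powr (- s))"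
proof (rule remove_sings_eqI)
  define W where "W = (\<lambda>z. e * (of_nat q :: complex) powr (- z))"
  have q0: "(of_nat q :: complex) \<noteq> 0" using q by simp
  have lnq: "Ln (of_nat q :: complex) \<noteq> 0"
  proof -
    have "Ln (complex_of_real (real q)) = complex_of_real (ln (real q))" using q by (intro Ln_of_real) simp
    moreover have "ln (real q) \<noteq> 0" using q by simp
    ultimately show ?thesis by (simp only: of_real_of_nat_eq of_real_eq_0_iff not_False_eq_True)
  qed
  have W: "W z = e * exp (- z * Ln (of_nat q))" for z using q0 by (simp add: W_def powr_def)
  have deriv: "(W has_field_derivative - (e * exp (- s * Ln (of_nat q)) * Ln (of_nat q))) (at s)"
  proof -
    have "W = (\<lambda>z. e * exp (- z * Ln (of_nat q)))" using W by auto
    thus ?thesis by (auto intro!: derivative_eq_intros)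
  qed
  have lim: "W \<midarrow>s\<rightarrow> W s" using DERIV_isCont[OF deriv] by (simp add: isCont_def)
  have "((\<lambda>z. (W z - W s) / (z - s)) \<longlongrightarrow> - (e * exp (- s * Ln (of_nat q)) * Ln (of_nat q))) (at s)"
    using deriv by (simp add: has_field_derivative_iff)
  hence "eventually (\<lambda>z. (W z - W s) / (z - s) \<noteq> 0) (at s)"
    by (rule tendsto_imp_eventually_ne) (use e lnq in simp)
  hence ne: "eventually (\<lambda>z. W z \<noteq> W s) (at s)" by (rule eventually_mono) simp
  hence fl: "filterlim W (at (W s)) (at s)" using lim ne by (simp add: filterlim_at)
  have "eventually (\<lambda>w. w \<notin> B) (at (W s))"
    using islimpt_finite[OF B, of "W s"] by (simp add: islimpt_iff_eventually)
  hence "eventually (\<lambda>z. W z \<notin> B) (at s)" using fl by (rule eventually_compose_filterlim)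
  hence ev: "eventually (\<lambda>z. H (W z) = \<Phi> (W z)) (at s)"
  proof eventually_elim
    case (elim z)
    have "W z \<noteq> 0" using e by (simp add: W)
    thus ?case using eq[OF elim] by simp
  qed
  have "(\<lambda>z. H (W z)) \<midarrow>s\<rightarrow> H (W s)"
    using cont lim unfolding W_def by (rule isCont_tendsto_compose)
  hence "(\<lambda>z. \<Phi> (W z)) \<midarrow>s\<rightarrow> H (W s)" using ev by (rule Lim_transform_eventually)
  thus "(\<lambda>z. \<Phi> (e * of_nat q powr (- z))) \<midarrow>s\<rightarrow> H (e * of_nat q powr (- s))" by (simp add: W_def)
qed

lemma finite_exceptional: "q > 0 \<Longrightarrow> finite {w::complex. of_nat q * w ^ 2 = 1}"
proof -
  assume "q > 0"
  hence "{w::complex. of_nat q * w ^ 2 = 1} = {w. w ^ 2 = 1 / of_nat q}" by (auto simp: field_simps)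
  thus ?thesis by (simp add: finite_nth_roots)
qed

lemma remove_sings_FJ1:
  assumes q: "q \<ge> 2" and e: "e \<noteq> 0" and v: "1 / (of_nat q * (e * of_nat q powr (- s))) \<noteq> 1"
  shows "remove_sings (\<lambda>z. FJ1 q g (e * of_nat q powr (- z))) s = HJ1 q g (e * of_nat q powr (- s))"
proof (rule remove_sings_powr[OF q e finite_exceptional[of q]])
  show "FJ1 q g w = HJ1 q g w" if "w \<notin> {w. of_nat q * w ^ 2 = 1}" for w
    using that by (intro FJ1_eq_HJ1) auto
  have "e * of_nat q powr (- s) \<noteq> 0" using e q by (simp add: powr_def)
  thus "isCont (HJ1 q g) (e * of_nat q powr (- s))"
    unfolding HJ1_def Let_def Zstar_def cfac_def using v q
    by (intro continuous_intros) auto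
qed (use q in simp)

lemma remove_sings_FJ2:
  assumes q: "q \<ge> 2" and e: "e \<noteq> 0" and g: "g \<ge> 1"
    and x: "of_nat q * (e * of_nat q powr (- s)) ^ 2 \<noteq> 1"
  shows "remove_sings (\<lambda>z. FJ2 q g (e * of_nat q powr (- z))) s = HJ2 q g (e * of_nat q powr (- s))"
proof (rule remove_sings_powr[OF q e, of "{w. of_nat q * w ^ 2 = 1} \<union> {1 / of_nat q}"])
  show "finite ({w::complex. of_nat q * w ^ 2 = 1} \<union> {1 / of_nat q})"
    using finite_exceptional[of q] q by simp
  show "FJ2 q g w = HJ2 q g w" if "w \<notin> {w. of_nat q * w ^ 2 = 1} \<union> {1 / of_nat q}" "w \<noteq> 0" for w
  proof (rule FJ2_eq_HJ2[OF q \<open>w \<noteq> 0\<close> _ g])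
    show "1 / (of_nat q * w) \<noteq> 1"
    proof
      assume "1 / (of_nat q * w) = 1"
      hence "of_nat q * w = 1" using \<open>w \<noteq> 0\<close> q by simp
      hence "w = 1 / of_nat q" using q by (simp add: eq_divide_eq mult.commute)
      thus False using that by simp
    qed
  qed (use that in auto)
  define w where "w = e * of_nat q powr (- s)"
  have w0: "w \<noteq> 0" using e q by (simp add: w_def powr_def)
  have q1: "(of_nat q :: complex) - 1 \<noteq> 0"
    using q by (metis One_nat_def Suc_1 eq_iff_diff_eq_0 not_less_eq_eq of_nat_1 of_nat_eq_iff order_refl)
  have "of_nat q * (1 / (of_nat q * w)) ^ 2 - 1 \<noteq> 0"
    using x w0 q unfolding w_def[symmetric] by (auto simp: power2_eq_square field_simps)
  thus "isCont (HJ2 q g) (e * of_nat q powr (- s))"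
    unfolding HJ2_def Let_def Rest2_def Msq_def dual_def w_def[symmetric] using w0 q1 q
    by (intro continuous_intros) auto
qed

section \<open>Error terms\<close>

definition rr :: "nat \<Rightarrow> complex \<Rightarrow> real" where
  "rr q s = real q powr (- Re s)"

text \<open>The error term expressed by g, up to constants depending on q; \<open>err_lower\<close>
  shows that it lies below \<open>err\<close>.\<close>

definition Gg :: "nat \<Rightarrow> complex \<Rightarrow> nat \<Rightarrow> real" where
  "Gg q s g = real q ^ g * (if Re s < 1 then (real q * rr q s) ^ g else real g + 1)"

text \<open>The tolerance for the main term: times |P| / log |P| it is at most a constant times
  \<open>Gg\<close>.\<close>

definition Dg :: "nat \<Rightarrow> complex \<Rightarrow> nat \<Rightarrow> real" where
  "Dg q s g = (if Re s < 1 then rr q s ^ g else (real g + 1) / real q ^ g)"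

lemma cmod_powr_rr: "cmod (of_nat q powr (- s)) = rr q s"
  by (subst norm_powr_real_powr) (auto simp: rr_def)

lemma rr_facts:
  assumes q: "q \<ge> 2" and s: "Re s \<ge> 1/2"
  shows "rr q s > 0" "real q * rr q s ^ 2 \<le> 1" "rr q s < 1"
    "Re s < 1 \<Longrightarrow> real q * rr q s > 1" "Re s \<ge> 1 \<Longrightarrow> real q * rr q s \<le> 1"
    "Re s \<ge> 3/2 \<Longrightarrow> real q ^ 3 * rr q s ^ 2 \<le> 1"
proof -
  have q1: "real q > 1" using q by simp
  show "rr q s > 0" using q by (simp add: rr_def)
  have p: "real q ^ k * rr q s ^ j = real q powr (real k - real j * Re s)" for k j
    using q1 by (simp add: rr_def powr_diff powr_realpow powr_minus powr_powr mult.commute field_simps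
      flip: powr_realpow[of "real q powr Re s"] powr_realpow[of "real q powr - Re s"])
  have le: "real q powr a \<le> 1" if "a \<le> 0" for a using powr_mono[OF that, of "real q"] q1 by simp
  show "real q * rr q s ^ 2 \<le> 1" using p[of 1 2] le[of "1 - 2 * Re s"] s by simp
  have "real q powr (- Re s) < real q powr 0" using q1 s by (intro powr_less_mono) auto
  thus "rr q s < 1" using q1 by (simp add: rr_def)
  show "real q * rr q s > 1" if "Re s < 1"
  proof -
    have "real q powr 0 < real q powr (1 - Re s)" using q1 that by (intro powr_less_mono) auto
    thus ?thesis using p[of 1 1] q1 by simp
  qed
  show "real q * rr q s \<le> 1" if "Re s \<ge> 1" using p[of 1 1] le[of "1 - Re s"] that by simp
  show "real q ^ 3 * rr q s ^ 2 \<le> 1" if "Re s \<ge> 3/2" using p[of 3 2] le[of "3 - 2 * Re s"] that by simp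
qed

lemma Gg_ge:
  assumes q: "q \<ge> 2" and s: "Re s \<ge> 1/2"
  shows "real q ^ g \<le> Gg q s g"
proof -
  have "1 \<le> (if Re s < 1 then (real q * rr q s) ^ g else real g + 1)"
    using rr_facts(4)[OF q s] by (auto intro: one_le_power)
  hence "real q ^ g * 1 \<le> Gg q s g" unfolding Gg_def by (intro mult_left_mono) auto
  thus ?thesis by simp
qed

lemma err_lower:
  assumes q: "q \<ge> 2" and s: "Re s \<ge> 1/2" and m: "2 * g < m"
  shows "Gg q s g \<le> cmod (err q s (q ^ m))"
proof (cases "Re s < 1")
  case True
  have q1: "real q > 1" using q by simp
  have "Gg q s g = (real q ^ 2 * rr q s) ^ g" using True by (simp add: Gg_def power_mult_distrib power2_eq_square)
  also have "real q ^ 2 * rr q s = real q powr (2 - Re s)"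
    using q1 by (simp add: rr_def powr_diff powr_minus field_simps powr_numeral)
  also have "(real q powr (2 - Re s)) ^ g = real q powr (real (2 * g) * (1 - Re s / 2))"
    using q1 by (simp add: powr_powr algebra_simps flip: powr_realpow[of "real q powr (2 - Re s)"])
  also have "\<dots> \<le> real q powr (real m * (1 - Re s / 2))"
    using q1 m True by (intro powr_mono mult_right_mono) auto
  also have "\<dots> = (real q ^ m) powr (1 - Re s / 2)"
    using q1 by (simp add: powr_powr flip: powr_realpow)
  also have "\<dots> = cmod (of_nat (q ^ m) powr (1 - s / 2))"
    by (subst norm_powr_real_powr) auto
  finally show ?thesis using True by (simp add: err_def)
next
  case False
  have q1: "real q > 1" using q by simp
  have l: "log (real q) (real (q ^ m)) = real m" using q1 by (simp add: log_nat_power)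
  have sq: "real q ^ g = real (q ^ (2 * g)) powr (1/2)"
    using q1 by (simp add: powr_powr flip: powr_realpow)
  have "real q ^ g * (real g + 1) \<le> real q ^ g * real m" using m by (intro mult_left_mono) auto
  also have "\<dots> \<le> real (q ^ m) powr (1/2) * real m"
    unfolding sq using q m by (intro mult_right_mono powr_mono2) (auto intro!: power_increasing)
  finally show ?thesis using False unfolding err_def Gg_def l by (simp add: norm_mult)
qed

lemma bigO_errI:
  assumes q: "q \<ge> 2" and s: "Re s \<ge> 1/2" and m: "\<And>g. 2 * g < m g" and C: "C \<ge> 0"
    and bound: "\<And>g. g \<ge> 1 \<Longrightarrow> cmod (f g) \<le> C * Gg q s g"
  shows "f \<in> O[at_top](\<lambda>g. err q s (q ^ m g))"
proof (rule bigoI[where c = C])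
  show "eventually (\<lambda>g. cmod (f g) \<le> C * cmod (err q s (q ^ m g))) at_top"
    using eventually_ge_at_top[of 1]
  proof eventually_elim
    case (elim g)
    have "C * Gg q s g \<le> C * cmod (err q s (q ^ m g))" using err_lower[OF q s m] C by (rule mult_left_mono)
    thus ?case using bound[OF elim] by linarith
  qed
qed

text \<open>With r = |w|, the lower half is a geometric sum of ratio q r. For Re s < 1 the ratio
  exceeds 1 and the last term dominates; for Re s \<ge> 1 there are g + 1 terms of size at most 1,
  the origin of the logarithm. The dual half is (q r)^g times a convergent series. K depends on s
  and grows without bound as Re s tends to 1 from below.\<close>

lemma dual_bound:
  assumes q: "q \<ge> 2" and s: "Re s \<ge> 1/2" and w: "cmod w = rr q s"
  shows "\<exists>K\<ge>0. \<forall>g A u. A \<ge> 0 \<longrightarrow> (\<forall>n\<le>g. cmod (u n) \<le> A * real q ^ n) \<longrightarrow>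
      real q ^ g * cmod (dual q g w u) \<le> A * K * Gg q s g"
proof -
  define r where "r = rr q s"
  note rf = rr_facts[OF q s, folded r_def]
  define E where "E = (\<lambda>g. if Re s < 1 then (real q * r) ^ g else real g + 1)"
  define K1 where "K1 = (if Re s < 1 then real q * r / (real q * r - 1) else 1)"
  have K1: "K1 \<ge> 0" using rf(4) by (auto simp: K1_def)
  have E1: "1 \<le> E g" for g using rf(4) by (auto simp: E_def intro: one_le_power)
  have first: "(\<Sum>n\<le>g. (real q * r) ^ n) \<le> K1 * E g" for g
  proof (cases "Re s < 1")
    case True
    hence p: "real q * r > 1" by (rule rf(4))
    have "(real q * r - 1) * (\<Sum>n\<le>g. (real q * r) ^ n) = (real q * r) ^ Suc g - 1"
      using power_diff_1_eq[of "real q * r" "Suc g"] by (simp only: lessThan_Suc_atMost)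
    also have "\<dots> \<le> (real q * r) * (real q * r) ^ g" by simp
    finally have "(\<Sum>n\<le>g. (real q * r) ^ n) \<le> (real q * r) * (real q * r) ^ g / (real q * r - 1)"
      using p by (simp add: pos_le_divide_eq mult.commute)
    thus ?thesis using True by (simp add: K1_def E_def)
  next
    case False
    hence p: "real q * r \<le> 1" using rf(5) by simp
    have "(\<Sum>n\<le>g. (real q * r) ^ n) \<le> (\<Sum>n\<le>g. 1)"
      using p rf(1) by (intro sum_mono power_le_one) auto
    thus ?thesis using False by (simp add: K1_def E_def)
  qed
  have second: "(\<Sum>k<g. real q ^ g * r ^ (2 * g - k)) \<le> 1 / (1 - r) * E g" for g
  proof -
    have "(\<Sum>k<g. real q ^ g * r ^ (2 * g - k)) = (\<Sum>k<g. (real q * r) ^ g * r ^ (g - k))"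
    proof (rule sum.cong)
      fix k assume "k \<in> {..<g}"
      hence "2 * g - k = g + (g - k)" by simp
      thus "real q ^ g * r ^ (2 * g - k) = (real q * r) ^ g * r ^ (g - k)"
        by (simp add: power_add power_mult_distrib)
    qed simp
    also have "\<dots> \<le> (\<Sum>k<g. (real q * r) ^ g * r ^ (g - Suc k))"
      using rf(1,3) by (intro sum_mono mult_left_mono power_decreasing) auto
    also have "\<dots> = (real q * r) ^ g * (\<Sum>k<g. r ^ k)"
      using sum.nat_diff_reindex[of "\<lambda>k. r ^ k" g] by (simp flip: sum_distrib_left)
    also have "\<dots> \<le> (real q * r) ^ g * (1 / (1 - r))"
    proof (intro mult_left_mono)
      have "(1 - r) * (\<Sum>k<g. r ^ k) = 1 - r ^ g" by (rule one_diff_power_eq[symmetric])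
      also have "\<dots> \<le> 1" using rf(1) by simp
      finally show "(\<Sum>k<g. r ^ k) \<le> 1 / (1 - r)" using rf(3) by (simp add: pos_le_divide_eq mult.commute)
    qed (use rf(1) in simp)
    also have "\<dots> \<le> E g * (1 / (1 - r))"
    proof (intro mult_right_mono)
      show "(real q * r) ^ g \<le> E g"
        using power_le_one[of "real q * r" g] rf(1,5) by (auto simp: E_def)
    qed (use rf(3) in simp)
    finally show ?thesis by (simp add: mult.commute)
  qed
  define K where "K = K1 + 1 / (1 - r)"
  have K: "K \<ge> 0" using K1 rf(3) by (simp add: K_def)
  show ?thesis
  proof (intro exI[of _ K] conjI allI impI K)
    fix g :: nat and A :: real and u :: "nat \<Rightarrow> complex"
    assume A: "A \<ge> 0" and u: "\<forall>n\<le>g. cmod (u n) \<le> A * real q ^ n"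
    have wr: "cmod w = r" using w by (simp add: r_def)
    have "cmod (dual q g w u) \<le> cmod (\<Sum>n\<le>g. u n * w ^ n) + cmod (\<Sum>k<g. of_nat q ^ (g - k) * u k * w ^ (2 * g - k))"
      unfolding dual_def by (rule norm_triangle_ineq)
    also have "cmod (\<Sum>n\<le>g. u n * w ^ n) \<le> (\<Sum>n\<le>g. A * (real q * r) ^ n)"
    proof (rule sum_norm_le)
      fix n assume "n \<in> {..g}"
      hence "cmod (u n) * r ^ n \<le> A * real q ^ n * r ^ n" using u rf(1) by (intro mult_right_mono) auto
      thus "cmod (u n * w ^ n) \<le> A * (real q * r) ^ n"
        by (simp add: norm_mult norm_power wr power_mult_distrib mult.assoc)
    qed
    also have "cmod (\<Sum>k<g. of_nat q ^ (g - k) * u k * w ^ (2 * g - k)) \<le> (\<Sum>k<g. A * (real q ^ g * r ^ (2 * g - k)))"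
    proof (rule sum_norm_le)
      fix k assume k: "k \<in> {..<g}"
      have "real q ^ (g - k) * cmod (u k) \<le> real q ^ (g - k) * (A * real q ^ k)"
        using u k by (intro mult_left_mono) auto
      also have "\<dots> = A * real q ^ g" using k by (simp flip: power_add)
      finally have "real q ^ (g - k) * cmod (u k) * r ^ (2 * g - k) \<le> A * real q ^ g * r ^ (2 * g - k)"
        using rf(1) by (intro mult_right_mono) auto
      thus "cmod (of_nat q ^ (g - k) * u k * w ^ (2 * g - k)) \<le> A * (real q ^ g * r ^ (2 * g - k))"
        by (simp add: norm_mult norm_power wr mult.assoc)
    qed
    also have "(\<Sum>n\<le>g. A * (real q * r) ^ n) + (\<Sum>k<g. A * (real q ^ g * r ^ (2 * g - k))) =
        A * ((\<Sum>n\<le>g. (real q * r) ^ n) + (\<Sum>k<g. real q ^ g * r ^ (2 * g - k)))"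
      by (simp add: distrib_left flip: sum_distrib_left)
    also have "\<dots> \<le> A * (K1 * E g + 1 / (1 - r) * E g)"
      using first[of g] second[of g] A by (intro mult_left_mono add_mono) auto
    also have "\<dots> = A * K * E g" by (simp add: K_def algebra_simps)
    finally have "cmod (dual q g w u) \<le> A * K * E g" by simp
    hence "real q ^ g * cmod (dual q g w u) \<le> real q ^ g * (A * K * E g)" by (rule mult_left_mono) simp
    moreover have "Gg q s g = real q ^ g * E g" by (simp add: Gg_def E_def r_def)
    ultimately show "real q ^ g * cmod (dual q g w u) \<le> A * K * Gg q s g" by (simp only: mult_ac)
  qed
qed

text \<open>Three errors add up: the character sums (A), the number of primes against |P| / log |P|,
  and the exact main term M against the stated one (K). In the second, the prime count is off by
  O(q^g / m), so a main term of size O(g) does no harm.\<close>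

lemma core_asymptotic:
  assumes q: "q \<ge> 2" and s: "Re s \<ge> 1/2" and m: "\<And>g. 2 * g < m g" "\<And>g. m g \<le> 2 * g + 2"
    and N: "\<And>g. real (m g) * N g \<le> real q ^ m g" "\<And>g. real q ^ m g \<le> real (m g) * N g + 2 * real q ^ (g + 1)"
    and A: "A \<ge> 0" "\<And>g. g \<ge> 1 \<Longrightarrow> cmod (L g - of_real (N g) * M g) \<le> A * Gg q s g"
    and M: "\<And>g. g \<ge> 1 \<Longrightarrow> cmod (M g) \<le> 8 * (real g + 1)"
    and K: "K \<ge> 0" "\<And>g. g \<ge> 1 \<Longrightarrow> cmod (M g - Main g) \<le> K * Dg q s g"
  shows "(\<lambda>g. L g - Main g * N_over_log q (q ^ m g)) \<in> O[at_top](\<lambda>g. err q s (q ^ m g))"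
proof (rule bigO_errI[OF q s m(1), where C = "A + 16 * real q + K * real q ^ 2"])
  show "0 \<le> A + 16 * real q + K * real q ^ 2" using A K by simp
  fix g :: nat assume g: "g \<ge> 1"
  have q1: "real q > 1" using q by simp
  have m0: "real (m g) > 0" "real (m g) \<ge> real g + 1" using m(1)[of g] by auto
  define R where "R = real q ^ m g / real (m g)"
  have NL: "N_over_log q (q ^ m g) = of_real R"
    using q1 by (simp add: N_over_log_def R_def log_nat_power)
  have NR: "\<bar>N g - R\<bar> \<le> 2 * real q ^ (g + 1) / real (m g)"
  proof -
    have "real (m g) * \<bar>N g - R\<bar> = \<bar>real (m g) * N g - real q ^ m g\<bar>"
      using m0 by (simp add: R_def abs_mult_pos' right_diff_distrib flip: abs_mult_pos)
    also have "\<dots> \<le> 2 * real q ^ (g + 1)" using N[of g] by linarith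
    finally show ?thesis using m0 by (simp add: pos_le_divide_eq mult.commute)
  qed
  have "L g - Main g * of_real R = (L g - of_real (N g) * M g) + of_real (N g - R) * M g + of_real R * (M g - Main g)"
    by (simp add: algebra_simps)
  also have "cmod \<dots> \<le> cmod (L g - of_real (N g) * M g) + cmod (of_real (N g - R) * M g) + cmod (of_real R * (M g - Main g))"
    by (intro order.trans[OF norm_triangle_ineq] add_mono norm_triangle_ineq order.refl)
  also have "\<dots> \<le> A * Gg q s g + 16 * real q * Gg q s g + K * real q ^ 2 * Gg q s g"
  proof (intro add_mono)
    show "cmod (L g - of_real (N g) * M g) \<le> A * Gg q s g" by (rule A(2)[OF g])
    have "cmod (of_real (N g - R) * M g) = \<bar>N g - R\<bar> * cmod (M g)" by (simp only: norm_mult norm_of_real)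
    also have "\<dots> \<le> 2 * real q ^ (g + 1) / real (m g) * (8 * (real g + 1))"
      using NR M[OF g] by (intro mult_mono) auto
    also have "\<dots> = 16 * real q * real q ^ g * ((real g + 1) / real (m g))" by simp
    also have "\<dots> \<le> 16 * real q * real q ^ g * 1"
      using m0 by (intro mult_left_mono) auto
    also have "\<dots> \<le> 16 * real q * Gg q s g" using Gg_ge[OF q s, of g] by (simp add: mult_left_mono)
    finally show "cmod (of_real (N g - R) * M g) \<le> 16 * real q * Gg q s g" .
    have R0: "R \<ge> 0" by (simp add: R_def)
    have qm: "real q ^ m g \<le> real q ^ (2 * g + 2)" using m(2)[of g] q1 by (intro power_increasing) auto
    have D: "R * Dg q s g \<le> real q ^ 2 * Gg q s g"
    proof (cases "Re s < 1")
      case True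
      have "R \<le> real q ^ m g" using m0 by (simp add: R_def pos_divide_le_eq mult_le_cancel_left1)
      hence "R * rr q s ^ g \<le> real q ^ (2 * g + 2) * rr q s ^ g"
        using qm rr_facts(1)[OF q s] by (intro mult_right_mono) auto
      also have "\<dots> = real q ^ 2 * Gg q s g"
        using True by (simp add: Gg_def power_mult_distrib power_add mult_2 power2_eq_square)
      finally show ?thesis using True by (simp add: Dg_def)
    next
      case False
      have "R * Dg q s g = real q ^ m g / real q ^ g * ((real g + 1) / real (m g))"
        using False by (simp add: R_def Dg_def)
      also have "\<dots> \<le> real q ^ (2 * g + 2) / real q ^ g * 1"
        using qm m0 q1 by (intro mult_mono divide_right_mono) auto
      also have "\<dots> = real q ^ 2 * real q ^ g"
        using q1 by (simp add: power_add mult_2 power2_eq_square)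
      also have "\<dots> \<le> real q ^ 2 * Gg q s g" using Gg_ge[OF q s, of g] by (intro mult_left_mono) auto
      finally show ?thesis .
    qed
    have "cmod (of_real R * (M g - Main g)) = R * cmod (M g - Main g)" using R0 by (simp add: norm_mult)
    also have "\<dots> \<le> R * (K * Dg q s g)" using K(2)[OF g] R0 by (rule mult_left_mono)
    also have "\<dots> = K * (R * Dg q s g)" by simp
    also have "\<dots> \<le> K * (real q ^ 2 * Gg q s g)" using D K(1) by (rule mult_left_mono)
    finally show "cmod (of_real R * (M g - Main g)) \<le> K * real q ^ 2 * Gg q s g" by (simp add: mult.assoc)
  qed
  finally show "cmod (L g - Main g * N_over_log q (q ^ m g)) \<le> (A + 16 * real q + K * real q ^ 2) * Gg q s g"
    unfolding NL by (simp add: algebra_simps)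
qed

lemma geometric_tail:
  fixes S x y :: complex
  assumes "(1 - x) * S = 1 - y" "1 - x \<noteq> 0"
  shows "S - 1 / (1 - x) = - (y / (1 - x))"
proof -
  have "S = (1 - y) / (1 - x)" using assms by (simp add: eq_divide_eq mult.commute)
  thus ?thesis by (simp add: diff_divide_distrib)
qed

lemma power_mult_le_1:
  fixes q r :: real
  assumes "q \<ge> 0" "0 \<le> r" "r \<le> 1" "q * r ^ 2 \<le> 1" "2 * e \<le> n"
  shows "q ^ e * r ^ n \<le> 1"
proof -
  have "q ^ e * r ^ n \<le> q ^ e * r ^ (2 * e)" using assms by (intro mult_left_mono power_decreasing) auto
  also have "\<dots> = (q * r ^ 2) ^ e" by (simp add: power_mult_distrib power_mult)
  also have "\<dots> \<le> 1" using assms by (intro power_le_one) auto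
  finally show ?thesis .
qed

lemma Sq_le: "q \<ge> 2 \<Longrightarrow> real (Sq q n) \<le> 2 * real q ^ (n div 2)"
proof -
  assume q: "q \<ge> 2"
  have "(real q - 1) * real (Sq q n) = real q * real q ^ (n div 2) - 1"
    using Sq_closed[of q n, where ?'b = real] by simp
  also have "\<dots> \<le> (2 * (real q - 1)) * real q ^ (n div 2) "
  proof -
    have "real q * real q ^ (n div 2) \<le> (2 * (real q - 1)) * real q ^ (n div 2)"
      using q by (intro mult_right_mono) auto
    thus ?thesis by linarith
  qed
  finally have "(real q - 1) * real (Sq q n) \<le> (real q - 1) * (2 * real q ^ (n div 2))" by (simp only: mult_ac)
  thus ?thesis using q by simp
qed

text \<open>As |q w^2| \<le> 1, a term q^e w^n with 2 e \<le> n is at most 1. There are 2g + 1 terms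
  of size at most 2, and |1 - w| \<le> 2.\<close>

lemma Msq_bound:
  assumes q: "q \<ge> 2" and s: "Re s \<ge> 1/2" and w: "cmod w = rr q s"
  shows "cmod (Msq q g w) \<le> 8 * (real g + 1)"
proof -
  note rf = rr_facts[OF q s]
  have le1: "real q ^ e * rr q s ^ n \<le> 1" if "2 * e \<le> n" for e n
    using rf that by (intro power_mult_le_1) auto
  have "cmod (dual q g w (\<lambda>n. of_nat (Sq q n))) \<le> cmod (\<Sum>n\<le>g. of_nat (Sq q n) * w ^ n)
      + cmod (\<Sum>k<g. of_nat q ^ (g - k) * of_nat (Sq q k) * w ^ (2 * g - k))"
    unfolding dual_def by (rule norm_triangle_ineq)
  also have "cmod (\<Sum>n\<le>g. of_nat (Sq q n) * w ^ n) \<le> (\<Sum>n\<le>g. 2)"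
  proof (rule sum_norm_le)
    fix n
    have "real (Sq q n) * rr q s ^ n \<le> 2 * real q ^ (n div 2) * rr q s ^ n"
      using Sq_le[OF q] rf(1) by (intro mult_right_mono) auto
    also have "\<dots> \<le> 2" using le1[of "n div 2" n] by simp
    finally show "cmod (of_nat (Sq q n) * w ^ n) \<le> 2" by (simp add: norm_mult norm_power w)
  qed
  also have "cmod (\<Sum>k<g. of_nat q ^ (g - k) * of_nat (Sq q k) * w ^ (2 * g - k)) \<le> (\<Sum>k<g. 2)"
  proof (rule sum_norm_le)
    fix k assume k: "k \<in> {..<g}"
    have "real q ^ (g - k) * real (Sq q k) * rr q s ^ (2 * g - k) \<le>
        real q ^ (g - k) * (2 * real q ^ (k div 2)) * rr q s ^ (2 * g - k)"
      using Sq_le[OF q] rf(1) by (intro mult_right_mono mult_left_mono) auto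
    also have "\<dots> = 2 * (real q ^ (g - k + k div 2) * rr q s ^ (2 * g - k))" by (simp add: power_add)
    also have "\<dots> \<le> 2" using le1[of "g - k + k div 2" "2 * g - k"] k by simp
    finally show "cmod (of_nat q ^ (g - k) * of_nat (Sq q k) * w ^ (2 * g - k)) \<le> 2"
      by (simp add: norm_mult norm_power w)
  qed
  finally have "cmod (dual q g w (\<lambda>n. of_nat (Sq q n))) \<le> 4 * (real g + 1)" by simp
  moreover have "cmod (1 - w) \<le> 2" using norm_triangle_ineq4[of 1 w] w rf(3) by simp
  ultimately have "cmod (1 - w) * cmod (dual q g w (\<lambda>n. of_nat (Sq q n))) \<le> 2 * (4 * (real g + 1))"
    by (intro mult_mono) auto
  thus ?thesis by (simp add: Msq_def norm_mult)
qed

lemma card_monic_irreds_real: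
  assumes "m > 0" "m \<le> 2 * g + 2"
  shows "real m * real (card (monic_irreds m :: 'a::{field,finite} poly set)) \<le> real CARD('a) ^ m"
    and "real CARD('a) ^ m \<le> real m * real (card (monic_irreds m :: 'a poly set)) + 2 * real CARD('a) ^ (g + 1)"
proof -
  note c = card_monic_irreds_bounds[OF assms(1), where 'a = 'a]
  show "real m * real (card (monic_irreds m :: 'a poly set)) \<le> real CARD('a) ^ m"
    using c(1) by (metis of_nat_le_iff of_nat_mult of_nat_power)
  have "CARD('a) ^ (m div 2) \<le> CARD('a) ^ (g + 1)" using assms by (intro power_increasing) auto
  hence "CARD('a) ^ m \<le> m * card (monic_irreds m :: 'a poly set) + 2 * CARD('a) ^ (g + 1)" using c(2) by linarith
  hence "real (CARD('a) ^ m) \<le> real (m * card (monic_irreds m :: 'a poly set) + 2 * CARD('a) ^ (g + 1))"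
    by (simp only: of_nat_le_iff)
  thus "real CARD('a) ^ m \<le> real m * real (card (monic_irreds m :: 'a poly set)) + 2 * real CARD('a) ^ (g + 1)" by simp
qed

lemma card_ge_2: "CARD('a::{field,finite}) \<ge> 2"
  using card_gt_1[where 'a = 'a] by simp

lemma sum_chi_sum_bound_complex:
  assumes odd: "odd CARD('a::{field,finite})" and m: "2 * g < m" "m \<le> 2 * g + 2" and n: "n \<le> g"
  shows "cmod (of_int (\<Sum>P\<in>(monic_irreds m :: 'a poly set). chi_sum P n) -
      of_nat (card (monic_irreds m :: 'a poly set)) * of_nat (sqc CARD('a) n)) \<le> 13 * real CARD('a) ^ (g + 2) * real CARD('a) ^ n"
proof -
  define z where "z = (\<Sum>P\<in>(monic_irreds m :: 'a poly set). chi_sum P n) -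
      int (card (monic_irreds m :: 'a poly set)) * int (sqc CARD('a) n)"
  have "\<bar>z\<bar> \<le> 13 * int (CARD('a) ^ (g + 2)) * int (CARD('a) ^ n)"
    unfolding z_def by (rule sum_chi_sum_bound[OF odd m n])
  hence "real_of_int \<bar>z\<bar> \<le> real_of_int (13 * int (CARD('a) ^ (g + 2)) * int (CARD('a) ^ n))"
    by (simp only: of_int_le_iff)
  moreover have "of_int (\<Sum>P\<in>(monic_irreds m :: 'a poly set). chi_sum P n) -
      of_nat (card (monic_irreds m :: 'a poly set)) * of_nat (sqc CARD('a) n) = (of_int z :: complex)"
    by (simp add: z_def)
  moreover have "cmod (of_int z) = real_of_int \<bar>z\<bar>" by simp
  ultimately show ?thesis by simp
qed

lemma asymptotic_odd:
  fixes s w :: complex and Main :: "nat \<Rightarrow> complex"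
  assumes odd: "odd CARD('a::{field,finite})" and s: "Re s \<ge> 1/2" and w: "cmod w = rr CARD('a) s"
    and K: "K \<ge> 0" "\<And>g. g \<ge> 1 \<Longrightarrow> cmod ((\<Sum>j\<le>g. (of_nat CARD('a) * w ^ 2) ^ j) - Main g) \<le> K * Dg CARD('a) s g"
  shows "(\<lambda>g. (\<Sum>P\<in>(monic_irreds (2 * g + 1) :: 'a poly set). \<Sum>n<2 * g + 1. of_int (chi_sum P n) * w ^ n)
       - Main g * N_over_log CARD('a) (CARD('a) ^ (2 * g + 1))) \<in> O[at_top](\<lambda>g. err CARD('a) s (CARD('a) ^ (2 * g + 1)))"
proof -
  let ?q = "CARD('a)"
  have q: "?q \<ge> 2" by (rule card_ge_2)
  obtain C where C: "C \<ge> 0" "\<And>g A u. A \<ge> 0 \<Longrightarrow> (\<And>n. n \<le> g \<Longrightarrow> cmod (u n) \<le> A * real ?q ^ n) \<Longrightarrow>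
      real ?q ^ g * cmod (dual ?q g w u) \<le> A * C * Gg ?q s g"
    using dual_bound[OF q s w] by blast
  show ?thesis
  proof (rule core_asymptotic[OF q s, where N = "\<lambda>g. real (card (monic_irreds (2 * g + 1) :: 'a poly set))"
        and M = "\<lambda>g. \<Sum>j\<le>g. (of_nat ?q * w ^ 2) ^ j" and A = "13 * real ?q ^ 2 * C" and K = K])
    show "real (2 * g + 1) * real (card (monic_irreds (2 * g + 1) :: 'a poly set)) \<le> real ?q ^ (2 * g + 1)" for g
      by (rule card_monic_irreds_real(1)[of _ g]) auto
    show "real ?q ^ (2 * g + 1) \<le> real (2 * g + 1) * real (card (monic_irreds (2 * g + 1) :: 'a poly set)) + 2 * real ?q ^ (g + 1)" for g
      by (rule card_monic_irreds_real(2)) auto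
    show "cmod (\<Sum>j\<le>g. (of_nat ?q * w ^ 2) ^ j) \<le> 8 * (real g + 1)" for g
    proof -
      have "cmod (of_nat ?q * w ^ 2) \<le> 1" using rr_facts(2)[OF q s] by (simp add: norm_mult norm_power w)
      hence "cmod (\<Sum>j\<le>g. (of_nat ?q * w ^ 2) ^ j) \<le> (\<Sum>j\<le>g. 1)"
        by (intro sum_norm_le) (simp add: norm_power power_le_one)
      thus ?thesis by simp
    qed
    fix g :: nat
    define T where "T = (\<lambda>n. \<Sum>P\<in>(monic_irreds (2 * g + 1) :: 'a poly set). chi_sum P n)"
    define N where "N = (of_nat (card (monic_irreds (2 * g + 1) :: 'a poly set)) :: complex)"
    have "(\<Sum>P\<in>(monic_irreds (2 * g + 1) :: 'a poly set). \<Sum>n<2 * g + 1. of_int (chi_sum P n) * w ^ n)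
        - of_real (real (card (monic_irreds (2 * g + 1) :: 'a poly set))) * (\<Sum>j\<le>g. (of_nat ?q * w ^ 2) ^ j)
        = dual ?q g w (\<lambda>n. of_int (T n)) + dual ?q g w (\<lambda>n. - N * of_nat (sqc ?q n))"
      unfolding dual_cmult sum_L_odd[OF odd] dual_sqc T_def N_def by simp
    also have "\<dots> = dual ?q g w (\<lambda>n. of_int (T n) - N * of_nat (sqc ?q n))"
      unfolding dual_add[symmetric] by simp
    finally have eq: "(\<Sum>P\<in>(monic_irreds (2 * g + 1) :: 'a poly set). \<Sum>n<2 * g + 1. of_int (chi_sum P n) * w ^ n)
        - of_real (real (card (monic_irreds (2 * g + 1) :: 'a poly set))) * (\<Sum>j\<le>g. (of_nat ?q * w ^ 2) ^ j)
        = dual ?q g w (\<lambda>n. of_int (T n) - N * of_nat (sqc ?q n))" .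
    have "real ?q ^ g * cmod (dual ?q g w (\<lambda>n. of_int (T n) - N * of_nat (sqc ?q n))) \<le> 13 * real ?q ^ (g + 2) * C * Gg ?q s g"
    proof (rule C(2))
      fix n assume "n \<le> g"
      thus "cmod (of_int (T n) - N * of_nat (sqc ?q n)) \<le> 13 * real ?q ^ (g + 2) * real ?q ^ n"
        unfolding T_def N_def by (intro sum_chi_sum_bound_complex[OF odd]) auto
    qed simp
    also have "\<dots> = real ?q ^ g * (13 * real ?q ^ 2 * C * Gg ?q s g)" by (simp add: power_add power2_eq_square)
    finally show "cmod ((\<Sum>P\<in>(monic_irreds (2 * g + 1) :: 'a poly set). \<Sum>n<2 * g + 1. of_int (chi_sum P n) * w ^ n)
        - of_real (real (card (monic_irreds (2 * g + 1) :: 'a poly set))) * (\<Sum>j\<le>g. (of_nat ?q * w ^ 2) ^ j))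
        \<le> 13 * real ?q ^ 2 * C * Gg ?q s g"
      unfolding eq using q by (simp add: mult_le_cancel_left_pos)
  qed (use C K in auto)
qed

text \<open>As in odd degree, but with partial sums: summing the coefficient errors geometrically
  doubles the constant 13, and the factor 1 - w doubles it once more.\<close>

lemma asymptotic_even:
  fixes s w :: complex and Main :: "nat \<Rightarrow> complex"
  assumes odd: "odd CARD('a::{field,finite})" and s: "Re s \<ge> 1/2" and w: "cmod w = rr CARD('a) s"
    and K: "K \<ge> 0" "\<And>g. g \<ge> 1 \<Longrightarrow> cmod (Msq CARD('a) g w - Main g) \<le> K * Dg CARD('a) s g"
  shows "(\<lambda>g. (\<Sum>P\<in>(monic_irreds (2 * g + 2) :: 'a poly set). \<Sum>n<2 * g + 2. of_int (chi_sum P n) * w ^ n)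
       - Main g * N_over_log CARD('a) (CARD('a) ^ (2 * g + 2))) \<in> O[at_top](\<lambda>g. err CARD('a) s (CARD('a) ^ (2 * g + 2)))"
proof -
  let ?q = "CARD('a)"
  have q: "?q \<ge> 2" by (rule card_ge_2)
  obtain C where C: "C \<ge> 0" "\<And>g A u. A \<ge> 0 \<Longrightarrow> (\<And>n. n \<le> g \<Longrightarrow> cmod (u n) \<le> A * real ?q ^ n) \<Longrightarrow>
      real ?q ^ g * cmod (dual ?q g w u) \<le> A * C * Gg ?q s g"
    using dual_bound[OF q s w] by blast
  have geo: "(\<Sum>j\<le>n. real ?q ^ j) \<le> 2 * real ?q ^ n" for n
  proof (induction n)
    case (Suc n)
    have "2 * real ?q ^ n \<le> real ?q * real ?q ^ n" using q by (intro mult_right_mono) auto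
    moreover have "(\<Sum>j\<le>Suc n. real ?q ^ j) = (\<Sum>j\<le>n. real ?q ^ j) + real ?q * real ?q ^ n" by simp
    ultimately show ?case using Suc unfolding power_Suc by linarith
  qed simp
  show ?thesis
  proof (rule core_asymptotic[OF q s, where N = "\<lambda>g. real (card (monic_irreds (2 * g + 2) :: 'a poly set))"
        and M = "\<lambda>g. Msq ?q g w" and A = "52 * real ?q ^ 2 * C" and K = K])
    show "real (2 * g + 2) * real (card (monic_irreds (2 * g + 2) :: 'a poly set)) \<le> real ?q ^ (2 * g + 2)" for g
      by (rule card_monic_irreds_real(1)[of _ g]) auto
    show "real ?q ^ (2 * g + 2) \<le> real (2 * g + 2) * real (card (monic_irreds (2 * g + 2) :: 'a poly set)) + 2 * real ?q ^ (g + 1)" for g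
      by (rule card_monic_irreds_real(2)) auto
    show "cmod (Msq ?q g w) \<le> 8 * (real g + 1)" for g by (rule Msq_bound[OF q s w])
    fix g :: nat
    define T where "T = (\<lambda>n. \<Sum>P\<in>(monic_irreds (2 * g + 2) :: 'a poly set). chi_sum P n)"
    define N where "N = (of_nat (card (monic_irreds (2 * g + 2) :: 'a poly set)) :: complex)"
    define U where "U = (\<lambda>n. \<Sum>j\<le>n. of_int (T j) - N * of_nat (sqc ?q j))"
    have U: "U n = (\<Sum>j\<le>n. of_int (T j)) + - N * of_nat (Sq ?q n)" for n
      by (simp add: U_def Sq_def sum_subtractf sum_distrib_left sum_negf)
    have eq: "(\<Sum>P\<in>(monic_irreds (2 * g + 2) :: 'a poly set). \<Sum>n<2 * g + 2. of_int (chi_sum P n) * w ^ n)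
        - of_real (real (card (monic_irreds (2 * g + 2) :: 'a poly set))) * Msq ?q g w = (1 - w) * dual ?q g w U"
      unfolding U dual_add dual_cmult sum_L_even[OF odd] Msq_def T_def N_def by (simp add: algebra_simps)
    have "real ?q ^ g * cmod (dual ?q g w U) \<le> 26 * real ?q ^ (g + 2) * C * Gg ?q s g"
    proof (rule C(2))
      fix n assume n: "n \<le> g"
      have "cmod (U n) \<le> (\<Sum>j\<le>n. 13 * real ?q ^ (g + 2) * real ?q ^ j)"
        unfolding U_def
      proof (rule sum_norm_le)
        fix j assume "j \<in> {..n}"
        thus "cmod (of_int (T j) - N * of_nat (sqc ?q j)) \<le> 13 * real ?q ^ (g + 2) * real ?q ^ j"
          unfolding T_def N_def using n by (intro sum_chi_sum_bound_complex[OF odd]) auto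
      qed
      also have "\<dots> = 13 * real ?q ^ (g + 2) * (\<Sum>j\<le>n. real ?q ^ j)" by (simp only: sum_distrib_left)
      also have "\<dots> \<le> 13 * real ?q ^ (g + 2) * (2 * real ?q ^ n)" using geo by (intro mult_left_mono) auto
      finally show "cmod (U n) \<le> 26 * real ?q ^ (g + 2) * real ?q ^ n" by simp
    qed simp
    also have "\<dots> = real ?q ^ g * (26 * real ?q ^ 2 * C * Gg ?q s g)" by (simp add: power_add power2_eq_square)
    finally have d: "cmod (dual ?q g w U) \<le> 26 * real ?q ^ 2 * C * Gg ?q s g"
      using q by (simp add: mult_le_cancel_left_pos)
    have "cmod (1 - w) \<le> 2" using norm_triangle_ineq4[of 1 w] w rr_facts(3)[OF q s] by simp
    hence "cmod (1 - w) * cmod (dual ?q g w U) \<le> 2 * (26 * real ?q ^ 2 * C * Gg ?q s g)"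
      using d by (intro mult_mono) auto
    thus "cmod ((\<Sum>P\<in>(monic_irreds (2 * g + 2) :: 'a poly set). \<Sum>n<2 * g + 2. of_int (chi_sum P n) * w ^ n)
        - of_real (real (card (monic_irreds (2 * g + 2) :: 'a poly set))) * Msq ?q g w)
        \<le> 52 * real ?q ^ 2 * C * Gg ?q s g"
      unfolding eq norm_mult by simp
  qed (use C K in auto)
qed

section \<open>Exact main terms against the stated ones\<close>

lemma cmod_q_minus_1: "q \<ge> 2 \<Longrightarrow> cmod (of_nat q - 1) = real q - 1"
proof -
  assume q: "q \<ge> 2"
  have "(of_nat q - 1 :: complex) = of_real (real q - 1)" by simp
  hence "cmod (of_nat q - 1) = \<bar>real q - 1\<bar>" by (simp only: norm_of_real)
  thus ?thesis using q by simp
qed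

text \<open>For Re s \<ge> 1 one has |q w^2| \<le> 1/q, so the tail of the geometric series is
  O(q^(-g)). This is why I_g loses its second term there.\<close>

lemma odd_estimate_ge1:
  assumes q: "q \<ge> 2" and s: "Re s \<ge> 1" and w: "cmod w = rr q s"
  shows "cmod ((\<Sum>j\<le>g. (of_nat q * w ^ 2) ^ j) - 1 / (1 - of_nat q * w ^ 2)) \<le> 2 * Dg q s g"
proof -
  define x where "x = of_nat q * w ^ 2"
  have s': "Re s \<ge> 1/2" using s by simp
  note rf = rr_facts[OF q s']
  have "cmod x = (real q * rr q s) * rr q s" by (simp add: x_def norm_mult norm_power w power2_eq_square)
  also have "\<dots> \<le> 1 * rr q s" using rf(1,5) s by (intro mult_right_mono) auto
  also have "rr q s \<le> 1 / real q" using rf(5)[OF s] q by (simp add: field_simps)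
  finally have x: "cmod x \<le> 1 / real q" by simp
  also have "\<dots> \<le> 1 / 2" using q by (simp add: field_simps)
  finally have x2: "cmod x \<le> 1 / 2" .
  have nx: "cmod (1 - x) \<ge> 1 / 2" using norm_triangle_ineq2[of 1 x] x2 by simp
  hence x1: "1 - x \<noteq> 0" by auto
  have "(1 - x) * (\<Sum>j\<le>g. x ^ j) = 1 - x ^ Suc g"
    using one_diff_power_eq[of x "Suc g"] by (simp only: lessThan_Suc_atMost)
  hence "(\<Sum>j\<le>g. x ^ j) - 1 / (1 - x) = - (x ^ Suc g / (1 - x))" using x1 by (rule geometric_tail)
  hence "cmod ((\<Sum>j\<le>g. x ^ j) - 1 / (1 - x)) = cmod x ^ Suc g / cmod (1 - x)"
    by (simp only: norm_minus_cancel norm_divide norm_power)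
  also have "\<dots> \<le> cmod x ^ Suc g / (1 / 2)" using nx by (intro divide_left_mono) auto
  also have "\<dots> \<le> 2 * cmod x ^ g" using x2 by (simp add: mult_left_le_one_le)
  also have "\<dots> \<le> 2 * (1 / real q) ^ g" using x by (intro mult_left_mono power_mono) auto
  also have "\<dots> \<le> 2 * Dg q s g" using s q by (simp add: Dg_def power_one_over field_simps)
  finally show ?thesis by (simp add: x_def)
qed

text \<open>For Re s < 1 one has |q w| > 1, so cfac is regular at w, and the boundary terms in
  \<open>Msq_minus_HJ1\<close> are of order |w|^g.\<close>

lemma even_estimate_lt1:
  assumes q: "q \<ge> 2" and s: "Re s \<ge> 1/2" "Re s < 1" and w: "cmod w = rr q s" and g: "g \<ge> 1"
  shows "cmod (Msq q g w - HJ1 q g w) \<le> (1 + cmod (cfac q w)) * Dg q s g"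
    and "1 / (of_nat q * w) \<noteq> 1"
proof -
  note rf = rr_facts[OF q s(1)]
  have w0: "w \<noteq> 0" using w rf(1) by auto
  have "cmod (of_nat q * w) > 1" using rf(4)[OF s(2)] by (simp add: norm_mult w)
  thus v: "1 / (of_nat q * w) \<noteq> 1" by auto
  have "cmod (Msq q g w - HJ1 q g w) = cmod (w ^ (g + 1) + cfac q w * w ^ g) / (real q - 1)"
    unfolding Msq_minus_HJ1[OF q w0 v g] norm_divide cmod_q_minus_1[OF q] ..
  also have "\<dots> \<le> cmod (w ^ (g + 1) + cfac q w * w ^ g) / 1"
    using q by (intro divide_left_mono) auto
  also have "\<dots> \<le> cmod (w ^ (g + 1)) + cmod (cfac q w * w ^ g)" by (simp add: norm_triangle_ineq del: power_Suc)
  also have "cmod (w ^ (g + 1)) \<le> rr q s ^ g"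
    using rf(1,3) by (simp add: norm_mult norm_power w mult_left_le_one_le)
  also have "cmod (cfac q w * w ^ g) = cmod (cfac q w) * rr q s ^ g" by (simp add: norm_mult norm_power w)
  finally show "cmod (Msq q g w - HJ1 q g w) \<le> (1 + cmod (cfac q w)) * Dg q s g"
    using s by (simp add: Dg_def algebra_simps)
qed

text \<open>Now V = |v| \<ge> 1 and the geometric sums in \<open>Rest2\<close> may grow like (g + 2)
  V^(g+2). But |q w^2| V = |w|, so the factor x^g reduces this to order g |w|^g, and |w| \<le>
  1/q.\<close>

lemma even_estimate_ge1:
  assumes q: "q \<ge> 2" and s: "Re s \<ge> 1" and w: "cmod w = rr q s"
  shows "\<exists>K\<ge>0. \<forall>g. cmod (Msq q g w - HJ2 q g w) \<le> K * Dg q s g"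
proof -
  have s': "Re s \<ge> 1/2" using s by simp
  note rf = rr_facts[OF q s']
  define v where "v = 1 / (of_nat q * w)"
  define d where "d = (of_nat q * v ^ 2 - 1) * (of_nat q - 1 :: complex)"
  define V where "V = cmod v"
  have w0: "w \<noteq> 0" using w rf(1) by auto
  have Vr: "V = 1 / (real q * rr q s)" by (simp add: V_def v_def norm_divide norm_mult w)
  have "real q * rr q s > 0" using rf(1) q by simp
  hence V1: "V \<ge> 1" using rf(5)[OF s] by (simp add: Vr)
  have xV: "cmod (of_nat q * w ^ 2) * V = rr q s"
    using rf(1) q by (simp add: Vr norm_mult norm_power w power2_eq_square)
  have rq: "rr q s \<le> 1 / real q" using rf(5)[OF s] q by (simp add: field_simps)
  have rg: "rr q s ^ g \<le> 1 / real q ^ g" for g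
    using power_mono[OF rq, of g] rf(1) by (simp add: power_one_over)
  define K where "K = 1 + 4 * (real q + 1) * V ^ 2 / cmod d"
  have K0: "K \<ge> 0" by (simp add: K_def)
  show ?thesis
  proof (intro exI[of _ K] conjI allI K0)
    fix g
    define B where "B = of_nat q * (\<Sum>i<g + 2. v ^ i) - (\<Sum>i<g. v ^ i)"
    have sumV: "cmod (\<Sum>i<n. v ^ i) \<le> (real g + 2) * V ^ (g + 2)" if "n \<le> g + 2" for n
    proof -
      have "cmod (\<Sum>i<n. v ^ i) \<le> (\<Sum>i<n. V ^ (g + 2))"
      proof (rule sum_norm_le)
        fix i assume "i \<in> {..<n}"
        thus "cmod (v ^ i) \<le> V ^ (g + 2)"
          unfolding norm_power V_def[symmetric] using V1 that by (intro power_increasing) auto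
      qed
      also have "\<dots> \<le> (real g + 2) * V ^ (g + 2)"
        using V1 that by (simp add: mult_right_mono del: power_Suc)
      finally show ?thesis .
    qed
    have "cmod B \<le> real q * cmod (\<Sum>i<g + 2. v ^ i) + cmod (\<Sum>i<g. v ^ i)"
      unfolding B_def by (rule order.trans[OF norm_triangle_ineq4]) (simp add: norm_mult)
    also have "\<dots> \<le> real q * ((real g + 2) * V ^ (g + 2)) + (real g + 2) * V ^ (g + 2)"
      using sumV[of "g + 2"] sumV[of g] by (intro add_mono mult_left_mono) auto
    finally have B: "cmod B \<le> (real q + 1) * (real g + 2) * V ^ (g + 2)" by (simp add: algebra_simps)
    have "cmod (1 - w) \<le> 2" using norm_triangle_ineq4[of 1 w] w rf(3) by simp
    have "cmod (Rest2 q g w) = cmod (1 - w) * (cmod (of_nat q * w ^ 2) ^ g * cmod B) / cmod d"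
      unfolding Rest2_def Let_def v_def[symmetric] B_def[symmetric] d_def[symmetric]
      by (simp add: norm_mult norm_divide norm_power mult.assoc)
    also have "\<dots> \<le> 2 * (cmod (of_nat q * w ^ 2) ^ g * ((real q + 1) * (real g + 2) * V ^ (g + 2))) / cmod d"
      using \<open>cmod (1 - w) \<le> 2\<close> B by (intro divide_right_mono mult_mono) auto
    also have "cmod (of_nat q * w ^ 2) ^ g * ((real q + 1) * (real g + 2) * V ^ (g + 2)) =
        (real q + 1) * (real g + 2) * V ^ 2 * (cmod (of_nat q * w ^ 2) * V) ^ g"
      by (simp only: power_mult_distrib power_add mult_ac)
    also have "\<dots> = (real q + 1) * V ^ 2 * ((real g + 2) * rr q s ^ g)" unfolding xV by simp
    also have "2 * \<dots> / cmod d \<le> 2 * ((real q + 1) * V ^ 2 * (2 * ((real g + 1) / real q ^ g))) / cmod d"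
    proof (intro divide_right_mono mult_left_mono)
      have "(real g + 2) * rr q s ^ g \<le> (2 * (real g + 1)) * (1 / real q ^ g)"
        using rg[of g] rf(1) by (intro mult_mono) auto
      thus "(real g + 2) * rr q s ^ g \<le> 2 * ((real g + 1) / real q ^ g)" by simp
    qed auto
    also have "\<dots> = 4 * (real q + 1) * V ^ 2 / cmod d * ((real g + 1) / real q ^ g)"
    proof -
      have "2 * (a * b * (2 * c)) / e = 4 * a * b / e * c" for a b c e :: real by simp
      thus ?thesis .
    qed
    finally have R: "cmod (Rest2 q g w) \<le> 4 * (real q + 1) * V ^ 2 / cmod d * ((real g + 1) / real q ^ g)" .
    have "cmod (w ^ (g + 1) / (of_nat q - 1)) = rr q s ^ (g + 1) / (real q - 1)"
      unfolding norm_divide cmod_q_minus_1[OF q] norm_power w ..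
    also have "\<dots> \<le> rr q s ^ (g + 1) / 1" using q rf(1) by (intro divide_left_mono) auto
    also have "\<dots> \<le> rr q s ^ g" using rf(1,3) by (simp add: mult_left_le_one_le)
    also have "\<dots> \<le> 1 / real q ^ g" by (rule rg)
    also have "\<dots> \<le> (real g + 1) / real q ^ g" by (intro divide_right_mono) auto
    finally have W: "cmod (w ^ (g + 1) / (of_nat q - 1)) \<le> (real g + 1) / real q ^ g" .
    have "Msq q g w - HJ2 q g w = w ^ (g + 1) / (of_nat q - 1) - Rest2 q g w" by (simp add: HJ2_def)
    also have "cmod \<dots> \<le> cmod (w ^ (g + 1) / (of_nat q - 1)) + cmod (Rest2 q g w)" by (rule norm_triangle_ineq4)
    also have "\<dots> \<le> K * ((real g + 1) / real q ^ g)"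
      unfolding K_def distrib_right mult_1 by (rule add_mono[OF W R])
    finally show "cmod (Msq q g w - HJ2 q g w) \<le> K * Dg q s g" using s by (simp add: Dg_def)
  qed
qed

text \<open>From Re s = 3/2 on, q^3 |w|^2 \<le> 1, whence q^e |w|^n \<le> q^(-n) for 2 e \<le> n, as
  squaring shows. Everything except 1/(1 - q w^2) is then within the tolerance.\<close>

lemma even_estimate_ge_3_halves:
  assumes q: "q \<ge> 2" and s: "Re s \<ge> 3/2" and w: "cmod w = rr q s"
  shows "cmod (Msq q g w - 1 / (1 - of_nat q * w ^ 2)) \<le> 8 * Dg q s g"
proof -
  have s': "Re s \<ge> 1/2" using s by simp
  note rf = rr_facts[OF q s']
  define r where "r = rr q s"
  have r0: "0 < r" "r < 1" using rf by (simp_all add: r_def)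
  have q1: "real q > 1" using q by simp
  have dec: "real q ^ e * r ^ n \<le> 1 / real q ^ n" if "2 * e \<le> n" for e n
  proof -
    have "(real q ^ e * r ^ n * real q ^ n) ^ 2 = real q ^ (2 * e + 2 * n) * r ^ (2 * n)"
      by (simp add: power_mult_distrib power_add power_mult[of _ 2] power2_eq_square)
    also have "\<dots> \<le> real q ^ (3 * n) * r ^ (2 * n)"
      using q1 r0 that by (intro mult_right_mono power_increasing) auto
    also have "\<dots> = (real q ^ 3 * r ^ 2) ^ n" by (simp add: power_mult_distrib power_mult)
    also have "\<dots> \<le> 1" using rf(6)[OF s] r0 by (intro power_le_one) (auto simp: r_def)
    finally have "real q ^ e * r ^ n * real q ^ n \<le> 1" using r0 by (simp add: power_le_one_iff abs_square_le_1)
    thus ?thesis using q1 by (simp add: pos_le_divide_eq)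
  qed
  have dec': "real q ^ e * r ^ n \<le> 1 / real q ^ g" if "2 * e \<le> n" "g \<le> n" for e n
  proof -
    have "1 / real q ^ n \<le> 1 / real q ^ g" using q1 that by (intro divide_left_mono power_increasing) auto
    thus ?thesis using dec[OF that(1)] by linarith
  qed
  define x where "x = of_nat q * w ^ 2"
  have cx: "cmod x = real q * r ^ 2" by (simp add: x_def r_def norm_mult norm_power w)
  also have "\<dots> \<le> 1 / real q ^ 2" using dec[of 1 2] by simp
  also have "\<dots> \<le> 1 / 2"
    using q1 q by (intro divide_left_mono) (auto simp: power2_eq_square intro: order.trans[of 2 "real q"])
  finally have x2: "cmod x \<le> 1 / 2" .
  have nx: "cmod (1 - x) \<ge> 1 / 2" using norm_triangle_ineq2[of 1 x] x2 by simp
  hence x1: "1 - x \<noteq> 0" by auto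
  let ?a = "g div 2 + 1"
  have "(1 - x) * (\<Sum>l\<le>g div 2. x ^ l) = 1 - x ^ ?a"
    using one_diff_power_eq[of x ?a] by (simp add: lessThan_Suc_atMost)
  hence "(\<Sum>l\<le>g div 2. x ^ l) - 1 / (1 - x) = - (x ^ ?a / (1 - x))" using x1 by (rule geometric_tail)
  hence "cmod ((\<Sum>l\<le>g div 2. x ^ l) - 1 / (1 - x)) = cmod x ^ ?a / cmod (1 - x)"
    by (simp only: norm_minus_cancel norm_divide norm_power)
  also have "\<dots> \<le> cmod x ^ ?a / (1 / 2)" using nx by (intro divide_left_mono) auto
  also have "cmod x ^ ?a = real q ^ ?a * r ^ (2 * ?a)" unfolding cx by (simp only: power_mult_distrib power_mult)
  also have "\<dots> \<le> 1 / real q ^ g" by (rule dec') auto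
  finally have t1: "cmod ((\<Sum>l\<le>g div 2. x ^ l) - 1 / (1 - x)) \<le> 2 / real q ^ g" by simp
  have "cmod (of_nat (Sq q g) * w ^ (g + 1)) = real (Sq q g) * r ^ (g + 1)"
    by (simp only: norm_mult norm_of_nat norm_power w r_def)
  also have "\<dots> \<le> 2 * real q ^ (g div 2) * r ^ (g + 1)" using Sq_le[OF q] r0 by (intro mult_right_mono) auto
  also have "\<dots> \<le> 2 * (1 / real q ^ g)" 
  proof -
    have "real q ^ (g div 2) * r ^ (g + 1) \<le> 1 / real q ^ g" by (rule dec') auto
    thus ?thesis by (simp only: mult.assoc mult_le_cancel_left_pos zero_less_numeral)
  qed
  finally have t2: "cmod (of_nat (Sq q g) * w ^ (g + 1)) \<le> 2 / real q ^ g" by simp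
  have "cmod (\<Sum>k<g. of_nat q ^ (g - k) * of_nat (Sq q k) * w ^ (2 * g - k)) \<le> (\<Sum>k<g. 2 / real q ^ g)"
  proof (rule sum_norm_le)
    fix k assume k: "k \<in> {..<g}"
    have "real q ^ (g - k) * real (Sq q k) * r ^ (2 * g - k) \<le>
        real q ^ (g - k) * (2 * real q ^ (k div 2)) * r ^ (2 * g - k)"
      using Sq_le[OF q] r0 by (intro mult_right_mono mult_left_mono) auto
    also have "\<dots> = 2 * (real q ^ (g - k + k div 2) * r ^ (2 * g - k))" by (simp add: power_add)
    also have "\<dots> \<le> 2 * (1 / real q ^ g)" using k by (intro mult_left_mono dec') auto
    finally show "cmod (of_nat q ^ (g - k) * of_nat (Sq q k) * w ^ (2 * g - k)) \<le> 2 / real q ^ g"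
      by (simp add: norm_mult norm_power w r_def)
  qed
  hence "cmod (\<Sum>k<g. of_nat q ^ (g - k) * of_nat (Sq q k) * w ^ (2 * g - k)) \<le> 2 * real g / real q ^ g" by (simp add: mult.commute)
  moreover have "cmod (1 - w) \<le> 2" using norm_triangle_ineq4[of 1 w] w r0 by (simp add: r_def)
  ultimately have t3: "cmod ((1 - w) * (\<Sum>k<g. of_nat q ^ (g - k) * of_nat (Sq q k) * w ^ (2 * g - k))) \<le> 2 * (2 * real g / real q ^ g)"
    unfolding norm_mult by (intro mult_mono) auto
  define Y where "Y = (1 - w) * (\<Sum>k<g. of_nat q ^ (g - k) * of_nat (Sq q k) * w ^ (2 * g - k))"
  have "Msq q g w - 1 / (1 - x) = ((\<Sum>l\<le>g div 2. x ^ l) - 1 / (1 - x)) - of_nat (Sq q g) * w ^ (g + 1) + Y"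
    unfolding Msq_split x_def Y_def by simp
  also have "cmod \<dots> \<le> cmod ((\<Sum>l\<le>g div 2. x ^ l) - 1 / (1 - x)) + cmod (of_nat (Sq q g) * w ^ (g + 1)) + cmod Y"
    by (intro order.trans[OF norm_triangle_ineq] add_mono norm_triangle_ineq4 order.refl)
  also have "\<dots> \<le> 2 / real q ^ g + 2 / real q ^ g + 2 * (2 * real g / real q ^ g)"
    using t1 t2 t3 by (intro add_mono) (simp_all add: Y_def)
  also have "\<dots> = 4 * ((real g + 1) / real q ^ g)" by (simp add: add_divide_distrib algebra_simps)
  also have "\<dots> \<le> 8 * ((real g + 1) / real q ^ g)" by (intro mult_right_mono) auto
  finally show ?thesis using s by (simp add: Dg_def x_def)
qed

lemma even_estimate_at_one:
  assumes q: "q \<ge> 2" and g: "g \<ge> 1"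
  shows "cmod (Msq q g (1 / of_nat q) - of_nat q / (of_nat q - 1)) \<le> 4 * Dg q 1 g"
proof -
  define w where "w = (1 / of_nat q :: complex)"
  have w: "cmod w = 1 / real q" "cmod w \<le> 1" using q by (simp_all add: w_def norm_divide)
  have "cmod ((w - 2) / (of_nat q - 1)) = cmod (w - 2) / (real q - 1)"
    unfolding norm_divide cmod_q_minus_1[OF q] ..
  also have "\<dots> \<le> cmod (w - 2) / 1" using q by (intro divide_left_mono) auto
  also have "\<dots> \<le> 3" using norm_triangle_ineq4[of w 2] w(2) by simp
  finally have 1: "cmod ((w - 2) / (of_nat q - 1)) \<le> 3" .
  have 2: "cmod (of_nat g * w) \<le> real g" using w(2) by (simp add: norm_mult mult_left_le)
  have "cmod (Msq q g w - of_nat q / (of_nat q - 1)) = cmod ((w - 2) / (of_nat q - 1) - of_nat g * w) * (1 / real q) ^ g"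
    unfolding w_def Msq_at_one[OF q g] by (simp add: norm_mult norm_power norm_divide)
  also have "\<dots> \<le> (3 + real g) * (1 / real q) ^ g"
  proof (intro mult_right_mono)
    show "cmod ((w - 2) / (of_nat q - 1) - of_nat g * w) \<le> 3 + real g"
      by (rule order.trans[OF norm_triangle_ineq4]) (use 1 2 in linarith)
  qed simp
  also have "\<dots> \<le> (4 * (real g + 1)) * (1 / real q) ^ g" by (intro mult_right_mono) auto
  also have "\<dots> = 4 * Dg q 1 g" by (simp add: Dg_def power_one_over)
  finally show ?thesis by (simp add: w_def)
qed

lemma powr_half_square: "q > 0 \<Longrightarrow> s = 1/2 \<Longrightarrow> of_nat q * (of_nat q powr (- s :: complex)) ^ 2 = 1"
  using powr_1_minus_2[of q s] by (simp del: eq_divide_eq_numeral1)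

text \<open>For Re s < 1 the stated term equals the exact sum, removable singularities included; for
  Re s \<ge> 1 a tail is cut off.\<close>

lemma Imain_estimate:
  assumes q: "q \<ge> 2" and s: "Re s \<ge> 1/2"
  shows "cmod ((\<Sum>j\<le>g. (of_nat q * (of_nat q powr (- s)) ^ 2) ^ j) - Imain q g s) \<le> 2 * Dg q s g"
proof -
  define H :: "complex \<Rightarrow> complex" where "H = (\<lambda>w. \<Sum>j\<le>g. (of_nat q * w ^ 2) ^ j)"
  have q0: "q > 0" using q by simp
  have D0: "0 \<le> 2 * Dg q s g" by (simp add: Dg_def rr_def)
  consider "s = 1/2" | "s \<noteq> 1/2" "Re s < 1" | "Re s \<ge> 1" by linarith
  thus ?thesis
  proof cases
    case 1
    thus ?thesis using powr_half_square[OF q0 1] D0 by (simp add: Imain_def add.commute)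
  next
    case 2
    define \<Phi> :: "complex \<Rightarrow> complex" where
      "\<Phi> = (\<lambda>w. 1 / (1 - of_nat q * w ^ 2) * (1 - (of_nat q * w ^ 2) ^ (g + 1)))"
    have "zetaA q (2 * z) * (1 - of_nat q powr ((1 + of_nat g) * (1 - 2 * z))) = \<Phi> (1 * of_nat q powr (- z))" for z
      using powr_of_nat_mult[OF q0, of "g + 1" "1 - 2 * z"]
      by (simp add: \<Phi>_def zetaA_double[OF q0] powr_1_minus_2[OF q0])
    hence "Imain q g s = remove_sings (\<lambda>z. \<Phi> (1 * of_nat q powr (- z))) s"
      using 2 by (simp only: Imain_def if_False if_True)
    also have "\<dots> = H (1 * of_nat q powr (- s))"
    proof (rule remove_sings_powr[OF q _ finite_exceptional[OF q0]])
      fix w :: complex assume w: "w \<notin> {w. of_nat q * w ^ 2 = 1}"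
      have "(1 - of_nat q * w ^ 2) * H w = 1 - (of_nat q * w ^ 2) ^ (g + 1)"
        unfolding H_def using one_diff_power_eq[of "of_nat q * w ^ 2" "g + 1"] by (simp add: lessThan_Suc_atMost)
      moreover have "1 - of_nat q * w ^ 2 \<noteq> 0" using w by simp
      ultimately show "\<Phi> w = H w" unfolding \<Phi>_def by (simp add: divide_eq_eq mult.commute)
    qed (auto simp: H_def intro!: continuous_intros)
    finally show ?thesis using D0 by (simp add: H_def)
  next
    case 3
    moreover from this have "s \<noteq> 1/2" by (auto simp del: eq_divide_eq_numeral1)
    ultimately have "Imain q g s = 1 / (1 - of_nat q * (of_nat q powr (- s)) ^ 2)"
      by (simp add: Imain_def zetaA_double[OF q0])
    thus ?thesis using odd_estimate_ge1[OF q 3 cmod_powr_rr] by simp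
  qed
qed

text \<open>The sign e = 1 or -1 treats J and K together: it enters through w only, and q w^2 does
  not depend on it.\<close>

lemma even_estimate:
  fixes e s :: complex
  assumes q: "q \<ge> 2" and s: "Re s \<ge> 1/2" and e: "cmod e = 1" "e ^ 2 = 1"
  defines "w \<equiv> e * of_nat q powr (- s)"
  defines "Main \<equiv> \<lambda>g. if s = 1/2 then of_nat g + 1 - w / (1 - w)
      else if Re s < 1 then remove_sings (\<lambda>z. FJ1 q g (e * of_nat q powr (- z))) s
      else if Re s < 3/2 then remove_sings (\<lambda>z. FJ2 q g (e * of_nat q powr (- z))) s
      else 1 / (1 - of_nat q * w ^ 2)"
  shows "\<exists>K\<ge>0. \<forall>g\<ge>1. cmod (Msq q g w - Main g) \<le> K * Dg q s g"
proof -
  have q0: "q > 0" using q by simp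
  have e0: "e \<noteq> 0" using e by auto
  have w: "cmod w = rr q s" using e by (simp add: w_def norm_mult cmod_powr_rr)
  consider "Re s < 1" | "1 \<le> Re s" "Re s < 3/2" | "Re s \<ge> 3/2" by linarith
  thus ?thesis
  proof cases
    case 1
    have H: "Main g = HJ1 q g w" if g: "g \<ge> 1" for g
    proof (cases "s = 1/2")
      case True
      have "of_nat q * w ^ 2 = 1" using e(2) powr_half_square[OF q0 True] by (simp add: w_def power_mult_distrib)
      moreover have "w \<noteq> 1" using w rr_facts(3)[OF q s] by auto
      ultimately show ?thesis using True HJ1_central[OF q _ _ g] by (simp add: Main_def)
    next
      case False
      have "1 / (of_nat q * w) \<noteq> 1" by (rule even_estimate_lt1(2)[OF q s 1 w order.refl])
      thus ?thesis using False 1 remove_sings_FJ1[OF q e0, of s g] by (simp add: Main_def w_def)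
    qed
    show ?thesis
    proof (intro exI[of _ "1 + cmod (cfac q w)"] conjI allI impI)
      show "cmod (Msq q g w - Main g) \<le> (1 + cmod (cfac q w)) * Dg q s g" if "g \<ge> 1" for g
        unfolding H[OF that] by (rule even_estimate_lt1(1)[OF q s 1 w that])
    qed simp
  next
    case 2
    have s1: "s \<noteq> 1/2" using 2 by (auto simp del: eq_divide_eq_numeral1)
    have "cmod (of_nat q * w ^ 2) = (real q * rr q s) * rr q s" by (simp add: norm_mult norm_power w power2_eq_square)
    also have "\<dots> \<le> 1 * rr q s" using rr_facts(1,5)[OF q s] 2 by (intro mult_right_mono) auto
    also have "\<dots> < 1" using rr_facts(3)[OF q s] by simp
    finally have x: "of_nat q * w ^ 2 \<noteq> 1" by auto
    have H: "Main g = HJ2 q g w" if g: "g \<ge> 1" for g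
      using 2 s1 remove_sings_FJ2[OF q e0 g, of s] x by (simp add: Main_def w_def)
    obtain K where "K \<ge> 0" "\<forall>g. cmod (Msq q g w - HJ2 q g w) \<le> K * Dg q s g"
      using even_estimate_ge1[OF q 2(1) w] by blast
    thus ?thesis using H by (intro exI[of _ K]) auto
  next
    case 3
    moreover from this have "s \<noteq> 1/2" by (auto simp del: eq_divide_eq_numeral1)
    ultimately have "Main g = 1 / (1 - of_nat q * w ^ 2)" for g by (simp add: Main_def)
    thus ?thesis using even_estimate_ge_3_halves[OF q 3 w] by (intro exI[of _ 8]) auto
  qed
qed

lemma Jmain_estimate:
  assumes q: "q \<ge> 2" and s: "Re s \<ge> 1/2"
  shows "\<exists>K\<ge>0. \<forall>g\<ge>1. cmod (Msq q g (of_nat q powr (- s)) - Jmain q g s) \<le> K * Dg q s g"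
proof -
  have q0: "q > 0" using q by simp
  define w where "w = 1 * (of_nat q powr (- s) :: complex)"
  have w0: "w \<noteq> 0" using q by (simp add: w_def powr_def)
  \<comment> \<open>Here 1/w is the square root of q, and zeta_A(1/2) = 1/(1 - 1/w).\<close>
  have half: "zetaA q (1/2) = - (w / (1 - w))" if "s = 1/2"
  proof -
    have p: "of_nat q powr (1 - 1/2 :: complex) = 1 / w" unfolding w_def that by (simp add: powr_minus field_simps)
    have "1 - 1 / w = - ((1 - w) / w)" using w0 by (simp add: field_simps)
    thus ?thesis unfolding zetaA_def p by simp
  qed
  have J: "Jmain q g s = (if s = 1/2 then of_nat g + 1 - w / (1 - w)
      else if Re s < 1 then remove_sings (\<lambda>z. FJ1 q g (1 * of_nat q powr (- z))) s
      else if Re s < 3/2 then remove_sings (\<lambda>z. FJ2 q g (1 * of_nat q powr (- z))) s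
      else 1 / (1 - of_nat q * w ^ 2))" if "g \<ge> 1" for g
    unfolding Jmain_def J_eq_FJ[OF q that] unfolding zetaA_double[OF q0] using half by (simp add: w_def)
  show ?thesis
    using even_estimate[OF q s, of 1] J unfolding w_def by simp
qed

lemma Kmain_estimate:
  assumes q: "q \<ge> 2" and s: "Re s \<ge> 1/2"
  shows "\<exists>K\<ge>0. \<forall>g\<ge>1. cmod (Msq q g (- (of_nat q powr (- s))) - Kmain q g s) \<le> K * Dg q s g"
proof -
  have q0: "q > 0" using q by simp
  define w where "w = - 1 * (of_nat q powr (- s) :: complex)"
  have w0: "w \<noteq> 0" using q by (simp add: w_def powr_def)
  \<comment> \<open>Now 1/w is minus the square root of q: the quotient is (1 + 1/w)/(1 - 1/w^2) =
    1/(1 - 1/w).\<close>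
  have half: "zetaA q 0 * inverse (zetaA q (1/2)) = - (w / (1 - w))" if "s = 1/2"
  proof -
    have "of_nat q powr (1 - 1/2 :: complex) = - (1 / w)" unfolding w_def that by (simp add: powr_minus field_simps)
    moreover have "of_nat q powr (1 - 0 :: complex) = 1 / w ^ 2"
      using powr_half_square[OF q0 that] w0 by (simp add: w_def field_simps)
    ultimately have z: "zetaA q (1/2) = 1 / (1 + 1 / w)" "zetaA q 0 = 1 / (1 - 1 / w ^ 2)" by (simp_all add: zetaA_def)
    have "cmod w < 1" using rr_facts(3)[OF q s] by (simp add: w_def norm_mult cmod_powr_rr)
    hence w1: "1 - w \<noteq> 0" "1 + w \<noteq> 0" by (auto simp: add_eq_0_iff)
    have "1 - 1 / w ^ 2 = - ((1 - w) * (1 + w) / w ^ 2)" "1 + 1 / w = (1 + w) / w"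
      using w0 by (simp_all add: field_simps power2_eq_square)
    thus ?thesis unfolding z using w0 w1 by (simp add: power2_eq_square)
  qed
  have K: "Kmain q g s = (if s = 1/2 then of_nat g + 1 - w / (1 - w)
      else if Re s < 1 then remove_sings (\<lambda>z. FJ1 q g (- 1 * of_nat q powr (- z))) s
      else if Re s < 3/2 then remove_sings (\<lambda>z. FJ2 q g (- 1 * of_nat q powr (- z))) s
      else 1 / (1 - of_nat q * w ^ 2))" if "g \<ge> 1" for g
    unfolding Kmain_def K_eq_FJ[OF q that] unfolding zetaA_double[OF q0] using half by (simp add: w_def)
  show ?thesis
    using even_estimate[OF q s, of "- 1"] K unfolding w_def by simp
qed

theorem theorem2p3:
  fixes \<gamma> :: "'a::{field,finite}" and q :: nat
  assumes q_def: "q = CARD('a)"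
    and q_odd: "odd q"
    and \<gamma>_gen: "\<gamma> \<noteq> 0" "\<forall>x::'a. x \<noteq> 0 \<longrightarrow> (\<exists>n::nat. x = \<gamma> ^ n)"
  shows
    "(\<forall>s::complex. Re s \<ge> 1/2 \<longrightarrow>
        (\<lambda>g::nat. (\<Sum>P\<in>(monic_irreds (2*g+1) :: 'a poly set). Lfun s P)
              - Imain q g s * N_over_log q (q ^ (2*g+1)))
          \<in> O[at_top](\<lambda>g. err q s (q ^ (2*g+1))))
   \<and> ((\<forall>\<epsilon>::real. \<epsilon> > 0 \<longrightarrow> (\<forall>s::complex. Re s \<ge> 1/2 \<and> cmod (s - 1) > \<epsilon> \<longrightarrow>
        (\<lambda>g::nat. (\<Sum>P\<in>(monic_irreds (2*g+2) :: 'a poly set). Lfun s P)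
              - Jmain q g s * N_over_log q (q ^ (2*g+2)))
          \<in> O[at_top](\<lambda>g. err q s (q ^ (2*g+2)))))
      \<and> (\<lambda>g::nat. (\<Sum>P\<in>(monic_irreds (2*g+2) :: 'a poly set). Lfun 1 P)
              - zetaA q 2 * N_over_log q (q ^ (2*g+2)))
          \<in> O[at_top](\<lambda>g. err q 1 (q ^ (2*g+2))))
   \<and> (\<forall>s::complex. Re s \<ge> 1/2 \<longrightarrow>
        (\<lambda>g::nat. (\<Sum>P\<in>(monic_irreds (2*g+2) :: 'a poly set). Lfun s (smult \<gamma> P))
              - Kmain q g s * N_over_log q (q ^ (2*g+2)))
          \<in> O[at_top](\<lambda>g. err q s (q ^ (2*g+2))))"
proof -
  note odd = q_odd[unfolded q_def]
  have q: "q \<ge> 2" unfolding q_def by (rule card_ge_2)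
  have one: "of_nat q powr (- 1) = (1 / of_nat q :: complex)" using q by (simp add: powr_minus field_simps)
  have L: "(\<Sum>P\<in>(monic_irreds m :: 'a poly set). Lfun s P) =
      (\<Sum>P\<in>(monic_irreds m :: 'a poly set). \<Sum>n<m. of_int (chi_sum P n) * (of_nat q powr (- s)) ^ n)" for s m
    unfolding q_def by (intro sum.cong refl Lfun_prime[OF odd])
  have L\<gamma>: "(\<Sum>P\<in>(monic_irreds m :: 'a poly set). Lfun s (smult \<gamma> P)) =
      (\<Sum>P\<in>(monic_irreds m :: 'a poly set). \<Sum>n<m. of_int (chi_sum P n) * (- (of_nat q powr (- s))) ^ n)" for s m
    unfolding q_def by (intro sum.cong refl Lfun_generator_prime[OF odd _ \<gamma>_gen])
  have even: "(\<lambda>g. (\<Sum>P\<in>(monic_irreds (2 * g + 2) :: 'a poly set). \<Sum>n<2 * g + 2. of_int (chi_sum P n) * w ^ n)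
        - Main g * N_over_log q (q ^ (2 * g + 2))) \<in> O[at_top](\<lambda>g. err q s (q ^ (2 * g + 2)))"
    if "Re s \<ge> 1/2" "cmod w = rr q s" "\<exists>K\<ge>0. \<forall>g\<ge>1. cmod (Msq q g w - Main g) \<le> K * Dg q s g"
    for s w :: complex and Main :: "nat \<Rightarrow> complex"
    using that asymptotic_even[OF odd, of s w, folded q_def] by blast
  show ?thesis
  proof (intro conjI allI impI)
    fix s :: complex assume s: "Re s \<ge> 1/2"
    show "(\<lambda>g. (\<Sum>P\<in>(monic_irreds (2*g+1) :: 'a poly set). Lfun s P) - Imain q g s * N_over_log q (q ^ (2*g+1)))
        \<in> O[at_top](\<lambda>g. err q s (q ^ (2*g+1)))"
      unfolding L
      using asymptotic_odd[OF odd s, folded q_def, OF cmod_powr_rr _ Imain_estimate[OF q s]] by simp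
    show "(\<lambda>g. (\<Sum>P\<in>(monic_irreds (2*g+2) :: 'a poly set). Lfun s (smult \<gamma> P)) - Kmain q g s * N_over_log q (q ^ (2*g+2)))
        \<in> O[at_top](\<lambda>g. err q s (q ^ (2*g+2)))"
      unfolding L\<gamma> by (rule even[OF s _ Kmain_estimate[OF q s]]) (simp add: cmod_powr_rr)
  next
    fix \<epsilon> :: real and s :: complex assume "\<epsilon> > 0" and s: "Re s \<ge> 1/2 \<and> cmod (s - 1) > \<epsilon>"
    show "(\<lambda>g. (\<Sum>P\<in>(monic_irreds (2*g+2) :: 'a poly set). Lfun s P) - Jmain q g s * N_over_log q (q ^ (2*g+2)))
        \<in> O[at_top](\<lambda>g. err q s (q ^ (2*g+2)))"
      unfolding L using s by (intro even cmod_powr_rr Jmain_estimate[OF q]) auto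
  next
    \<comment> \<open>s = 1 is w = 1/q, where the exact value of \<open>Msq\<close> tends to q/(q -
      1) = zeta_A(2).\<close>
    have "\<exists>K\<ge>0. \<forall>g\<ge>1. cmod (Msq q g (of_nat q powr (- 1)) - zetaA q 2) \<le> K * Dg q 1 g"
      unfolding one zetaA_2[OF q] using even_estimate_at_one[OF q] by (intro exI[of _ 4]) auto
    thus "(\<lambda>g. (\<Sum>P\<in>(monic_irreds (2*g+2) :: 'a poly set). Lfun 1 P) - zetaA q 2 * N_over_log q (q ^ (2*g+2)))
        \<in> O[at_top](\<lambda>g. err q 1 (q ^ (2*g+2)))"
      unfolding L by (intro even cmod_powr_rr) auto
  qed
qed

end
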